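(* Let $\mathbb{F}_q$ be a finite field with $q$ elements, let $d\ge 2$ and $s\ge 2$ be integers, and let $a_1,\ldots,a_d\in\mathbb{F}_q$ all be nonzero. For $\boldsymbol{x}=(x_1,\ldots,x_d),\boldsymbol{y}=(y_1,\ldots,y_d)\in\mathbb{F}_q^d$ put $\|\boldsymbol{x}-\boldsymbol{y}\|_s=\sum_{i=1}^d a_i(x_i-y_i)^s\in\mathbb{F}_q$. For $E\subseteq \mathbb{F}_q^d\times\mathbb{F}_q^d$ define \[\Delta^s_{d,d}(E)=\left\{\left(\|x_1-y_1\|_s,\|x_2-y_2\|_s\right) : (x_1,x_2),(y_1,y_2)\in E\right\}\subseteq \mathbb{F}_q\times\mathbb{F}_q.\] If $|E|\gg q^{\frac{3d+1}{2}}$, then $|\Delta^s_{d,d}(E)|\gg q^2$.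
   Context: $X\ll Y$ (equivalently $Y\gg X$) means there is a constant $C>0$, independent of $q$ and of the set $E$, with $X\le CY$. Thus the statement means: there are constants $C,c>0$ (independent of $q$ and $E$) such that $|E|\ge C q^{\frac{3d+1}{2}}$ implies $|\Delta^s_{d,d}(E)|\ge c q^2$.
   Formalization: The formal theorem additionally assumes that s is not a power of the characteristic of F_q; without this the claim is false (e.g. s=2, q even, where the norm is the square of a linear form). *)

theory Defs
  imports Complex_Main "HOL-Library.FuncSet" "HOL-Algebra.Ring" "HOL-Algebra.Coset"
    "HOL-Computational_Algebra.Primes"
begin

text \<open>
  Fields are \<open>HOL-Algebra\<close> records rather than types of class \<open>field\<close>: the implied constants
  must be uniform over all finite fields, so fields have to be quantified inside the formula.
\<close>

text \<open>Extensional functions, so that a point is determined by its coordinates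
  \<open>1, \<dots>, d\<close> and cardinalities of sets of points are the intended ones.\<close>
definition points :: "'a ring \<Rightarrow> nat \<Rightarrow> (nat \<Rightarrow> 'a) set" where
  "points F d = {1..d} \<rightarrow>\<^sub>E carrier F"

definition diag_norm :: "'a ring \<Rightarrow> nat \<Rightarrow> nat \<Rightarrow> (nat \<Rightarrow> 'a) \<Rightarrow> (nat \<Rightarrow> 'a) \<Rightarrow> (nat \<Rightarrow> 'a) \<Rightarrow> 'a" where
  "diag_norm F d s a x y =
     (\<Oplus>\<^bsub>F\<^esub>i\<in>{1..d}. a i \<otimes>\<^bsub>F\<^esub> (x i \<ominus>\<^bsub>F\<^esub> y i) [^]\<^bsub>F\<^esub> s)"

definition distance_pairs ::
    "'a ring \<Rightarrow> nat \<Rightarrow> nat \<Rightarrow> (nat \<Rightarrow> 'a) \<Rightarrow> ((nat \<Rightarrow> 'a) \<times> (nat \<Rightarrow> 'a)) set \<Rightarrow> ('a \<times> 'a) set" where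
  "distance_pairs F d s a E =
     {(diag_norm F d s a x1 y1, diag_norm F d s a x2 y2) | x1 x2 y1 y2.
        (x1, x2) \<in> E \<and> (y1, y2) \<in> E}"

text \<open>
  The characteristic of a finite field \<open>F\<close> is the unique prime dividing \<open>order F\<close>. If \<open>s\<close> is a
  power of it, then \<open>z \<mapsto> z [^] s\<close> is additive and bijective, \<open>diag_norm\<close> is the image under this
  map of a linear form in \<open>x - y\<close>, and a lower bound of order \<open>q\<^sup>2\<close> fails for large \<open>q\<close>.
\<close>
definition char_power :: "'a ring \<Rightarrow> nat \<Rightarrow> bool" where
  "char_power F s \<longleftrightarrow>
     (\<exists>p k. Factorial_Ring.prime p \<and> p dvd order F \<and> s = p ^ k)"

end

theory Submission
  imports Defs "HOL-Algebra.Algebraic_Closure" "HOL-Algebra.Multiplicative_Group"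
    "HOL-Computational_Algebra.Fundamental_Theorem_Algebra"
begin

text \<open>
  Let \<open>\<psi>\<close> be a nontrivial additive character of \<open>F\<close>, and suppose that the characteristic does not divide
  \<open>s\<close>. Expanding the number of collisions of the pair of distances in characters \<open>(u\<^sub>1, u\<^sub>2)\<close> gives
  bilinear forms on \<open>E\<close> with product kernels, whose norms are products of the sums
  \<open>\<Sum>x. \<psi> (c x\<^sup>s + m x)\<close>. By Weil's bound each factor is at most \<open>s q\<^sup>1\<^sup>/\<^sup>2\<close> unless \<open>c = 0\<close>, so the
  dominant error comes from the \<open>2 q\<close> characters with one vanishing component; it is
  \<open>O(q \<cdot> |E|\<^sup>2 q\<^sup>3\<^sup>d)\<close> and is absorbed by the main term \<open>|E|\<^sup>4\<close> exactly in the stated range.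
  If \<open>s = p\<^sup>j s'\<close>, the distances are the images under a power of Frobenius of those with exponent \<open>s'\<close>.

  Weil's bound is proved by elementary means. The L-function is the generating series of the character
  over Frobenius-stable multisets in the algebraic closure (that is, over monic polynomials); Newton's
  identities make it a polynomial of degree less than \<open>s\<close>, and its logarithmic derivative generates the
  character sums \<open>S n\<close> over the extensions of degree \<open>n\<close>. Bombieri's form of Stepanov's method bounds the number
  of points on \<open>y\<^sup>q - y = c x\<^sup>s + m x - b\<close> from above, which yields \<open>S n = O(q\<^sup>n\<^sup>/\<^sup>2)\<close> with a constant
  depending on \<open>q\<close>. This suffices to place all zeros of the L-function outside the disc of radius
  \<open>q\<^sup>-\<^sup>1\<^sup>/\<^sup>2\<close>, and then \<open>S 1\<close> is minus the sum of the reciprocals of fewer than \<open>s\<close> such zeros.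
\<close>

text \<open>Stepanov's method bounds point numbers from above only. This suffices because the
  elements of \<open>fld n\<close> are distributed over the possible traces of \<open>f x\<close>:
  the deviations of the fibre sizes from their mean add up to zero, so upper bounds for all fibres
  control the absolute values as well. The constant may grow with q, and finitely many n may be left
  out, because only the radius of convergence of the series with coefficients \<open>S n\<close> is
  used. Uniformity in q enters through the degree of the L-function, which is bounded in terms of s
  alone.

  Weil's bound is required for every linear term \<open>m x\<close>, not just for
  \<open>m = 0\<close>: Fourier expansion of the kernel \<open>\<psi> (c (x - y)^s)\<close>
  diagonalises the bilinear form, and its eigenvalues are these sums.

  Passing from s to s' requires roots of the coefficients \<open>a i\<close> of p-power order; they
  exist because Frobenius permutes a finite field. The excluded exponents are those with
  \<open>s' = 1\<close>: there the sum with \<open>m = - c\<close> equals q, so cancellation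
  fails.\<close>

hide_const (open) Polynomial.order

text \<open>
  Fields occur as records, so the algebraic closure of \<open>F\<close> is not a type. To calculate in it with type
  class operations, it is embedded into a type of class \<open>comm_ring_1\<close>: the product of all commutative ring
  records over a given type. The extra factor \<open>int\<close> ensures \<open>0 \<noteq> 1\<close>.
\<close>

definition cring_family :: "('b ring \<Rightarrow> 'b) \<Rightarrow> bool" where
  "cring_family f \<longleftrightarrow> (\<forall>R. cring R \<longrightarrow> f R \<in> carrier R) \<and> (\<forall>R. \<not> cring R \<longrightarrow> f R = undefined)"

lemma cring_familyD: "cring_family f \<Longrightarrow> cring R \<Longrightarrow> f R \<in> carrier R"
    "cring_family f \<Longrightarrow> \<not> cring R \<Longrightarrow> f R = undefined"
  by (auto simp: cring_family_def)

lemma cring_familyI: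
  "(\<And>R. cring R \<Longrightarrow> g R \<in> carrier R) \<Longrightarrow> cring_family (\<lambda>R. if cring R then g R else undefined)"
  by (auto simp: cring_family_def)

typedef 'b cring_prod = "{(n :: int, f :: 'b ring \<Rightarrow> 'b). cring_family f}"
  by (rule exI[of _ "(0, \<lambda>R. if cring R then \<zero>\<^bsub>R\<^esub> else undefined)"])
    (auto intro!: cring_familyI cring.cring_simprules)

setup_lifting type_definition_cring_prod

instantiation cring_prod :: (type) comm_ring_1
begin

lift_definition zero_cring_prod :: "'a cring_prod"
  is "(0, \<lambda>R. if cring R then \<zero>\<^bsub>R\<^esub> else undefined)"
  by (auto intro!: cring_familyI cring.cring_simprules dest: cring_familyD)

lift_definition one_cring_prod :: "'a cring_prod"
  is "(1, \<lambda>R. if cring R then \<one>\<^bsub>R\<^esub> else undefined)"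
  by (auto intro!: cring_familyI cring.cring_simprules dest: cring_familyD)

lift_definition plus_cring_prod :: "'a cring_prod \<Rightarrow> 'a cring_prod \<Rightarrow> 'a cring_prod"
  is "\<lambda>(m, f) (n, g). (m + n, \<lambda>R. if cring R then f R \<oplus>\<^bsub>R\<^esub> g R else undefined)"
  by (auto intro!: cring_familyI cring.cring_simprules dest: cring_familyD)

lift_definition minus_cring_prod :: "'a cring_prod \<Rightarrow> 'a cring_prod \<Rightarrow> 'a cring_prod"
  is "\<lambda>(m, f) (n, g). (m - n, \<lambda>R. if cring R then f R \<ominus>\<^bsub>R\<^esub> g R else undefined)"
  by (auto intro!: cring_familyI cring.cring_simprules dest: cring_familyD)

lift_definition times_cring_prod :: "'a cring_prod \<Rightarrow> 'a cring_prod \<Rightarrow> 'a cring_prod"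
  is "\<lambda>(m, f) (n, g). (m * n, \<lambda>R. if cring R then f R \<otimes>\<^bsub>R\<^esub> g R else undefined)"
  by (auto intro!: cring_familyI cring.cring_simprules dest: cring_familyD)

lift_definition uminus_cring_prod :: "'a cring_prod \<Rightarrow> 'a cring_prod"
  is "\<lambda>(m, f). (- m, \<lambda>R. if cring R then \<ominus>\<^bsub>R\<^esub> f R else undefined)"
  by (auto intro!: cring_familyI cring.cring_simprules dest: cring_familyD)

instance
proof
  fix a b c :: "'a cring_prod"
  show "a * b * c = a * (b * c)" "a * b = b * a" "a + b + c = a + (b + c)" "a + b = b + a"
    "(a + b) * c = a * c + b * c"
    by (transfer, auto simp: fun_eq_iff algebra_simps intro!: cring.cring_simprules dest: cring_familyD)+
  show "0 + a = a" "- a + a = 0" "a - b = a + - b"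
    by (transfer, auto simp: fun_eq_iff cring.cring_simprules cring_familyD)+
  show "1 * a = a"
    by transfer (auto simp: fun_eq_iff cring_familyD intro!: cring.cring_simprules)
  show "(0 :: 'a cring_prod) \<noteq> 1"
    by transfer auto
qed

end

lift_definition proj_factor :: "'b ring \<Rightarrow> 'b cring_prod \<Rightarrow> 'b" is "\<lambda>R (n, f). f R" .

text \<open>Extension by zero to the other factors preserves sums and products, but it sends the
  unit of a commutative ring \<open>R\<close> to an idempotent different from \<open>1\<close>.
  Hence the embedded field carries its own unit \<open>e\<close>, and \<open>x ^ 0\<close> has to be
  handled with care.\<close>

lift_definition embed_factor :: "'b ring \<Rightarrow> 'b \<Rightarrow> 'b cring_prod"
  is "\<lambda>R x. (0, \<lambda>S. if cring S then (if S = R \<and> x \<in> carrier R then x else \<zero>\<^bsub>S\<^esub>) else undefined)"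
  by (auto intro!: cring_familyI cring.cring_simprules dest: cring_familyD)

context
  fixes R :: "'b ring"
  assumes R: "cring R"
begin

interpretation cring R by (rule R)

lemma proj_embed_factor: "x \<in> carrier R \<Longrightarrow> proj_factor R (embed_factor R x) = x"
  using R by transfer auto

lemma inj_embed_factor: "inj_on (embed_factor R) (carrier R)"
  by (rule inj_on_inverseI[of _ "proj_factor R"]) (rule proj_embed_factor)

lemma embed_factor_zero: "embed_factor R \<zero>\<^bsub>R\<^esub> = 0"
  using R by transfer (auto simp: fun_eq_iff)

lemma embed_factor_add:
  "x \<in> carrier R \<Longrightarrow> y \<in> carrier R \<Longrightarrow>
   embed_factor R (x \<oplus>\<^bsub>R\<^esub> y) = embed_factor R x + embed_factor R y"
  using R by transfer (auto simp: fun_eq_iff cring.cring_simprules cring_familyD)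

lemma embed_factor_uminus:
  "x \<in> carrier R \<Longrightarrow> embed_factor R (\<ominus>\<^bsub>R\<^esub> x) = - embed_factor R x"
  using R by transfer (auto simp: fun_eq_iff cring.cring_simprules cring_familyD)

lemma embed_factor_mult:
  "x \<in> carrier R \<Longrightarrow> y \<in> carrier R \<Longrightarrow>
   embed_factor R (x \<otimes>\<^bsub>R\<^esub> y) = embed_factor R x * embed_factor R y"
  using R by transfer (auto simp: fun_eq_iff cring.cring_simprules cring_familyD)

end

text \<open>
  The field laws hold on the subset \<open>U\<close> of a commutative ring type, with unit element \<open>e\<close> in place of \<open>1\<close>.
\<close>

locale alg_closed_subset =
  fixes U :: "'t :: comm_ring_1 set" and e :: 't
  assumes zero_mem: "0 \<in> U" and unit_mem: "e \<in> U" and unit_neq_0: "e \<noteq> 0"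
    and add_mem: "x \<in> U \<Longrightarrow> y \<in> U \<Longrightarrow> x + y \<in> U"
    and uminus_mem: "x \<in> U \<Longrightarrow> - x \<in> U"
    and mult_mem: "x \<in> U \<Longrightarrow> y \<in> U \<Longrightarrow> x * y \<in> U"
    and unit_mult: "x \<in> U \<Longrightarrow> e * x = x"
    and ex_inverse: "x \<in> U \<Longrightarrow> x \<noteq> 0 \<Longrightarrow> \<exists>y\<in>U. x * y = e"
    and ex_root: "n > 0 \<Longrightarrow> (\<And>i. i < n \<Longrightarrow> c i \<in> U) \<Longrightarrow> \<exists>x\<in>U. x ^ n + (\<Sum>i<n. c i * x ^ i) = 0"

text \<open>Most conditions are transported along the homomorphism. For \<open>ex_root\<close>, a
  monic polynomial of positive degree splits over \<open>L\<close>, so its multiset of roots has as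
  many elements as its degree and is not empty.\<close>

lemma alg_closed_subset_embed_factor:
  fixes L :: "'b ring"
  assumes "algebraically_closed L"
  shows "alg_closed_subset (embed_factor L ` carrier L) (embed_factor L \<one>\<^bsub>L\<^esub>)"
proof -
  interpret algebraically_closed L by fact
  let ?h = "embed_factor L"
  have cr: "cring L" by (rule is_cring)
  note h = embed_factor_zero[OF cr] embed_factor_add[OF cr] embed_factor_uminus[OF cr]
    embed_factor_mult[OF cr]
  note inj = inj_onD[OF inj_embed_factor[OF cr]]
  show ?thesis
  proof
    show "0 \<in> ?h ` carrier L" using h(1) by (metis image_eqI zero_closed)
    show "?h \<one>\<^bsub>L\<^esub> \<in> ?h ` carrier L" by auto
    show "?h \<one>\<^bsub>L\<^esub> \<noteq> 0"
      using inj[of "\<one>\<^bsub>L\<^esub>" "\<zero>\<^bsub>L\<^esub>"] h(1) by auto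
  next
    fix x y assume "x \<in> ?h ` carrier L" "y \<in> ?h ` carrier L"
    then show "x + y \<in> ?h ` carrier L" "x * y \<in> ?h ` carrier L"
      by (auto simp flip: h)
  next
    fix x assume x: "x \<in> ?h ` carrier L"
    then show "- x \<in> ?h ` carrier L" by (auto simp flip: h)
    show "?h \<one>\<^bsub>L\<^esub> * x = x" using x by (auto simp flip: h)
    assume "x \<noteq> 0"
    then obtain z where z: "z \<in> carrier L" "z \<noteq> \<zero>\<^bsub>L\<^esub>" "x = ?h z" using x h(1) by auto
    then have "inv\<^bsub>L\<^esub> z \<in> carrier L" "z \<otimes>\<^bsub>L\<^esub> inv\<^bsub>L\<^esub> z = \<one>\<^bsub>L\<^esub>"
      using field_Units by auto
    then show "\<exists>y\<in>?h ` carrier L. x * y = ?h \<one>\<^bsub>L\<^esub>"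
      using z h(4)[of z "inv\<^bsub>L\<^esub> z"] by auto
  next
    fix n :: nat and c :: "nat \<Rightarrow> 'b cring_prod"
    assume n: "n > 0" and c: "\<And>i. i < n \<Longrightarrow> c i \<in> ?h ` carrier L"
    have "\<forall>i. \<exists>b. i < n \<longrightarrow> b \<in> carrier L \<and> c i = ?h b" using c by blast
    then obtain b where b: "\<And>i. i < n \<Longrightarrow> b i \<in> carrier L" "\<And>i. i < n \<Longrightarrow> c i = ?h (b i)"
      by metis
    define B where "B = (\<lambda>m. rev (map b [0..<m]))"
    have set_B: "set (B m) \<subseteq> carrier L" if "m \<le> n" for m using b that by (auto simp: B_def)
    have hpow: "?h (x [^]\<^bsub>L\<^esub> m) = ?h x ^ m" if "x \<in> carrier L" "m > 0" for x and m :: nat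
      using that(2,1) by (induction m rule: nat_induct_non_zero) (auto simp: h mult.commute)
    have tm: "?h (y \<otimes>\<^bsub>L\<^esub> x [^]\<^bsub>L\<^esub> m) = ?h y * ?h x ^ m"
      if "x \<in> carrier L" "y \<in> carrier L" for x y and m :: nat
      using that by (cases "m = 0") (auto simp: h hpow)
    have ev: "?h (eval (B m) x) = (\<Sum>i<m. c i * ?h x ^ i)" if "x \<in> carrier L" "m \<le> n" for x m
      using that(2)
    proof (induction m)
      case 0
      then show ?case by (simp add: B_def h)
    next
      case (Suc m)
      have "B (Suc m) = b m # B m" "length (B m) = m" by (auto simp: B_def)
      moreover have "eval (B m) x \<in> carrier L"
        using eval_in_carrier[OF set_B that(1)] Suc by auto
      ultimately show ?case using Suc b that by (simp add: h(2) tm algebra_simps)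
    qed
    define P where "P = \<one>\<^bsub>L\<^esub> # B n"
    have "P \<in> carrier (poly_ring L)"
      using set_B[of n] unfolding sym[OF univ_poly_carrier] polynomial_def P_def by auto
    have "Polynomials.degree P = n" by (simp add: P_def B_def)
    then have "roots P \<noteq> {#}"
      using roots_over_carrier[OF \<open>P \<in> carrier (poly_ring L)\<close>] n unfolding splitted_def by auto
    then obtain x where "x \<in># roots P" by blast
    then have x: "x \<in> carrier L" "eval P x = \<zero>\<^bsub>L\<^esub>"
      using roots_mem_iff_is_root[OF \<open>P \<in> carrier (poly_ring L)\<close>] by (auto simp: is_root_def)
    have "eval P x = x [^]\<^bsub>L\<^esub> n \<oplus>\<^bsub>L\<^esub> eval (B n) x"
      using x(1) by (simp add: P_def B_def)
    then have "0 = ?h (x [^]\<^bsub>L\<^esub> n \<oplus>\<^bsub>L\<^esub> eval (B n) x)" using x h(1) by simp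
    also have "\<dots> = ?h x ^ n + (\<Sum>i<n. c i * ?h x ^ i)"
      using x(1) eval_in_carrier[OF set_B x(1), of n] n by (simp add: h hpow ev)
    finally show "\<exists>x\<in>?h ` carrier L. x ^ n + (\<Sum>i<n. c i * x ^ i) = 0"
      using x(1) by auto
  qed
qed

subsection \<open>Additive characters\<close>

definition additive_subgroup :: "'a :: ab_group_add set \<Rightarrow> bool" where
  "additive_subgroup H \<longleftrightarrow> 0 \<in> H \<and> (\<forall>x\<in>H. \<forall>y\<in>H. x + y \<in> H) \<and> (\<forall>x\<in>H. - x \<in> H)"

lemma additive_subgroup_diff: "additive_subgroup H \<Longrightarrow> x \<in> H \<Longrightarrow> y \<in> H \<Longrightarrow> x - y \<in> H"
  unfolding additive_subgroup_def by (metis diff_conv_add_uminus)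

lemma additive_subgroup_of_nat_mult:
  fixes H :: "'a :: comm_ring_1 set"
  shows "additive_subgroup H \<Longrightarrow> x \<in> H \<Longrightarrow> of_nat n * x \<in> H"
  by (induction n) (auto simp: additive_subgroup_def distrib_right)

lemma of_nat_mod_mult:
  fixes x :: "'a :: comm_ring_1"
  assumes "of_nat p * x = 0"
  shows "of_nat (n mod p) * x = of_nat n * x"
proof -
  have "of_nat n * x = of_nat (p * (n div p) + n mod p) * x" by simp
  also have "\<dots> = of_nat (n div p) * (of_nat p * x) + of_nat (n mod p) * x"
    by (simp only: of_nat_add of_nat_mult) (simp add: algebra_simps)
  finally show ?thesis using assms by simp
qed

text \<open>In an elementary abelian p-group, a maximal proper subgroup H and any x outside it
  generate the group, and the multiples of x by \<open>0, ..., p - 1\<close> represent the cosets of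
  H. Both the order of the group and a nontrivial character are read off from this
  splitting.\<close>

lemma ex_maximal_subgroup:
  fixes G :: "'a :: comm_ring_1 set"
  assumes G: "additive_subgroup G" "finite G" "G \<noteq> {0}"
    and p: "Factorial_Ring.prime p" "\<And>x. x \<in> G \<Longrightarrow> of_nat p * x = 0"
  shows "\<exists>H x. additive_subgroup H \<and> H \<subset> G \<and> x \<in> G - H \<and>
    bij_betw (\<lambda>(h, j). h + of_nat j * x) (H \<times> {..<p}) G"
proof -
  let ?S = "{H. additive_subgroup H \<and> H \<subset> G}"
  have "{0} \<in> ?S" using G by (auto simp: additive_subgroup_def)
  moreover have "finite ?S" by (rule finite_subset[of _ "Pow G"]) (use G(2) in auto)
  ultimately have "\<exists>H\<in>?S. \<forall>H'\<in>?S. H \<subseteq> H' \<longrightarrow> H = H'"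
    by (intro finite_has_maximal) auto
  then obtain H where H: "H \<in> ?S" and max: "\<And>H'. H' \<in> ?S \<Longrightarrow> H \<subseteq> H' \<Longrightarrow> H = H'"
    by (elim bexE) simp
  obtain x where x: "x \<in> G" "x \<notin> H" using H by blast
  have sub: "additive_subgroup H" "H \<subseteq> G" using H by auto
  have p0: "p > 0" using p(1) prime_gt_0_nat by blast
  let ?f = "\<lambda>(h, j). h + of_nat j * x"
  let ?H = "{h + of_nat j * x | h j. h \<in> H}"
  have px: "of_nat p * x = 0" using p(2) x by simp
  have neg: "- (of_nat j * x) = of_nat ((p - 1) * j) * x" for j
  proof -
    have "of_nat ((p - 1) * j) * x + of_nat j * x = of_nat ((p - 1) * j + j) * x"
      by (simp only: of_nat_add distrib_right)
    also have "(p - 1) * j + j = p * j" using p0 by (cases p) auto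
    also have "of_nat (p * j) * x = of_nat j * (of_nat p * x)" by (simp add: algebra_simps)
    finally have "of_nat ((p - 1) * j) * x + of_nat j * x = 0" using px by simp
    then show ?thesis by (metis add.commute minus_unique)
  qed
  have Hsub: "additive_subgroup ?H"
    unfolding additive_subgroup_def
  proof (intro conjI ballI)
    show "0 \<in> ?H" using sub(1) by (auto simp: additive_subgroup_def intro!: exI[of _ 0])
  next
    fix a b assume "a \<in> ?H" "b \<in> ?H"
    then obtain h i h' j where hj: "a = h + of_nat i * x" "b = h' + of_nat j * x" "h \<in> H" "h' \<in> H" by auto
    then have "a + b = (h + h') + of_nat (i + j) * x" by (simp add: algebra_simps)
    then show "a + b \<in> ?H" using hj sub(1) unfolding additive_subgroup_def by blast
  next
    fix a assume "a \<in> ?H"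
    then obtain h i where hj: "a = h + of_nat i * x" "h \<in> H" by auto
    then have "- a = - h + of_nat ((p - 1) * i) * x" unfolding neg[symmetric] by simp
    then show "- a \<in> ?H" using hj sub(1) unfolding additive_subgroup_def by blast
  qed
  have "x = 0 + of_nat 1 * x" by simp
  then have xH: "x \<in> ?H" using sub(1) unfolding additive_subgroup_def by blast
  have HG: "?H \<subseteq> G"
    using sub G(1) additive_subgroup_of_nat_mult[OF G(1) x(1)] by (auto simp: additive_subgroup_def)
  have "h = h + of_nat 0 * x" for h by simp
  then have "H \<subseteq> ?H" by blast
  then have HG_eq: "?H = G" using max[of ?H] Hsub HG xH x(2) by blast
  have img: "?f ` (H \<times> {..<p}) = G"
  proof
    show "?f ` (H \<times> {..<p}) \<subseteq> G" using HG_eq by auto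
    show "G \<subseteq> ?f ` (H \<times> {..<p})"
    proof
      fix g assume "g \<in> G"
      then obtain h j where "g = h + of_nat j * x" "h \<in> H" using HG_eq by auto
      then have "g = ?f (h, j mod p)" "(h, j mod p) \<in> H \<times> {..<p}"
        using of_nat_mod_mult[OF px] p0 by auto
      then show "g \<in> ?f ` (H \<times> {..<p})" by blast
    qed
  qed
  \<comment> \<open>Two representations differ by the multiple \<open>j - i\<close> of x, which then
    lies in H; inverting \<open>j - i\<close> modulo p would put x itself into H.\<close>
  have key: False if "h \<in> H" "h' \<in> H" "h + of_nat i * x = h' + of_nat j * x" "i < j" "j < p" for h h' i j
  proof -
    have "of_nat (j - i) * x = h - h'" using that(3,4) by (simp add: of_nat_diff algebra_simps)
    then have m: "of_nat (j - i) * x \<in> H" using additive_subgroup_diff[OF sub(1)] that by simp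
    have "\<not> p dvd (j - i)" using that by (auto dest: dvd_imp_le)
    then have "coprime (j - i) p" using p(1) prime_imp_coprime coprime_commute by blast
    moreover have "p \<noteq> 1" using p(1) by auto
    ultimately obtain a b where ab: "(j - i) * a = p * b + 1" using coprime_bezout_strong by blast
    have "of_nat a * (of_nat (j - i) * x) = of_nat ((j - i) * a) * x"
      by (simp only: of_nat_mult mult.commute[of "j - i" a] mult.assoc)
    also have "\<dots> = of_nat b * (of_nat p * x) + x" unfolding ab by (simp add: algebra_simps)
    finally have "x = of_nat a * (of_nat (j - i) * x)" using px by simp
    then show False using additive_subgroup_of_nat_mult[OF sub(1) m, of a] x(2) by simp
  qed
  have "inj_on ?f (H \<times> {..<p})"
  proof (rule inj_onI, clarsimp)
    fix h i h' j assume a: "h \<in> H" "h' \<in> H" "i < p" "j < p" "h + of_nat i * x = h' + of_nat j * x"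
    then have "i = j" using key[of h h' i j] key[of h' h j i] by (metis linorder_neqE_nat)
    then show "h = h' \<and> i = j" using a by simp
  qed
  with img have "bij_betw ?f (H \<times> {..<p}) G" by (simp add: bij_betw_def)
  then show ?thesis using sub x H by blast
qed

lemma card_additive_p_group:
  fixes G :: "'a :: comm_ring_1 set"
  assumes "additive_subgroup G" "finite G" "Factorial_Ring.prime p" "\<And>x. x \<in> G \<Longrightarrow> of_nat p * x = 0"
  shows "\<exists>n. card G = p ^ n"
  using assms
proof (induction "card G" arbitrary: G rule: less_induct)
  case less
  show ?case
  proof (cases "G = {0}")
    case True
    then show ?thesis by (intro exI[of _ 0]) simp
  next
    case False
    then obtain H x where H: "additive_subgroup H" "H \<subset> G"
      "bij_betw (\<lambda>(h, j). h + of_nat j * x) (H \<times> {..<p}) G"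
      using ex_maximal_subgroup[OF less.prems(1,2) _ less.prems(3,4)] by blast
    then obtain n where "card H = p ^ n"
      using less.hyps[of H] less.prems psubset_card_mono[of G H] finite_subset[of H G]
      by (metis psubset_imp_subset subsetD)
    moreover have "card G = card H * p"
      using bij_betw_same_card[OF H(3)] by (simp add: card_cartesian_product)
    ultimately show ?thesis by (intro exI[of _ "Suc n"]) simp
  qed
qed

text \<open>The character is trivial on a maximal subgroup H and sends the complementary generator x
  to a primitive p-th root of unity; \<open>J\<close> is the coordinate along x.\<close>

lemma ex_nontrivial_character:
  fixes G :: "'a :: comm_ring_1 set"
  assumes G: "additive_subgroup G" "finite G" "G \<noteq> {0}"
    and p: "Factorial_Ring.prime p" "\<And>x. x \<in> G \<Longrightarrow> of_nat p * x = 0"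
  shows "\<exists>\<psi> :: 'a \<Rightarrow> complex. (\<forall>x\<in>G. \<forall>y\<in>G. \<psi> (x + y) = \<psi> x * \<psi> y) \<and>
    (\<forall>x\<in>G. norm (\<psi> x) = 1) \<and> (\<exists>x\<in>G. \<psi> x \<noteq> 1)"
proof -
  obtain H x where H: "additive_subgroup H" "H \<subset> G" "x \<in> G - H"
    and bij: "bij_betw (\<lambda>(h, j). h + of_nat j * x) (H \<times> {..<p}) G"
    using ex_maximal_subgroup[OF assms] by blast
  have p1: "p > 1" using p(1) prime_gt_1_nat by blast
  have px: "of_nat p * x = 0" using H p by blast
  define J where "J g = (SOME j. j < p \<and> g - of_nat j * x \<in> H)" for g
  define \<psi> where "\<psi> g = cis (2 * pi * real (J g) / real p)" for g
  have J: "J g = j" if "g = h + of_nat j * x" "h \<in> H" "j < p" for g h j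
  proof -
    have ex: "j < p \<and> g - of_nat j * x \<in> H" using that by simp
    have "J g < p \<and> g - of_nat (J g) * x \<in> H" unfolding J_def by (rule someI, rule ex)
    then have "(g - of_nat (J g) * x, J g) = (h, j)"
      by (intro inj_onD[OF bij_betw_imp_inj_on[OF bij]]) (use that in auto)
    then show ?thesis by simp
  qed
  have cis_mod: "cis (2 * pi * real (n mod p) / real p) = cis (2 * pi * real n / real p)" for n
  proof -
    have "real n = real p * real (n div p) + real (n mod p)"
      by (metis mult_div_mod_eq of_nat_add of_nat_mult)
    then have "2 * pi * real n / real p = 2 * pi * real (n mod p) / real p + 2 * pi * real (n div p)"
      using p1 by (simp add: field_simps)
    then show ?thesis by (simp flip: cis_mult add: cis_multiple_2pi)
  qed
  have rep: "\<exists>h\<in>H. \<exists>i<p. g = h + of_nat i * x" if "g \<in> G" for g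
  proof -
    have "g \<in> (\<lambda>(h, j). h + of_nat j * x) ` (H \<times> {..<p})"
      using that bij_betw_imp_surj_on[OF bij] by simp
    then show ?thesis by auto
  qed
  have "\<psi> (a + b) = \<psi> a * \<psi> b" if "a \<in> G" "b \<in> G" for a b
  proof -
    obtain h i where a: "a = h + of_nat i * x" "h \<in> H" "i < p"
      using rep[OF \<open>a \<in> G\<close>] by blast
    obtain h' j where b: "b = h' + of_nat j * x" "h' \<in> H" "j < p"
      using rep[OF \<open>b \<in> G\<close>] by blast
    have "a + b = (h + h') + of_nat (i + j) * x" using a b by (simp add: algebra_simps)
    also have "\<dots> = (h + h') + of_nat ((i + j) mod p) * x" by (simp only: of_nat_mod_mult[OF px])
    finally have "J (a + b) = (i + j) mod p"
      by (rule J) (use a b H(1) p1 in \<open>auto simp: additive_subgroup_def\<close>)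
    moreover have "J a = i" "J b = j" using J a b by auto
    ultimately show ?thesis
      unfolding \<psi>_def by (simp only: cis_mod cis_mult) (simp add: field_simps add_divide_distrib)
  qed
  moreover have "\<psi> x \<noteq> 1"
  proof
    have "J x = 1" using H p1 by (intro J[of _ 0]) (auto simp: additive_subgroup_def)
    moreover assume "\<psi> x = 1"
    ultimately have "cos (2 * pi / real p) = 1" "sin (2 * pi / real p) = 0"
      by (auto simp: \<psi>_def cis.ctr complex_eq_iff)
    then obtain n :: int where "2 * pi / real p = of_int n * 2 * pi" by (auto simp: cos_one_2pi_int)
    then have "1 = of_int n * real p" using p1 by (simp add: field_simps)
    then have "real_of_int 1 = real_of_int (n * int p)" by simp
    then have "1 = n * int p" by (simp only: of_int_eq_iff)
    then have "int p dvd 1" by (metis dvd_triv_right)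
    then show False using p1 by simp
  qed
  moreover have "norm (\<psi> g) = 1" for g by (simp add: \<psi>_def)
  ultimately show ?thesis using H by blast
qed

section \<open>Powers and roots of polynomials in the embedded field\<close>

context alg_closed_subset
begin

lemma minus_mem: "x \<in> U \<Longrightarrow> y \<in> U \<Longrightarrow> x - y \<in> U"
  using add_mem[of x "- y"] uminus_mem by simp

text \<open>\<open>x ^ 0 = 1\<close> need not lie in \<open>U\<close>, so a term of a polynomial is
  kept together with its coefficient.\<close>

lemma mult_power_mem: "c \<in> U \<Longrightarrow> x \<in> U \<Longrightarrow> c * x ^ i \<in> U"
  by (induction i arbitrary: c) (auto simp: mult_mem simp flip: mult.assoc)

lemma power_mem: "x \<in> U \<Longrightarrow> n > 0 \<Longrightarrow> x ^ n \<in> U"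
  using mult_power_mem[of x x "n - 1"] by (cases n) auto

lemma sum_mem: "(\<And>i. i \<in> I \<Longrightarrow> f i \<in> U) \<Longrightarrow> sum f I \<in> U"
  by (induction I rule: infinite_finite_induct) (auto simp: zero_mem add_mem)

lemma mult_eq_0: "x \<in> U \<Longrightarrow> y \<in> U \<Longrightarrow> x * y = 0 \<Longrightarrow> x = 0 \<or> y = 0"
proof -
  assume x: "x \<in> U" "y \<in> U" "x * y = 0"
  show "x = 0 \<or> y = 0"
  proof (cases "x = 0")
    case False
    then obtain z where "x * z = e" using ex_inverse x by blast
    then have "y = (x * z) * y" using unit_mult x by simp
    also have "\<dots> = z * (x * y)" by (simp add: ac_simps)
    finally show ?thesis using x by simp
  qed simp
qed

lemma power_eq_0:
  assumes "x \<in> U" "n > 0" "x ^ n = 0"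
  shows "x = 0"
  using assms(2,1,3)
proof (induction n rule: nat_induct_non_zero)
  case (Suc n)
  then show ?case using mult_eq_0[of x "x ^ n"] power_mem[of x n] by auto
qed auto

lemma mult_cancel: "x \<in> U \<Longrightarrow> x \<noteq> 0 \<Longrightarrow> y \<in> U \<Longrightarrow> z \<in> U \<Longrightarrow> x * y = x * z \<Longrightarrow> y = z"
  using mult_eq_0[of x "y - z"] minus_mem[of y z] by (auto simp: right_diff_distrib)

text \<open>Induction by division by \<open>x - a\<close> for a zero a: the quotient has one
  coefficient fewer and, \<open>U\<close> having no zero divisors, still vanishes at the remaining
  zeros.\<close>

lemma card_roots_le:
  assumes "finite S" "S \<subseteq> U" "card S \<ge> n" "\<And>i. i < n \<Longrightarrow> c i \<in> U"
    and "\<And>x. x \<in> S \<Longrightarrow> (\<Sum>i<n. c i * x ^ i) = 0" "i < n"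
  shows "c i = 0"
  using assms
proof (induction n arbitrary: S c i)
  case (Suc n)
  from Suc.prems(3) obtain a where a: "a \<in> S" by fastforce
  then have aU: "a \<in> U" using Suc.prems by blast
  \<comment> \<open>Coefficients of the quotient by \<open>x - a\<close> (synthetic
    division).\<close>
  define b where "b j = (\<Sum>i=Suc j..n. c i * a ^ (i - j - 1))" for j
  have bU: "b j \<in> U" if "j < n" for j unfolding b_def using Suc.prems aU by (auto intro!: sum_mem mult_power_mem)
  have diff: "(\<Sum>i\<le>n. c i * x ^ i) - (\<Sum>i\<le>n. c i * a ^ i) = (x - a) * (\<Sum>j<n. b j * x ^ j)" for x
  proof -
    have "(\<Sum>i\<le>n. c i * x ^ i) - (\<Sum>i\<le>n. c i * a ^ i) = (\<Sum>i\<le>n. c i * (x ^ i - a ^ i))"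
      by (simp add: sum_subtractf right_diff_distrib)
    also have "\<dots> = (\<Sum>i\<le>n. \<Sum>j<i. (x - a) * (c i * a ^ (i - Suc j) * x ^ j))"
      by (simp add: power_diff_sumr2 sum_distrib_left ac_simps)
    also have "\<dots> = (\<Sum>(i, j)\<in>(SIGMA i:{..n}. {..<i}). (x - a) * (c i * a ^ (i - Suc j) * x ^ j))"
      by (simp add: sum.Sigma)
    also have "\<dots> = (\<Sum>(j, i)\<in>(SIGMA j:{..<n}. {Suc j..n}). (x - a) * (c i * a ^ (i - Suc j) * x ^ j))"
      by (rule sum.reindex_bij_witness[of _ "\<lambda>(j, i). (i, j)" "\<lambda>(i, j). (j, i)"]) auto
    also have "\<dots> = (\<Sum>j<n. \<Sum>i=Suc j..n. (x - a) * (c i * a ^ (i - Suc j) * x ^ j))"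
      by (simp add: sum.Sigma)
    also have "\<dots> = (x - a) * (\<Sum>j<n. b j * x ^ j)"
      by (simp add: b_def sum_distrib_left sum_distrib_right ac_simps)
    finally show ?thesis .
  qed
  have b0: "b j = 0" if "j < n" for j
  proof (rule Suc.IH[of "S - {a}"])
    fix x assume x: "x \<in> S - {a}"
    then have "(x - a) * (\<Sum>j<n. b j * x ^ j) = 0"
      using diff[of x] Suc.prems(5)[of x] Suc.prems(5)[of a] a by (simp add: lessThan_Suc_atMost)
    moreover have "x - a \<in> U" "x - a \<noteq> 0" "(\<Sum>j<n. b j * x ^ j) \<in> U"
      using x Suc.prems(2) aU bU by (auto intro!: minus_mem sum_mem mult_power_mem)
    ultimately show "(\<Sum>j<n. b j * x ^ j) = 0" using mult_eq_0 by blast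
  qed (use Suc.prems a that bU in auto)
  \<comment> \<open>Read backwards, synthetic division recovers every coefficient but the constant
    one from the quotient; evaluation at a settles the constant one.\<close>
  have rec: "b j = c (Suc j) + a * b (Suc j)" if "j < n" for j
  proof -
    have "b j = c (Suc j) + (\<Sum>i=Suc (Suc j)..n. c i * a ^ (i - j - 1))"
      using that unfolding b_def by (subst sum.atLeast_Suc_atMost) auto
    also have "(\<Sum>i=Suc (Suc j)..n. c i * a ^ (i - j - 1)) = a * b (Suc j)"
      unfolding b_def sum_distrib_left
    proof (rule sum.cong[OF refl])
      fix i assume "i \<in> {Suc (Suc j)..n}"
      then have "i - j - 1 = Suc (i - Suc j - 1)" by auto
      then show "c i * a ^ (i - j - 1) = a * (c i * a ^ (i - Suc j - 1))" by (simp add: ac_simps)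
    qed
    finally show ?thesis .
  qed
  have pos: "c (Suc j) = 0" if "j < n" for j
  proof (cases "Suc j < n")
    case True
    then show ?thesis using rec[OF that] b0[OF that] b0[OF True] by simp
  next
    case False
    then have "b (Suc j) = 0" by (simp add: b_def)
    then show ?thesis using rec[OF that] b0[OF that] by simp
  qed
  show ?case
  proof (cases i)
    case 0
    have "0 = (\<Sum>j<Suc n. c j * a ^ j)" using Suc.prems(5)[OF a] by simp
    also have "\<dots> = c 0 + (\<Sum>j<n. c (Suc j) * a ^ Suc j)" by (subst sum.lessThan_Suc_shift) simp
    finally show ?thesis using pos 0 by simp
  next
    case (Suc j)
    then show ?thesis using pos \<open>i < Suc n\<close> by simp
  qed
qed auto

lemma finite_power_fixed:
  assumes "n > 1"
  shows "finite {x \<in> U. x ^ n = x}" "card {x \<in> U. x ^ n = x} \<le> n"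
proof -
  let ?Z = "{x \<in> U. x ^ n = x}"
  have "\<not> (\<exists>S\<subseteq>?Z. finite S \<and> card S = Suc n)"
  proof
    assume "\<exists>S\<subseteq>?Z. finite S \<and> card S = Suc n"
    then obtain S where S: "S \<subseteq> ?Z" "finite S" "card S = Suc n" by blast
    let ?c = "\<lambda>i. if i = n then e else if i = 1 then - e else 0"
    have "?c n = 0"
    proof (rule card_roots_le[OF S(2), where n = "Suc n" and i = n and c = ?c])
      fix x assume "x \<in> S"
      then have x: "x \<in> U" "x ^ n = x" using S by auto
      have "(\<Sum>i<Suc n. ?c i * x ^ i) = (\<Sum>i\<in>{1, n}. ?c i * x ^ i)"
        using assms by (intro sum.mono_neutral_right) auto
      then show "(\<Sum>i<Suc n. ?c i * x ^ i) = 0" using assms x by simp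
    qed (use S zero_mem unit_mem uminus_mem in auto)
    then show False using unit_neq_0 by simp
  qed
  note no = this
  show fin: "finite ?Z"
    using no infinite_arbitrarily_large[of ?Z "Suc n"] by blast
  show "card ?Z \<le> n"
  proof (rule ccontr)
    assume "\<not> card ?Z \<le> n"
    then have "Suc n \<le> card ?Z" by simp
    from obtain_subset_with_card_n[OF this] obtain S where "S \<subseteq> ?Z" "card S = Suc n" "finite S" .
    then show False using no by blast
  qed
qed

end

subsection \<open>Frobenius-stable multisets and their elementary symmetric functions\<close>

text \<open>The reversed polynomial with roots \<open>M\<close>: its n-th coefficient is
  \<open>(-1)^n\<close> times the n-th elementary symmetric function. Reversal makes the constant
  term 1.\<close>

definition recip_poly :: "'a :: comm_ring_1 multiset \<Rightarrow> 'a poly" where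
  "recip_poly M = (\<Prod>x\<in>#M. [:1, - x:])"

definition power_sum :: "nat \<Rightarrow> 'a :: comm_ring_1 multiset \<Rightarrow> 'a" where
  "power_sum i M = (\<Sum>x\<in>#M. x ^ i)"

lemma recip_poly_add: "recip_poly (add_mset x M) = [:1, - x:] * recip_poly M"
  by (simp add: recip_poly_def)

lemma coeff_linear_mult_Suc: "coeff ([:1, - x:] * P) (Suc n) = coeff P (Suc n) - x * coeff P n"
  for x :: "'a :: comm_ring_1"
  by (simp add: mult_pCons_left)

lemma coeff_recip_poly_0: "coeff (recip_poly M) 0 = 1"
  by (induction M) (simp_all add: recip_poly_def)

lemma coeff_recip_poly_Suc:
  "coeff (recip_poly (add_mset x M)) (Suc n) = coeff (recip_poly M) (Suc n) - x * coeff (recip_poly M) n"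
  unfolding recip_poly_add coeff_linear_mult_Suc ..

lemma coeff_recip_poly_beyond: "n > size M \<Longrightarrow> coeff (recip_poly M) n = 0"
proof (induction M arbitrary: n)
  case empty
  then show ?case by (simp add: recip_poly_def)
next
  case (add x M)
  then obtain m where "n = Suc m" "m > size M" by (cases n) auto
  then show ?case using add.IH[of n] add.IH[of m] by (simp add: coeff_recip_poly_Suc)
qed

text \<open>Zero divisors of the ring type do no harm: the constant term of
  \<open>[:1, - x:]\<close> is 1, so the coefficients of P are recovered recursively from the
  product.\<close>

lemma linear_mult_cancel:
  fixes x :: "'a :: comm_ring_1"
  assumes "[:1, - x:] * P = [:1, - x:] * Q"
  shows "P = Q"
proof (rule poly_eqI)
  fix n
  show "coeff P n = coeff Q n"
  proof (induction n)
    case 0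
    show ?case using arg_cong[OF assms, of "\<lambda>R. coeff R 0"] by simp
  next
    case (Suc n)
    have "coeff P (Suc n) - x * coeff P n = coeff Q (Suc n) - x * coeff Q n"
      using arg_cong[OF assms, of "\<lambda>R. coeff R (Suc n)"] unfolding coeff_linear_mult_Suc .
    then show ?case using Suc by simp
  qed
qed

text \<open>Coefficient form of \<open>T P' = - P (\<Sum> p_i T^i)\<close> for
  \<open>P = recip_poly M\<close>. Adding x to M multiplies P by \<open>1 - x T\<close> and adds to
  the series a geometric one, which collapses against that factor.\<close>

lemma newton_identity:
  "of_nat n * coeff (recip_poly M) n = - (\<Sum>i=1..n. power_sum i M * coeff (recip_poly M) (n - i))"
proof (induction M arbitrary: n)
  case empty
  show ?case
    by (cases n) (auto simp: recip_poly_def power_sum_def)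
next
  case (add x M)
  define c where "c = coeff (recip_poly M)"
  define c' where "c' = coeff (recip_poly (add_mset x M))"
  have c': "c' 0 = c 0" "c' (Suc m) = c (Suc m) - x * c m" for m
    unfolding c_def c'_def by (simp_all add: coeff_recip_poly_Suc coeff_recip_poly_0)
  have IH: "of_nat n * c n = - (\<Sum>i=1..n. power_sum i M * c (n - i))" for n
    using add.IH c_def by simp
  \<comment> \<open>Coefficient of \<open>T^(n+1)\<close> in
    \<open>(\<Sum> x^i T^i) (1 - x T) P = x T P\<close>, the sum starting at
    \<open>i = 1\<close>.\<close>
  have geo: "(\<Sum>i=1..Suc n. x ^ i * c' (Suc n - i)) = x * c n" for n
  proof (induction n)
    case (Suc n)
    have "(\<Sum>i=1..Suc (Suc n). x ^ i * c' (Suc (Suc n) - i)) =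
        x * c' (Suc n) + (\<Sum>i=Suc 1..Suc (Suc n). x ^ i * c' (Suc (Suc n) - i))"
      by (subst sum.atLeast_Suc_atMost) auto
    also have "(\<Sum>i=Suc 1..Suc (Suc n). x ^ i * c' (Suc (Suc n) - i)) = x * (\<Sum>i=1..Suc n. x ^ i * c' (Suc n - i))"
      by (simp add: sum.shift_bounds_cl_Suc_ivl sum_distrib_left mult.assoc del: sum.cl_ivl_Suc)
    finally show ?case unfolding Suc.IH by (simp add: c' algebra_simps del: sum.cl_ivl_Suc)
  qed (simp add: c')
  show ?case
  proof (cases n)
    case 0
    then show ?thesis by simp
  next
    case (Suc m)
    have "(\<Sum>i=1..n. power_sum i (add_mset x M) * c' (n - i)) =
      (\<Sum>i=1..n. power_sum i M * c' (n - i)) + (\<Sum>i=1..n. x ^ i * c' (n - i))"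
      by (simp add: power_sum_def distrib_right sum.distrib algebra_simps)
    also have "(\<Sum>i=1..n. x ^ i * c' (n - i)) = x * c m" using geo[of m] Suc by simp
    also have "(\<Sum>i=1..n. power_sum i M * c' (n - i)) =
       (\<Sum>i=1..n. power_sum i M * c (n - i)) - x * (\<Sum>i=1..m. power_sum i M * c (m - i))"
    proof -
      have "(\<Sum>i=1..n. power_sum i M * c' (n - i)) =
         (\<Sum>i=1..m. power_sum i M * c' (n - i)) + power_sum n M * c 0"
        using Suc by (simp add: c')
      also have "(\<Sum>i=1..m. power_sum i M * c' (n - i)) =
        (\<Sum>i=1..m. power_sum i M * c (n - i) - x * (power_sum i M * c (m - i)))"
        using Suc by (intro sum.cong) (auto simp: Suc_diff_le c' algebra_simps)
      finally show ?thesis using Suc by (simp add: sum_subtractf sum_distrib_left)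
    qed
    also have "(\<Sum>i=1..n. power_sum i M * c (n - i)) = - (of_nat n * c n)" using IH[of n] by simp
    also have "(\<Sum>i=1..m. power_sum i M * c (m - i)) = - (of_nat m * c m)" using IH[of m] by simp
    finally have "- (\<Sum>i=1..n. power_sum i (add_mset x M) * c' (n - i)) = of_nat n * c n - x * of_nat (Suc m) * c m"
      by (simp add: algebra_simps)
    also have "\<dots> = of_nat n * c' n" using Suc by (simp add: c' algebra_simps)
    finally show ?thesis by (simp add: c'_def)
  qed
qed

lemma prod_mset_diff_expand:
  "(\<Sum>i\<le>size M. coeff (recip_poly M) i * t ^ (size M - i)) = (\<Prod>x\<in>#M. t - x)"
proof (induction M)
  case empty
  then show ?case by (simp add: recip_poly_def)
next
  case (add x M)
  let ?c = "coeff (recip_poly M)" and ?n = "size M"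
  have "(\<Sum>i\<le>Suc ?n. coeff (recip_poly (add_mset x M)) i * t ^ (Suc ?n - i)) =
     t ^ Suc ?n + (\<Sum>i\<le>?n. (?c (Suc i) - x * ?c i) * t ^ (?n - i))"
    by (subst sum.atMost_Suc_shift) (simp add: coeff_recip_poly_0 coeff_recip_poly_Suc)
  also have "\<dots> = (t ^ Suc ?n + (\<Sum>i\<le>?n. ?c (Suc i) * t ^ (?n - i))) - x * (\<Sum>i\<le>?n. ?c i * t ^ (?n - i))"
    by (simp add: left_diff_distrib sum_subtractf sum_distrib_left algebra_simps)
  also have "t ^ Suc ?n + (\<Sum>i\<le>?n. ?c (Suc i) * t ^ (?n - i)) = (\<Sum>i\<le>Suc ?n. ?c i * t ^ (Suc ?n - i))"
    by (subst sum.atMost_Suc_shift) (simp add: coeff_recip_poly_0)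
  also have "\<dots> = (\<Sum>i\<le>?n. ?c i * t ^ (Suc ?n - i))"
    by (simp add: coeff_recip_poly_beyond)
  also have "\<dots> = t * (\<Sum>i\<le>?n. ?c i * t ^ (?n - i))"
    by (auto simp: sum_distrib_left Suc_diff_le algebra_simps intro!: sum.cong)
  finally show ?case using add.IH by (simp add: left_diff_distrib)
qed

context alg_closed_subset
begin

lemma prod_mset_mem: "M \<noteq> {#} \<Longrightarrow> (\<And>x. x \<in># M \<Longrightarrow> f x \<in> U) \<Longrightarrow> (\<Prod>x\<in>#M. f x) \<in> U"
proof (induction M)
  case (add x M)
  then show ?case by (cases "M = {#}") (auto intro: mult_mem)
qed auto

lemma prod_mset_eq_0:
  "(\<And>x. x \<in># M \<Longrightarrow> f x \<in> U) \<Longrightarrow> (\<Prod>x\<in>#M. f x) = 0 \<Longrightarrow> \<exists>x\<in>#M. f x = 0"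
proof (induction M)
  case (add x M)
  show ?case
  proof (cases "M = {#}")
    case False
    then have "(\<Prod>x\<in>#M. f x) \<in> U" using add by (intro prod_mset_mem) auto
    then have "f x = 0 \<or> (\<Prod>x\<in>#M. f x) = 0" using add mult_eq_0 by auto
    then show ?thesis using add by auto
  qed (use add in auto)
qed auto

lemma coeff_recip_poly_mem: "set_mset M \<subseteq> U \<Longrightarrow> n > 0 \<Longrightarrow> coeff (recip_poly M) n \<in> U"
proof (induction M arbitrary: n)
  case empty
  then show ?case by (simp add: recip_poly_def zero_mem)
next
  case (add x M)
  then obtain m where n: "n = Suc m" by (cases n) auto
  have "x * coeff (recip_poly M) m \<in> U"
    using add by (cases m) (auto intro!: mult_mem simp: coeff_recip_poly_0)
  then show ?case unfolding n coeff_recip_poly_Suc using add by (intro minus_mem) auto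
qed

text \<open>An element x of M is a zero of the product over N, hence belongs to N; the common factor
  \<open>1 - x T\<close> cancels and the induction continues.\<close>

lemma recip_poly_inj:
  "set_mset M \<subseteq> U \<Longrightarrow> set_mset N \<subseteq> U \<Longrightarrow> size M = size N \<Longrightarrow> recip_poly M = recip_poly N \<Longrightarrow> M = N"
proof (induction M arbitrary: N)
  case (add x M)
  have "(\<Prod>y\<in>#N. x - y) = (\<Prod>y\<in>#add_mset x M. x - y)"
    unfolding prod_mset_diff_expand[symmetric] using add.prems by simp
  then have "(\<Prod>y\<in>#N. x - y) = 0" by simp
  moreover have "x - y \<in> U" if "y \<in># N" for y using that add.prems by (intro minus_mem) auto
  ultimately have "\<exists>y\<in>#N. x - y = 0" by (rule prod_mset_eq_0[rotated])
  then have "x \<in># N" by auto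
  then obtain N' where N: "N = add_mset x N'" by (auto dest: multi_member_split)
  have "recip_poly M = recip_poly N'"
    using add.prems(4) unfolding N recip_poly_add by (rule linear_mult_cancel)
  then show ?case using add N by auto
qed auto

lemma ex_multiset_recip_poly:
  "(\<And>i. 1 \<le> i \<Longrightarrow> i \<le> r \<Longrightarrow> a i \<in> U) \<Longrightarrow>
    \<exists>M. set_mset M \<subseteq> U \<and> size M = r \<and> (\<forall>i\<in>{1..r}. coeff (recip_poly M) i = a i)"
proof (induction r arbitrary: a)
  case (Suc r)
  define b where "b i = (if i = 0 then 1 else a i)" for i
  have bU: "b i \<in> U" if "i > 0" "i \<le> Suc r" for i using that Suc.prems by (simp add: b_def)
  obtain x where x: "x \<in> U" "x ^ Suc r + (\<Sum>i<Suc r. b (Suc r - i) * x ^ i) = 0"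
    using ex_root[of "Suc r" "\<lambda>i. b (Suc r - i)"] bU by auto
  \<comment> \<open>Horner's scheme at the zero x: \<open>d 0, ..., d r\<close> are the coefficients
    of the quotient by \<open>t - x\<close>, and \<open>d (Suc r)\<close> is the value at x, hence
    0.\<close>
  define d where "d m = (\<Sum>i\<le>m. b i * x ^ (m - i))" for m
  have d0: "d 0 = 1" by (simp add: d_def b_def)
  have dSuc: "d (Suc m) = b (Suc m) + x * d m" for m
    unfolding d_def sum_distrib_left
    by (auto simp: Suc_diff_le algebra_simps intro!: sum.cong)
  have dU: "m > 0 \<Longrightarrow> m \<le> Suc r \<Longrightarrow> d m \<in> U" for m
  proof (induction m)
    case (Suc m)
    have "x * d m \<in> U" using Suc x by (cases m) (auto simp: d0 intro: mult_mem)
    then show ?case unfolding dSuc using bU Suc by (intro add_mem) auto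
  qed auto
  have "d (Suc r) = (\<Sum>i\<in>{..Suc r}. b (Suc r - i) * x ^ i)"
    unfolding d_def by (rule sum.reindex_bij_witness[of _ "\<lambda>i. Suc r - i" "\<lambda>i. Suc r - i"]) auto
  also have "\<dots> = 0" using x(2) by (simp add: b_def add.commute flip: lessThan_Suc_atMost)
  finally have dr: "d (Suc r) = 0" .
  obtain M where M: "set_mset M \<subseteq> U" "size M = r" "\<And>i. i \<in> {1..r} \<Longrightarrow> coeff (recip_poly M) i = d i"
    using Suc.IH[of d] dU by auto
  have M': "coeff (recip_poly M) i = d i" if "i \<le> Suc r" for i
  proof -
    consider "i = 0" | "i \<in> {1..r}" | "i = Suc r" using \<open>i \<le> Suc r\<close> by fastforce
    then show ?thesis
      by cases (simp_all add: coeff_recip_poly_0 d0 M dr coeff_recip_poly_beyond del: atLeastAtMost_iff)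
  qed
  show ?case
  proof (intro exI[of _ "add_mset x M"] conjI ballI)
    fix i assume i: "i \<in> {1..Suc r}"
    then obtain m where m: "i = Suc m" by (cases i) auto
    have "coeff (recip_poly (add_mset x M)) i = d (Suc m) - x * d m"
      using i M' unfolding m coeff_recip_poly_Suc by auto
    then show "coeff (recip_poly (add_mset x M)) i = a i" unfolding dSuc by (simp add: m b_def)
  qed (use x M in auto)
qed (auto intro: exI[of _ "{#}"])

end

section \<open>Frobenius and the finite subfields\<close>

locale frobenius_field = alg_closed_subset U e for U :: "'t :: comm_ring_1 set" and e +
  fixes p \<kappa> q :: nat
  assumes p: "Factorial_Ring.prime p" and p_mult: "x \<in> U \<Longrightarrow> of_nat p * x = 0"
    and q: "q = p ^ \<kappa>" "\<kappa> > 0" and card_base: "card {x\<in>U. x ^ q = x} = q"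
begin

text \<open>For \<open>n > 0\<close> this is the subfield with \<open>q^n\<close> elements, although
  the cardinality is established only in \<open>card_fld\<close>; \<open>fld 0\<close> is all of
  \<open>U\<close>.\<close>

definition fld :: "nat \<Rightarrow> 't set" where
  "fld n = {x\<in>U. x ^ (q ^ n) = x}"

lemma q_gt_1: "q > 1"
  using one_less_power[of p \<kappa>] q prime_gt_1_nat[OF p] by simp

lemma q_power_gt_1: "n > 0 \<Longrightarrow> q ^ n > 1"
  using one_less_power[of q n] q_gt_1 by simp

lemma p_pos: "p > 0" using p prime_gt_0_nat by blast

lemma q_power: "q ^ n = p ^ (\<kappa> * n)" by (simp add: q power_mult)

lemma frob_p_add: "x \<in> U \<Longrightarrow> y \<in> U \<Longrightarrow> (x + y) ^ p = x ^ p + y ^ p"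
proof -
  assume x: "x \<in> U" "y \<in> U"
  have "(x + y) ^ p = (\<Sum>k\<le>p. of_nat (p choose k) * x ^ k * y ^ (p - k))" by (rule binomial_ring)
  also have "\<dots> = (\<Sum>k\<in>{0, p}. of_nat (p choose k) * x ^ k * y ^ (p - k))"
  proof (rule sum.mono_neutral_right)
    show "\<forall>i\<in>{..p} - {0, p}. of_nat (p choose i) * x ^ i * y ^ (p - i) = 0"
    proof
      fix i assume "i \<in> {..p} - {0, p}"
      then have i: "0 < i" "i < p" by auto
      then have "p dvd (p choose i)" using p by (intro dvd_choose_prime) auto
      then obtain m where m: "p choose i = p * m" by auto
      have "of_nat (p choose i) * x ^ i * y ^ (p - i) = of_nat m * (of_nat p * x ^ i) * y ^ (p - i)"
        unfolding m by (simp add: algebra_simps)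
      also have "of_nat p * x ^ i = 0" using p_mult power_mem[OF x(1) i(1)] by blast
      finally show "of_nat (p choose i) * x ^ i * y ^ (p - i) = 0" by simp
    qed
  qed auto
  also have "\<dots> = x ^ p + y ^ p" using p_pos by (simp add: add.commute)
  finally show ?thesis .
qed

lemma frob_add: "x \<in> U \<Longrightarrow> y \<in> U \<Longrightarrow> (x + y) ^ (p ^ n) = x ^ (p ^ n) + y ^ (p ^ n)"
proof (induction n)
  case (Suc n)
  then show ?case
    using frob_p_add[of "x ^ p ^ n" "y ^ p ^ n"] p_pos
    by (simp add: power_mem mult.commute[of p] power_mult)
qed auto

lemma frob_diff: "x \<in> U \<Longrightarrow> y \<in> U \<Longrightarrow> (x - y) ^ (p ^ n) = x ^ (p ^ n) - y ^ (p ^ n)"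
  using frob_add[of "x - y" y n] minus_mem[of x y] by simp

lemma frob_sum: "(\<And>i. i \<in> I \<Longrightarrow> f i \<in> U) \<Longrightarrow> (\<Sum>i\<in>I. f i) ^ (p ^ n) = (\<Sum>i\<in>I. f i ^ (p ^ n))"
  using p_pos by (induction I rule: infinite_finite_induct) (auto simp: frob_add sum_mem zero_power)

lemma frob_inj: "x \<in> U \<Longrightarrow> y \<in> U \<Longrightarrow> x ^ (p ^ n) = y ^ (p ^ n) \<Longrightarrow> x = y"
  using frob_diff[of x y n] power_eq_0[of "x - y" "p ^ n"] minus_mem[of x y] p_pos by auto

lemma unit_power: "n > 0 \<Longrightarrow> e ^ n = e"
  by (induction n rule: nat_induct_non_zero) (auto simp: unit_mult unit_mem)

lemma fld_subset: "fld n \<subseteq> U" by (auto simp: fld_def)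

lemma fld_zero: "0 \<in> fld n" using q_gt_1 by (auto simp: fld_def zero_mem zero_power)

lemma fld_unit: "e \<in> fld n" using q_gt_1 by (auto simp: fld_def unit_mem unit_power)

lemma fld_add: "x \<in> fld n \<Longrightarrow> y \<in> fld n \<Longrightarrow> x + y \<in> fld n"
  by (auto simp: fld_def add_mem frob_add q_power)

lemma fld_diff: "x \<in> fld n \<Longrightarrow> y \<in> fld n \<Longrightarrow> x - y \<in> fld n"
  by (auto simp: fld_def minus_mem frob_diff q_power)

lemma fld_uminus: "x \<in> fld n \<Longrightarrow> - x \<in> fld n"
  using fld_diff[of 0 n x] fld_zero by simp

lemma fld_mult: "x \<in> fld n \<Longrightarrow> y \<in> fld n \<Longrightarrow> x * y \<in> fld n"
  by (auto simp: fld_def mult_mem power_mult_distrib)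

lemma fld_power: "x \<in> fld n \<Longrightarrow> m > 0 \<Longrightarrow> x ^ m \<in> fld n"
  by (auto simp: fld_def power_mem simp flip: power_mult) (metis mult.commute power_mult)

lemma fld_sum: "(\<And>i. i \<in> I \<Longrightarrow> f i \<in> fld n) \<Longrightarrow> sum f I \<in> fld n"
  by (induction I rule: infinite_finite_induct) (auto simp: fld_zero fld_add)

lemma fld_mono: "x \<in> fld m \<Longrightarrow> x \<in> fld (m * n)"
proof (induction n)
  case 0
  then show ?case by (simp add: fld_def)
next
  case (Suc n)
  then have "x ^ q ^ (m * Suc n) = (x ^ q ^ m) ^ q ^ (m * n)"
    by (simp add: power_add mult.commute flip: power_mult)
  then show ?case using Suc by (auto simp: fld_def)
qed

lemma fld_base: "x \<in> fld 1 \<Longrightarrow> x \<in> fld n" using fld_mono[of x 1 n] by simp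

lemma finite_fld: "n > 0 \<Longrightarrow> finite (fld n)"
  unfolding fld_def by (intro finite_power_fixed q_power_gt_1)

lemma card_fld_1: "card (fld 1) = q" using card_base by (simp add: fld_def)

lemma coeff_recip_poly_frob:
  "set_mset M \<subseteq> U \<Longrightarrow> coeff (recip_poly (image_mset (\<lambda>x. x ^ q) M)) n = coeff (recip_poly M) n ^ q"
proof (induction M arbitrary: n)
  case empty
  then show ?case using q_gt_1 by (cases n) (auto simp: recip_poly_def zero_power)
next
  case (add x M)
  show ?case
  proof (cases n)
    case (Suc m)
    have mem: "x * coeff (recip_poly M) m \<in> U"
      using add by (cases m) (auto intro!: mult_mem coeff_recip_poly_mem simp: coeff_recip_poly_0)
    have mem': "coeff (recip_poly M) n \<in> U" using add Suc by (intro coeff_recip_poly_mem) auto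
    show ?thesis
      unfolding image_mset_add_mset Suc coeff_recip_poly_Suc
      using add mem mem' unfolding Suc by (simp add: frob_diff q power_mult_distrib)
  qed (simp add: coeff_recip_poly_0)
qed

definition stab :: "nat \<Rightarrow> 't multiset set" where
  "stab r = {M. set_mset M \<subseteq> U \<and> size M = r \<and> image_mset (\<lambda>x. x ^ q) M = M}"

lemma coeff_recip_poly_stab: "M \<in> stab r \<Longrightarrow> n > 0 \<Longrightarrow> coeff (recip_poly M) n \<in> fld 1"
  using coeff_recip_poly_frob[of M n] coeff_recip_poly_mem[of M n] by (simp add: stab_def fld_def)

lemma recip_poly_eqI:
  assumes "size M = r" "size N = r" "\<And>i. i \<in> {1..r} \<Longrightarrow> coeff (recip_poly M) i = coeff (recip_poly N) i"
  shows "recip_poly M = recip_poly N"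
proof (rule poly_eqI)
  fix n
  consider "n = 0" | "n \<in> {1..r}" | "n > r" by fastforce
  then show "coeff (recip_poly M) n = coeff (recip_poly N) n"
    by cases (use assms in \<open>simp_all add: coeff_recip_poly_0 coeff_recip_poly_beyond\<close>)
qed

lemma ex_stab:
  assumes "\<And>i. i \<in> {1..r} \<Longrightarrow> a i \<in> fld 1"
  shows "\<exists>M\<in>stab r. \<forall>i\<in>{1..r}. coeff (recip_poly M) i = a i"
proof -
  have "\<exists>M. set_mset M \<subseteq> U \<and> size M = r \<and> (\<forall>i\<in>{1..r}. coeff (recip_poly M) i = a i)"
    by (rule ex_multiset_recip_poly) (use assms fld_subset in auto)
  then obtain M where M: "set_mset M \<subseteq> U" "size M = r" "\<And>i. i \<in> {1..r} \<Longrightarrow> coeff (recip_poly M) i = a i"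
    by blast
  have "recip_poly (image_mset (\<lambda>x. x ^ q) M) = recip_poly M"
  proof (rule recip_poly_eqI)
    fix i assume i: "i \<in> {1..r}"
    then have "coeff (recip_poly M) i \<in> fld 1" using assms M by auto
    then show "coeff (recip_poly (image_mset (\<lambda>x. x ^ q) M)) i = coeff (recip_poly M) i"
      unfolding coeff_recip_poly_frob[OF M(1)] by (simp add: fld_def)
  qed (use M in auto)
  then have "image_mset (\<lambda>x. x ^ q) M = M"
    using M(1) q_gt_1 by (intro recip_poly_inj) (auto intro!: power_mem)
  then show ?thesis using M by (auto simp: stab_def intro!: bexI[of _ M])
qed

text \<open>Frobenius raises the coefficients to the power q, so M is stable exactly if they lie in
  \<open>fld 1\<close>, and every choice of r coefficients is realised. Besides the number of stable
  multisets this supplies the free coordinates used in \<open>A_beyond\<close>.\<close>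

lemma bij_betw_stab:
  "bij_betw (\<lambda>M. restrict (coeff (recip_poly M)) {1..r}) (stab r) ({1..r} \<rightarrow>\<^sub>E fld 1)"
proof (rule bij_betw_imageI)
  let ?f = "\<lambda>M. restrict (coeff (recip_poly M)) {1..r}"
  show "inj_on ?f (stab r)"
  proof (rule inj_onI)
    fix M N assume MN: "M \<in> stab r" "N \<in> stab r" "?f M = ?f N"
    have "recip_poly M = recip_poly N"
    proof (rule recip_poly_eqI)
      fix i assume "i \<in> {1..r}"
      then show "coeff (recip_poly M) i = coeff (recip_poly N) i"
        using fun_cong[OF MN(3), of i] by simp
    qed (use MN in \<open>auto simp: stab_def\<close>)
    then show "M = N" using MN by (intro recip_poly_inj) (auto simp: stab_def)
  qed
  show "?f ` stab r = ({1..r} \<rightarrow>\<^sub>E fld 1)"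
  proof
    show "?f ` stab r \<subseteq> ({1..r} \<rightarrow>\<^sub>E fld 1)"
      using coeff_recip_poly_stab by (auto simp: PiE_iff)
    show "({1..r} \<rightarrow>\<^sub>E fld 1) \<subseteq> ?f ` stab r"
    proof
      fix a assume a: "a \<in> {1..r} \<rightarrow>\<^sub>E fld 1"
      then obtain M where M: "M \<in> stab r" "\<forall>i\<in>{1..r}. coeff (recip_poly M) i = a i"
        using ex_stab[of r a] by (auto simp: PiE_iff)
      then have "a = ?f M" using a by (auto simp: PiE_iff extensional_def fun_eq_iff)
      then show "a \<in> ?f ` stab r" using M by blast
    qed
  qed
qed

lemma finite_stab: "finite (stab r)"
  using bij_betw_finite[OF bij_betw_stab[of r]] finite_fld[of 1] by (simp add: finite_PiE)

lemma card_stab: "card (stab r) = q ^ r"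
  using bij_betw_same_card[OF bij_betw_stab[of r]] by (simp add: card_PiE card_fld_1[simplified])

end

subsection \<open>The L-function\<close>

context frobenius_field
begin

text \<open>For x in \<open>fld j\<close> these are the roots of the characteristic polynomial of x
  over the base field; conjugates are repeated if x has smaller degree.\<close>

definition orb :: "'t \<Rightarrow> nat \<Rightarrow> 't multiset" where
  "orb x j = image_mset (\<lambda>i. x ^ (q ^ i)) (mset_set {..<j})"

lemma orb_mem: "x \<in> U \<Longrightarrow> y \<in># orb x j \<Longrightarrow> y \<in> U"
  using q_gt_1 by (auto simp: orb_def intro!: power_mem)

lemma size_orb: "size (orb x j) = j"
  by (simp add: orb_def)

lemma orb_add:
  assumes "x \<in> fld a"
  shows "orb x (a + b) = orb x a + orb x b"
proof -
  have "{..<a + b} = {..<a} \<union> (\<lambda>i. a + i) ` {..<b}"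
  proof (intro Set.set_eqI iffI)
    fix i assume "i \<in> {..<a + b}"
    then show "i \<in> {..<a} \<union> (\<lambda>i. a + i) ` {..<b}"
      by (cases "i < a") (auto intro: image_eqI[of _ _ "i - a"])
  qed auto
  then have "mset_set {..<a + b} = mset_set {..<a} + mset_set ((\<lambda>i. a + i) ` {..<b})"
    by (simp only:) (rule mset_set_Union, auto)
  also have "mset_set ((\<lambda>i. a + i) ` {..<b}) = image_mset (\<lambda>i. a + i) (mset_set {..<b})"
    by (rule image_mset_mset_set[symmetric]) auto
  finally have "orb x (a + b) = orb x a + image_mset (\<lambda>i. x ^ (q ^ (a + i))) (mset_set {..<b})"
    by (simp add: orb_def multiset.map_comp o_def)
  also have "image_mset (\<lambda>i. x ^ (q ^ (a + i))) (mset_set {..<b}) = orb x b"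
    using assms by (simp add: orb_def fld_def power_add power_mult)
  finally show ?thesis .
qed

lemma orb_Suc: "orb x (Suc j) = add_mset (x ^ (q ^ j)) (orb x j)"
  by (simp add: orb_def lessThan_Suc)

lemma frob_orb:
  assumes "x \<in> fld j"
  shows "image_mset (\<lambda>x. x ^ q) (orb x j) = orb x j"
proof -
  have "add_mset x (image_mset (\<lambda>x. x ^ q) (orb x j)) = orb x (Suc j)" for j
    by (induction j) (simp_all add: orb_Suc power_mult[symmetric] mult.commute, simp add: orb_def)
  also have "orb x (Suc j) = add_mset x (orb x j)"
    using assms by (simp add: orb_Suc fld_def)
  finally show ?thesis by simp
qed

lemma orb_stab: "x \<in> fld j \<Longrightarrow> orb x j \<in> stab j"
  using fld_subset by (auto simp: stab_def size_orb frob_orb dest: orb_mem)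

lemma power_q_inj: "x \<in> U \<Longrightarrow> y \<in> U \<Longrightarrow> x ^ (q ^ n) = y ^ (q ^ n) \<Longrightarrow> x = y"
  unfolding q_power by (rule frob_inj)

lemma count_stab_frob:
  assumes "M \<in> stab r" "x \<in> U"
  shows "count M (x ^ (q ^ n)) = count M x"
proof (induction n)
  case (Suc n)
  define y where "y = x ^ q ^ n"
  have y: "y \<in> U" using assms q_gt_1 by (simp add: y_def power_mem)
  have M: "set_mset M \<subseteq> U" using assms by (simp add: stab_def)
  have "count M (y ^ q) = count (image_mset (\<lambda>x. x ^ q) M) (y ^ q)"
    using assms by (simp add: stab_def)
  also have "\<dots> = (\<Sum>z | z \<in># M \<and> y ^ q = z ^ q. count M z)" by (rule count_image_mset')
  also have "{z. z \<in># M \<and> y ^ q = z ^ q} = {z. z \<in># M \<and> z = y}"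
    using power_q_inj[of y _ 1] M y by auto
  also have "(\<Sum>z | z \<in># M \<and> z = y. count M z) = count M y"
    by (cases "y \<in># M") (auto simp: not_in_iff conj_commute cong: conj_cong)
  finally show ?case using Suc by (simp add: y_def power_mult[symmetric] mult.commute)
qed simp

text \<open>Let x occur in M and have degree E over the base field. Then x lies in
  \<open>fld j\<close> iff E divides j, and \<open>orb x (E * m)\<close> is m copies of the set of
  conjugates. Conjugates have equal multiplicity in M, so these copies fit into M iff m is at most
  that multiplicity.\<close>

lemma card_orb_subset:
  assumes M: "M \<in> stab r" and x: "x \<in> U"
  shows "card {j. j \<ge> 1 \<and> x \<in> fld j \<and> orb x j \<subseteq># M} = count M x"
proof (cases "x \<in># M")
  case False
  have "x \<in># orb x j" if "j \<ge> 1" for j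
    using that by (auto simp: orb_def image_iff intro!: bexI[of _ 0])
  then have "{j. j \<ge> 1 \<and> x \<in> fld j \<and> orb x j \<subseteq># M} = {}"
    using False by (auto dest: mset_subset_eqD)
  then have "card {j. j \<ge> 1 \<and> x \<in> fld j \<and> orb x j \<subseteq># M} = 0" by (simp only: card.empty)
  then show ?thesis using False by (simp add: not_in_iff)
next
  case True
  have "x ^ (q ^ i) \<in># M" for i
    using count_stab_frob[OF M x, of i] True by (metis count_eq_zero_iff)
  then have "finite (range (\<lambda>i. x ^ (q ^ i)))"
    by (intro finite_subset[OF _ finite_set_mset[of M]] image_subsetI)
  then have "\<not> inj (\<lambda>i. x ^ (q ^ i))" using finite_imageD infinite_UNIV_nat by blast
  then obtain i j where ij: "i < j" "x ^ (q ^ i) = x ^ (q ^ j)"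
    unfolding inj_def by (metis linorder_neqE_nat)
  have period: "x \<in> fld (j - i)" if "i < j" "x ^ (q ^ i) = x ^ (q ^ j)" for i j
  proof -
    have "q ^ j = q ^ (j - i) * q ^ i" using that(1) by (simp flip: power_add)
    then have "x ^ (q ^ i) = (x ^ q ^ (j - i)) ^ q ^ i" using that(2) by (simp flip: power_mult)
    then show ?thesis using power_q_inj[of x "x ^ q ^ (j - i)" i] x q_gt_1 by (auto simp: fld_def power_mem)
  qed
  define E where "E = (LEAST n. n \<ge> 1 \<and> x \<in> fld n)"
  have "\<exists>n. n \<ge> 1 \<and> x \<in> fld n" using period[OF ij] ij(1) by (intro exI[of _ "j - i"]) auto
  then have E: "E \<ge> 1" "x \<in> fld E" unfolding E_def by (metis (mono_tags, lifting) LeastI_ex)+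
  have Emin: "E \<le> n" if "n \<ge> 1" "x \<in> fld n" for n unfolding E_def using that by (intro Least_le) simp
  have Edvd: "x \<in> fld n \<longleftrightarrow> E dvd n" if "n \<ge> 1" for n
  proof
    assume "x \<in> fld n"
    then have "x = x ^ (q ^ n)" by (simp add: fld_def)
    also have "q ^ n = q ^ (E * (n div E)) * q ^ (n mod E)" by (simp flip: power_add)
    also have "x ^ \<dots> = x ^ (q ^ (n mod E))"
      using fld_mono[OF E(2), of "n div E"] by (simp add: fld_def power_mult)
    finally have "x \<in> fld (n mod E)" using x by (simp add: fld_def)
    then have "\<not> n mod E \<ge> 1" using Emin[of "n mod E"] E(1) mod_less_divisor[of E n] by linarith
    then show "E dvd n" by (simp add: dvd_eq_mod_eq_0)
  next
    assume "E dvd n"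
    then show "x \<in> fld n" using fld_mono[OF E(2)] by auto
  qed
  let ?O = "(\<lambda>i. x ^ (q ^ i)) ` {..<E}"
  have "inj_on (\<lambda>i. x ^ (q ^ i)) {..<E}"
  proof (rule inj_onI)
    fix i j assume a: "i \<in> {..<E}" "j \<in> {..<E}" "x ^ (q ^ i) = x ^ (q ^ j)"
    have False if "i < j" "j < E" "x ^ (q ^ i) = x ^ (q ^ j)" for i j
      using period[OF that(1,3)] Emin[of "j - i"] that by simp linarith
    from this[of i j] this[of j i] a show "i = j" by (metis lessThan_iff linorder_neqE_nat)
  qed
  then have orbE: "orb x E = mset_set ?O" unfolding orb_def by (rule image_mset_mset_set)
  have rep: "orb x (E * m) = repeat_mset m (orb x E)" for m
  proof (induction m)
    case (Suc m)
    have "orb x (E * Suc m) = orb x (E + E * m)" by simp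
    also have "\<dots> = orb x E + orb x (E * m)" by (rule orb_add[OF E(2)])
    finally show ?case using Suc by simp
  qed (simp add: orb_def)
  have sub: "orb x (E * m) \<subseteq># M \<longleftrightarrow> m \<le> count M x" for m
  proof
    assume "orb x (E * m) \<subseteq># M"
    then have "count (repeat_mset m (orb x E)) x \<le> count M x" unfolding rep by (rule mset_subset_eq_count)
    moreover have "x \<in> ?O" using E(1) by (auto simp: image_iff intro!: bexI[of _ 0])
    ultimately show "m \<le> count M x" by (simp add: orbE)
  next
    assume m: "m \<le> count M x"
    show "orb x (E * m) \<subseteq># M"
      unfolding rep orbE subseteq_mset_def
    proof
      fix y
      show "count (repeat_mset m (mset_set ?O)) y \<le> count M y"
        using m count_stab_frob[OF M x] by (cases "y \<in> ?O") (auto simp: not_in_iff)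
    qed
  qed
  have "{j. j \<ge> 1 \<and> x \<in> fld j \<and> orb x j \<subseteq># M} = (\<lambda>m. E * m) ` {1..count M x}"
  proof (intro Set.set_eqI iffI)
    fix j assume j: "j \<in> {j. j \<ge> 1 \<and> x \<in> fld j \<and> orb x j \<subseteq># M}"
    then obtain m where m: "j = E * m" using Edvd by auto
    then show "j \<in> (\<lambda>m. E * m) ` {1..count M x}" using j sub[of m] by (intro image_eqI[of _ _ m]) (auto simp: Suc_le_eq)
  next
    fix j assume "j \<in> (\<lambda>m. E * m) ` {1..count M x}"
    then obtain m where "j = E * m" "1 \<le> m" "m \<le> count M x" by (elim imageE) auto
    then show "j \<in> {j. j \<ge> 1 \<and> x \<in> fld j \<and> orb x j \<subseteq># M}"
      using sub Edvd[of j] E(1) by auto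
  qed
  moreover have "inj_on (\<lambda>m. E * m) {1..count M x}" using E(1) by (auto simp: inj_on_def)
  ultimately show ?thesis by (simp add: card_image)
qed

text \<open>Exchanging the summations and applying \<open>card_orb_subset\<close> gives the sum of
  the multiplicities in M. This is the counterpart of the identity that sums the von Mangoldt
  function over the divisors of a polynomial to its degree.\<close>

lemma card_orb_pairs:
  assumes M: "M \<in> stab r"
  shows "(\<Sum>j=1..r. card {x \<in> fld j. orb x j \<subseteq># M}) = r"
proof -
  have fin: "finite {x \<in> fld j. orb x j \<subseteq># M}" if "j \<in> {1..r}" for j using finite_fld[of j] that by auto
  have MU: "set_mset M \<subseteq> U" "size M = r" using M by (auto simp: stab_def)
  let ?J = "\<lambda>x. {j. j \<ge> 1 \<and> x \<in> fld j \<and> orb x j \<subseteq># M}"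
  have J: "?J x \<subseteq> {1..r}" for x using size_mset_mono[of "orb x _" M] MU by (auto simp: size_orb)
  have mem: "x \<in># M" if "j \<ge> 1" "orb x j \<subseteq># M" for x j
  proof -
    have "x \<in># orb x j" using that by (auto simp: orb_def image_iff intro!: bexI[of _ 0])
    then show ?thesis using that by (auto dest: mset_subset_eqD)
  qed
  have "(\<Sum>j=1..r. card {x \<in> fld j. orb x j \<subseteq># M}) = card (SIGMA j:{1..r}. {x \<in> fld j. orb x j \<subseteq># M})"
    using fin by (intro card_SigmaI[symmetric]) auto
  also have "\<dots> = card (SIGMA x:set_mset M. ?J x)"
  proof (rule bij_betw_same_card[of "\<lambda>(j, x). (x, j)"], rule bij_betw_imageI)
    show "inj_on (\<lambda>(j, x). (x, j)) (SIGMA j:{1..r}. {x \<in> fld j. orb x j \<subseteq># M})" by (auto simp: inj_on_def)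
    show "(\<lambda>(j, x). (x, j)) ` (SIGMA j:{1..r}. {x \<in> fld j. orb x j \<subseteq># M}) = (SIGMA x:set_mset M. ?J x)"
      using mem J by (force simp: image_iff)
  qed
  also have "\<dots> = (\<Sum>x\<in>set_mset M. card (?J x))"
    using J by (intro card_SigmaI) (auto intro: finite_subset)
  also have "\<dots> = (\<Sum>x\<in>set_mset M. count M x)"
    using card_orb_subset[OF M] MU by (intro sum.cong) auto
  also have "\<dots> = r" using MU by (simp add: size_multiset_overloaded_eq)
  finally show ?thesis .
qed

text \<open>Coefficient form of \<open>T L' = L (\<Sum> S_j T^j)\<close>. The factor r is rewritten
  as the number of pairs (j, x) with \<open>orb x j\<close> contained in M; removing that orbit
  leaves an arbitrary stable multiset of size \<open>r - j\<close>.\<close>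

theorem stab_sum_recurrence:
  fixes \<Lambda> :: "'t multiset \<Rightarrow> complex"
  assumes mult: "\<And>a b M N. M \<in> stab a \<Longrightarrow> N \<in> stab b \<Longrightarrow> \<Lambda> (M + N) = \<Lambda> M * \<Lambda> N"
  shows "of_nat r * (\<Sum>M\<in>stab r. \<Lambda> M) =
    (\<Sum>j=1..r. (\<Sum>x\<in>fld j. \<Lambda> (orb x j)) * (\<Sum>M\<in>stab (r - j). \<Lambda> M))"
proof -
  have inner: "(\<Sum>M | M \<in> stab r \<and> orb x j \<subseteq># M. \<Lambda> M) = \<Lambda> (orb x j) * (\<Sum>M\<in>stab (r - j). \<Lambda> M)"
    if "j \<in> {1..r}" "x \<in> fld j" for x j
  proof -
    have "(\<Sum>M | M \<in> stab r \<and> orb x j \<subseteq># M. \<Lambda> M) = (\<Sum>N\<in>stab (r - j). \<Lambda> (orb x j + N))"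
    proof (rule sum.reindex_bij_witness[of _ "\<lambda>N. orb x j + N" "\<lambda>M. M - orb x j"])
      fix M assume "M \<in> {M \<in> stab r. orb x j \<subseteq># M}"
      then have M: "M \<in> stab r" "orb x j \<subseteq># M" by auto
      then show eq: "orb x j + (M - orb x j) = M" by simp
      have "image_mset (\<lambda>x. x ^ q) (M - orb x j) = M - orb x j"
        using M frob_orb[OF that(2)] by (simp add: image_mset_Diff stab_def)
      then show "M - orb x j \<in> stab (r - j)"
        using M by (auto simp: stab_def size_orb size_Diff_submset dest: in_diffD)
      show "\<Lambda> (orb x j + (M - orb x j)) = \<Lambda> M" using eq by simp
    next
      fix N assume "N \<in> stab (r - j)"
      then show "orb x j + N - orb x j = N" "orb x j + N \<in> {M \<in> stab r. orb x j \<subseteq># M}"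
        using orb_stab[OF that(2)] that(1) by (auto simp: stab_def)
    qed
    also have "\<dots> = (\<Sum>N\<in>stab (r - j). \<Lambda> (orb x j) * \<Lambda> N)"
      using mult orb_stab[OF that(2)] by (intro sum.cong) auto
    finally show ?thesis by (simp add: sum_distrib_left)
  qed
  have "of_nat r * (\<Sum>M\<in>stab r. \<Lambda> M) =
     (\<Sum>M\<in>stab r. (\<Sum>j=1..r. of_nat (card {x \<in> fld j. orb x j \<subseteq># M})) * \<Lambda> M)"
    unfolding sum_distrib_left of_nat_sum[symmetric] by (intro sum.cong refl) (simp only: card_orb_pairs)
  also have "\<dots> = (\<Sum>M\<in>stab r. \<Sum>j=1..r. \<Sum>x\<in>fld j. if orb x j \<subseteq># M then \<Lambda> M else 0)"
    unfolding sum_distrib_right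
  proof (intro sum.cong refl)
    fix M j assume "j \<in> {1..r}"
    then have "finite (fld j)" by (intro finite_fld) auto
    then show "of_nat (card {x \<in> fld j. orb x j \<subseteq># M}) * \<Lambda> M = (\<Sum>x\<in>fld j. if orb x j \<subseteq># M then \<Lambda> M else 0)"
      by (simp add: sum.If_cases Int_def)
  qed
  also have "\<dots> = (\<Sum>j=1..r. \<Sum>M\<in>stab r. \<Sum>x\<in>fld j. if orb x j \<subseteq># M then \<Lambda> M else 0)"
    by (rule sum.swap)
  also have "\<dots> = (\<Sum>j=1..r. \<Sum>x\<in>fld j. \<Sum>M\<in>stab r. if orb x j \<subseteq># M then \<Lambda> M else 0)"
    by (intro sum.cong refl sum.swap)
  also have "\<dots> = (\<Sum>j=1..r. \<Sum>x\<in>fld j. \<Lambda> (orb x j) * (\<Sum>M\<in>stab (r - j). \<Lambda> M))"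
  proof (intro sum.cong refl)
    fix j x assume "j \<in> {1..r}" "x \<in> fld j"
    then show "(\<Sum>M\<in>stab r. if orb x j \<subseteq># M then \<Lambda> M else 0) = \<Lambda> (orb x j) * (\<Sum>M\<in>stab (r - j). \<Lambda> M)"
      by (subst inner[symmetric]) (auto simp: sum.If_cases[OF finite_stab] Int_def)
  qed
  also have "\<dots> = (\<Sum>j=1..r. (\<Sum>x\<in>fld j. \<Lambda> (orb x j)) * (\<Sum>M\<in>stab (r - j). \<Lambda> M))"
    by (simp add: sum_distrib_right)
  finally show ?thesis .
qed

text \<open>For the trivial weight all sums over stable multisets are powers of q; subtracting q
  times the recurrence for r from the one for \<open>Suc r\<close> isolates the cardinality of
  \<open>fld (Suc r)\<close>.\<close>

lemma card_fld:
  assumes "n > 0"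
  shows "card (fld n) = q ^ n"
proof -
  have rec: "of_nat r * (of_nat q ^ r :: complex) = (\<Sum>j=1..r. of_nat (card (fld j)) * of_nat q ^ (r - j))" for r
    using stab_sum_recurrence[of "\<lambda>_. 1" r] by (simp add: card_stab)
  obtain r where n: "n = Suc r" using assms by (cases n) auto
  have "(\<Sum>j=1..Suc r. of_nat (card (fld j)) * (of_nat q :: complex) ^ (Suc r - j)) =
     of_nat q * (\<Sum>j=1..r. of_nat (card (fld j)) * of_nat q ^ (r - j)) + of_nat (card (fld (Suc r)))"
    by (simp add: sum_distrib_left Suc_diff_le mult.left_commute)
  then have "of_nat (Suc r) * (of_nat q ^ Suc r :: complex) = of_nat q * (of_nat r * of_nat q ^ r) + of_nat (card (fld (Suc r)))"
    unfolding rec[symmetric] .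
  then have "of_nat (card (fld (Suc r))) = (of_nat (q ^ Suc r) :: complex)" by (simp add: algebra_simps)
  then show ?thesis unfolding n by (simp only: of_nat_eq_iff)
qed

definition tr :: "nat \<Rightarrow> 't \<Rightarrow> 't" where
  "tr n y = (\<Sum>i<n. y ^ (q ^ i))"

lemma tr_fld:
  assumes "y \<in> fld n"
  shows "tr n y \<in> fld 1"
proof -
  have yU: "y ^ (q ^ i) \<in> U" for i using assms q_gt_1 by (auto simp: fld_def intro!: power_mem)
  have "tr n y ^ q = (\<Sum>i<n. y ^ (q ^ Suc i))"
    unfolding tr_def using yU frob_sum[of "{..<n}" "\<lambda>i. y ^ (q ^ i)" \<kappa>]
    by (simp add: power_mult[symmetric] mult.commute flip: q(1))
  also have "\<dots> = (\<Sum>i<Suc n. y ^ (q ^ i)) - y" by (simp only: sum.lessThan_Suc_shift) simp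
  also have "\<dots> = tr n y" using assms by (simp add: tr_def fld_def)
  finally show ?thesis unfolding fld_def tr_def using yU by (auto intro: sum_mem)
qed

lemma power_sum_stab:
  assumes "M \<in> stab r" "i > 0"
  shows "power_sum i M \<in> fld 1"
proof -
  have aux: "power_sum i N \<in> U \<and> power_sum i N ^ q = power_sum i (image_mset (\<lambda>x. x ^ q) N)"
    if "set_mset N \<subseteq> U" for N
    using that
  proof (induction N)
    case empty
    then show ?case using q_gt_1 by (simp add: power_sum_def zero_mem zero_power)
  next
    case (add x N)
    then have "x ^ i \<in> U" "power_sum i N \<in> U" using assms(2) by (auto intro: power_mem)
    then show ?case using add frob_add[of "x ^ i" "power_sum i N" \<kappa>]
      by (auto simp: power_sum_def add_mem q power_mult[symmetric] mult.commute)
  qed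
  then show ?thesis using assms aux[of M] by (simp add: stab_def fld_def)
qed

lemma power_sum_orb: "power_sum i (orb x j) = (\<Sum>t<j. (x ^ i) ^ (q ^ t))"
  by (simp add: power_sum_def orb_def multiset.map_comp o_def sum_unfold_sum_mset
      flip: power_mult) (simp add: mult.commute)

lemma fld_inverse:
  assumes "x \<in> fld n" "x \<noteq> 0"
  shows "\<exists>y\<in>fld n. x * y = e"
proof -
  have x: "x \<in> U" using assms by (simp add: fld_def)
  obtain y where y: "y \<in> U" "x * y = e" using ex_inverse[OF x assms(2)] by blast
  have Q: "q ^ n > 0" using q_gt_1 by simp
  have "x * y ^ (q ^ n) = (x * y) ^ (q ^ n)" using assms(1) by (simp add: power_mult_distrib fld_def)
  also have "\<dots> = x * y" unfolding y(2) by (rule unit_power[OF Q])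
  finally have "x * y ^ (q ^ n) = x * y" .
  then have "y ^ (q ^ n) = y" by (rule mult_cancel[OF x assms(2) power_mem[OF y(1) Q] y(1)])
  then show ?thesis using y by (auto simp: fld_def)
qed

end

section \<open>The character on multisets and the coefficients of the L-function\<close>

locale char_field = frobenius_field U e p \<kappa> q for U :: "'t :: comm_ring_1 set" and e p \<kappa> q +
  fixes \<psi> :: "'t \<Rightarrow> complex" and s :: nat
  assumes psi_add: "x \<in> fld 1 \<Longrightarrow> y \<in> fld 1 \<Longrightarrow> \<psi> (x + y) = \<psi> x * \<psi> y"
    and norm_psi: "x \<in> fld 1 \<Longrightarrow> norm (\<psi> x) = 1"
    and psi_nontrivial: "\<exists>x\<in>fld 1. \<psi> x \<noteq> 1"
    and s: "s \<ge> 2" "\<not> p dvd s"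
begin

lemma psi_0: "\<psi> 0 = 1"
  using psi_add[of 0 0] fld_zero norm_psi[of 0] by (auto simp: fld_zero)

end

locale exp_sum = char_field U e p \<kappa> q \<psi> s for U :: "'t :: comm_ring_1 set" and e p \<kappa> q \<psi> s +
  fixes c m :: 't
  assumes c: "c \<in> fld 1" "c \<noteq> 0" and m: "m \<in> fld 1"
begin

text \<open>Power sums are additive in M, so this is multiplicative; on \<open>orb x j\<close> it is
  \<psi> of the trace of \<open>f x\<close>. Thus one function yields both the L-function and the
  sums over the extensions.\<close>

definition weight :: "'t multiset \<Rightarrow> complex" where
  "weight M = \<psi> (c * power_sum s M + m * power_sum 1 M)"

text \<open>Coefficient of \<open>T^r\<close> in the L-function.\<close>

definition A :: "nat \<Rightarrow> complex" where "A r = (\<Sum>M\<in>stab r. weight M)"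

definition f :: "'t \<Rightarrow> 't" where "f x = c * x ^ s + m * x"

definition S :: "nat \<Rightarrow> complex" where "S n = (\<Sum>x\<in>fld n. \<psi> (tr n (f x)))"

lemma f_fld: "x \<in> fld n \<Longrightarrow> f x \<in> fld n"
  unfolding f_def using s fld_base[OF c(1)] fld_base[OF m] by (intro fld_add fld_mult fld_power) auto

lemma weight_arg: "M \<in> stab r \<Longrightarrow> c * power_sum s M + m * power_sum 1 M \<in> fld 1"
  using s c m power_sum_stab[of M r] by (intro fld_add fld_mult) auto

lemma weight_add: "M \<in> stab a \<Longrightarrow> N \<in> stab b \<Longrightarrow> weight (M + N) = weight M * weight N"
  unfolding weight_def using psi_add[OF weight_arg weight_arg, of M a N b]
  by (simp add: power_sum_def algebra_simps)

lemma weight_orb: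
  assumes "x \<in> fld j"
  shows "weight (orb x j) = \<psi> (tr j (f x))"
proof -
  have cq: "c ^ q ^ i = c" "m ^ q ^ i = m" for i using fld_base[OF c(1), of i] fld_base[OF m, of i] by (auto simp: fld_def)
  have U: "c * x ^ s \<in> U" "m * x \<in> U" using assms s c m fld_subset by (auto intro!: mult_mem power_mem)
  have "tr j (f x) = (\<Sum>t<j. c * (x ^ s) ^ (q ^ t) + m * (x ^ 1) ^ (q ^ t))"
    unfolding tr_def f_def q_power using frob_add[OF U]
    by (simp add: power_mult_distrib cq[unfolded q_power])
  then show ?thesis by (simp add: weight_def power_sum_orb sum.distrib sum_distrib_left)
qed

lemma A_recurrence: "of_nat r * A r = (\<Sum>j=1..r. S j * A (r - j))"
  using stab_sum_recurrence[where \<Lambda> = weight and r = r, OF weight_add] by (simp add: A_def S_def weight_orb)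

lemma A_0: "A 0 = 1"
proof -
  have "stab 0 = {{#}}" by (auto simp: stab_def)
  then show ?thesis using psi_0 by (simp add: A_def weight_def power_sum_def)
qed

lemma of_nat_s_unit: "of_nat s * e \<noteq> 0"
proof
  assume 0: "of_nat s * e = 0"
  have "coprime s p" using p s(2) prime_imp_coprime coprime_commute by blast
  moreover have "p \<noteq> 1" using p by auto
  ultimately obtain a b where ab: "s * a = p * b + 1" using coprime_bezout_strong by blast
  have "of_nat a * (of_nat s * e) = of_nat (s * a) * e"
    by (simp only: of_nat_mult mult.commute[of s a] mult.assoc)
  also have "\<dots> = of_nat b * (of_nat p * e) + e" unfolding ab by (simp add: algebra_simps)
  finally show False using 0 p_mult[OF unit_mem] unit_neq_0 by simp
qed

lemma power_sum_newton:
  assumes "n > 0"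
  shows "power_sum n M = - (of_nat n * coeff (recip_poly M) n) -
    (\<Sum>i=1..<n. power_sum i M * coeff (recip_poly M) (n - i))"
proof -
  have "{1..n} = insert n {1..<n}" using assms by auto
  then have "(\<Sum>i=1..n. power_sum i M * coeff (recip_poly M) (n - i)) =
     power_sum n M + (\<Sum>i=1..<n. power_sum i M * coeff (recip_poly M) (n - i))"
    by (simp add: coeff_recip_poly_0)
  then show ?thesis using newton_identity[of n M] by simp
qed

lemma power_sum_eqI:
  assumes "\<And>i. i < n \<Longrightarrow> coeff (recip_poly M) i = coeff (recip_poly N) i" "0 < i" "i < n"
  shows "power_sum i M = power_sum i N"
  using assms(2,3)
proof (induction i rule: less_induct)
  case (less i)
  then show ?case
    unfolding power_sum_newton[OF less.prems(1)]
    using assms(1) by (intro arg_cong2[of _ _ _ _ "(-)"] sum.cong) (auto simp: assms(1))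
qed

text \<open>For \<open>r \<ge> s\<close> the s-th coefficient of \<open>recip_poly M\<close> is a
  free parameter. By Newton's identities, adding b to it keeps the power sums of index below s and
  changes the s-th one by \<open>- s b\<close>. The weights are thus multiplied by a constant, which
  can be made different from 1 because p does not divide s.\<close>

lemma A_beyond:
  assumes "r \<ge> s"
  shows "A r = 0"
proof -
  obtain y where y: "y \<in> fld 1" "\<psi> y \<noteq> 1" using psi_nontrivial by blast
  have sc: "of_nat s * e \<in> fld 1" using fld_unit[of 1] fld_zero[of 1]
    by (induction s) (auto simp: distrib_right fld_add)
  then have "c * (of_nat s * e) \<in> fld 1" "c * (of_nat s * e) \<noteq> 0"
    using c of_nat_s_unit fld_mult mult_eq_0[of c "of_nat s * e"] fld_subset by blast+
  then obtain z where z: "z \<in> fld 1" "c * (of_nat s * e) * z = e" using fld_inverse by blast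
  \<comment> \<open>Solves \<open>- c s b = y\<close>, so that the shift multiplies every weight by
    \<open>\<psi> y\<close>.\<close>
  define b where "b = - (z * y)"
  have b: "b \<in> fld 1" using z y by (auto simp: b_def intro!: fld_uminus fld_mult)
  have bU: "b \<in> U" using b fld_subset by blast
  have yU: "y \<in> U" using y fld_subset by blast
  have "c * (of_nat s * b) = c * of_nat s * (e * b)" using unit_mult[OF bU] by (simp add: ac_simps)
  also have "\<dots> = - (c * (of_nat s * e) * z * y)" by (simp add: b_def ac_simps)
  also have "\<dots> = - y" using z unit_mult[OF yU] by simp
  finally have cy: "- (c * (of_nat s * b)) = y" by simp
  let ?P = "{1..r} \<rightarrow>\<^sub>E fld 1"
  let ?F = "\<lambda>M. restrict (coeff (recip_poly M)) {1..r}"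
  define G where "G = the_inv_into (stab r) ?F"
  note bij = bij_betw_stab[of r]
  have G: "G a \<in> stab r" "?F (G a) = a" if "a \<in> ?P" for a
    using the_inv_into_into[OF bij_betw_imp_inj_on[OF bij], of a "stab r"] that
      f_the_inv_into_f_bij_betw[OF bij, of a] bij_betw_imp_surj_on[OF bij]
    unfolding G_def by auto
  have cG: "coeff (recip_poly (G a)) i = a i" if "a \<in> ?P" "i \<in> {1..r}" for a i
    using fun_cong[OF G(2)[OF that(1)], of i] that(2) by simp
  have bijG: "bij_betw G ?P (stab r)" unfolding G_def by (rule bij_betw_the_inv_into[OF bij])
  let ?s = "\<lambda>b a. a(s := a s + b)"
  have sr: "s \<in> {1..r}" using assms s by auto
  have sP: "?s b a \<in> ?P" if "a \<in> ?P" "b \<in> fld 1" for a b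
    using that sr by (auto simp: PiE_iff fld_add extensional_def)
  have shift: "weight (G (?s b a)) = \<psi> y * weight (G a)" if a: "a \<in> ?P" for a
  proof -
    let ?M = "G a" and ?N = "G (?s b a)"
    have eq: "coeff (recip_poly ?N) i = coeff (recip_poly ?M) i" if "i < s" for i
    proof (cases "i = 0")
      case False
      then show ?thesis using cG[OF a, of i] cG[OF sP[OF a b], of i] that assms by auto
    qed (simp add: coeff_recip_poly_0)
    have s_eq: "coeff (recip_poly ?N) s = coeff (recip_poly ?M) s + b"
      using cG[OF a sr] cG[OF sP[OF a b] sr] by simp
    have ps: "power_sum i ?N = power_sum i ?M" if "0 < i" "i < s" for i
      using power_sum_eqI[of s ?N ?M i] eq that by blast
    have "(\<Sum>i=1..<s. power_sum i ?N * coeff (recip_poly ?N) (s - i)) =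
        (\<Sum>i=1..<s. power_sum i ?M * coeff (recip_poly ?M) (s - i))"
      by (intro sum.cong refl arg_cong2[of _ _ _ _ "(*)"] ps eq) auto
    then have "power_sum s ?N = power_sum s ?M - of_nat s * b"
      using s by (simp only: power_sum_newton[of s ?N] power_sum_newton[of s ?M] s_eq) (simp add: algebra_simps)
    moreover have "power_sum 1 ?N = power_sum 1 ?M" using ps s by auto
    ultimately have "c * power_sum s ?N + m * power_sum 1 ?N = y + (c * power_sum s ?M + m * power_sum 1 ?M)"
      by (simp only: cy[symmetric]) (simp add: right_diff_distrib)
    then show ?thesis
      unfolding weight_def using psi_add[OF y(1) weight_arg[OF G(1)[OF a]]] by simp
  qed
  have "A r = (\<Sum>a\<in>?P. weight (G a))" unfolding A_def by (rule sum.reindex_bij_betw[OF bijG, symmetric])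
  also have "\<dots> = (\<Sum>a\<in>?P. weight (G (?s b a)))"
  proof (rule sum.reindex_bij_witness[of _ "?s b" "?s (- b)"])
    fix a assume "a \<in> ?P"
    then show "?s b a \<in> ?P" "?s (- b) a \<in> ?P" using sP b fld_uminus[OF b] by blast+
  qed auto
  also have "\<dots> = \<psi> y * (\<Sum>a\<in>?P. weight (G a))" using shift by (simp add: sum_distrib_left)
  also have "(\<Sum>a\<in>?P. weight (G a)) = A r" unfolding A_def by (rule sum.reindex_bij_betw[OF bijG])
  finally have "(1 - \<psi> y) * A r = 0" by (simp add: algebra_simps)
  then show ?thesis using y by simp
qed

end

subsection \<open>Counting points on Artin-Schreier curves\<close>

locale artin_schreier = exp_sum U e p \<kappa> q \<psi> s c m
  for U :: "'t :: comm_ring_1 set" and e p \<kappa> q \<psi> s c m +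
  fixes n :: nat and b :: 't
  assumes n: "n > 0" and b: "b \<in> fld n"
begin

definition V :: "('t \<times> 't) set" where
  "V = {(x, y). x \<in> U \<and> y \<in> U \<and> y ^ q - y = f x - b}"

abbreviation K :: "'t set" where "K \<equiv> fld n"

text \<open>Semigroup of pole orders at the only point at infinity of the curve, where x has order q
  and y has order s. The restriction \<open>j < q\<close> selects one monomial for each order; the
  curve equation eliminates \<open>y^q\<close>.\<close>

definition W :: "nat set" where
  "W = {w. \<exists>i j. j < q \<and> w = i * q + j * s}"

definition expo :: "nat \<Rightarrow> nat \<times> nat" where
  "expo w = (SOME (i, j). j < q \<and> w = i * q + j * s)"

definition mon :: "nat \<Rightarrow> 't \<times> 't \<Rightarrow> 't" where
  "mon w v = fst v ^ fst (expo w) * snd v ^ snd (expo w)"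

abbreviation W_lt :: "nat \<Rightarrow> nat set" where
  "W_lt t \<equiv> {w. w \<in> W \<and> w < t}"

abbreviation comb :: "nat \<Rightarrow> (nat \<Rightarrow> 't) \<Rightarrow> 't \<times> 't \<Rightarrow> 't" where
  "comb t a v \<equiv> \<Sum>w\<in>W_lt t. a w * mon w v"

text \<open>Functions of pole order below t, in terms of the monomial basis over \<open>K\<close>.
  Equality is demanded on \<open>V\<close> only, since reduction by the curve equation is valid only
  there.\<close>

definition Lt :: "nat \<Rightarrow> ('t \<times> 't \<Rightarrow> 't) set" where
  "Lt t = {\<phi>. \<exists>a. (\<forall>w. a w \<in> K) \<and> (\<forall>v\<in>V. \<phi> v = comb t a v)}"

text \<open>Expresses that the pole order is exactly w; it behaves like a valuation under products
  and under sums of terms with distinct orders.\<close>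

definition lead :: "('t \<times> 't \<Rightarrow> 't) \<Rightarrow> nat \<Rightarrow> bool" where
  "lead \<phi> w \<longleftrightarrow> w \<in> W \<and> (\<exists>\<gamma>\<in>K - {0}. \<exists>l\<in>Lt w. \<forall>v\<in>V. \<phi> v = \<gamma> * mon w v + l v)"

section \<open>Weights and independence of the monomials\<close>

lemma coprime_s_q: "coprime s q"
proof -
  have "coprime s p" using p s(2) prime_imp_coprime coprime_commute by blast
  then show ?thesis using q by simp
qed

lemma weight_unique:
  assumes "j < q" "j' < q" "i * q + j * s = i' * q + j' * s"
  shows "i = i' \<and> j = j'"
proof -
  have le: "j = j'" if "j \<le> j'" "j' < q" "i * q + j * s = i' * q + j' * s" for i j i' j'
  proof -
    have "i * q = i' * q + (j' - j) * s"
      using that by (simp add: diff_mult_distrib)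
    then have "q dvd i' * q + (j' - j) * s" by (metis dvd_triv_right)
    then have "q dvd (j' - j) * s" by (simp add: dvd_add_right_iff)
    then have "q dvd j' - j" using coprime_s_q coprime_commute coprime_dvd_mult_left_iff by blast
    then have "j' - j = 0" using that(2) by (meson dvd_imp_le less_imp_diff_less not_gr_zero not_less)
    then show ?thesis using that(1) by simp
  qed
  have "j = j'"
    using le[of j j' i i'] le[of j' j i' i] assms by (cases "j \<le> j'") auto
  then show ?thesis using assms q_gt_1 by simp
qed

lemma expo: "j < q \<Longrightarrow> expo (i * q + j * s) = (i, j)"
  unfolding expo_def by (rule some_equality) (auto dest: weight_unique)

lemma mon_eq: "j < q \<Longrightarrow> mon (i * q + j * s) (x, y) = x ^ i * y ^ j"
  by (simp add: mon_def expo)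

lemma W_I: "j < q \<Longrightarrow> i * q + j * s \<in> W"
  by (auto simp: W_def)

lemma W_E:
  assumes "w \<in> W"
  obtains i j where "j < q" "w = i * q + j * s" "\<And>x y. mon w (x, y) = x ^ i * y ^ j"
  using assms mon_eq unfolding W_def by blast

lemma VD: "(x, y) \<in> V \<Longrightarrow> x \<in> U" "(x, y) \<in> V \<Longrightarrow> y \<in> U"
    "(x, y) \<in> V \<Longrightarrow> y ^ q = y + f x - b"
  by (auto simp: V_def algebra_simps)

lemma term_mem: "a \<in> U \<Longrightarrow> v \<in> V \<Longrightarrow> a * mon w v \<in> U"
  by (cases v) (auto simp: mon_def simp flip: mult.assoc intro!: mult_power_mem dest: VD)

lemma bU: "b \<in> U" using b fld_subset by blast

lemma fU: "x \<in> U \<Longrightarrow> f x \<in> U"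
  unfolding f_def using s c m fld_subset[of 1] by (intro add_mem mult_mem power_mem) auto

lemma ex_fibre_point:
  assumes "x \<in> U"
  shows "\<exists>y. (x, y) \<in> V"
proof -
  let ?c = "\<lambda>i. if i = 0 then - (f x - b) else if i = 1 then - e else 0"
  have "\<exists>y\<in>U. y ^ q + (\<Sum>i<q. ?c i * y ^ i) = 0"
    using q_gt_1 by (intro ex_root) (auto intro: uminus_mem minus_mem fU assms bU unit_mem zero_mem)
  then obtain y where y: "y \<in> U" "y ^ q + (\<Sum>i<q. ?c i * y ^ i) = 0" by blast
  have "(\<Sum>i<q. ?c i * y ^ i) = (\<Sum>i\<in>{0, 1}. ?c i * y ^ i)"
    using q_gt_1 by (intro sum.mono_neutral_right) auto
  also have "\<dots> = - (f x - b) - y" using unit_mult[OF y(1)] by simp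
  finally have sum_eq: "(\<Sum>i<q. ?c i * y ^ i) = - (f x - b) - y" .
  have "y ^ q - y = f x - b" using y(2) unfolding sum_eq by (simp add: algebra_simps)
  then show ?thesis using assms y by (auto simp: V_def)
qed

lemma fibre_translate:
  assumes "(x, y) \<in> V" "u \<in> fld 1"
  shows "(x, y + u) \<in> V"
proof -
  have "u \<in> U" "u ^ q = u" using assms(2) by (auto simp: fld_def)
  then have "(y + u) ^ q = y ^ q + u" using frob_add[of y u \<kappa>] VD[OF assms(1)] by (simp add: q)
  then show ?thesis using assms(1) \<open>u \<in> U\<close> by (auto simp: V_def intro: add_mem)
qed

text \<open>On the fibre over x the combination is a polynomial in y of degree below q with the q
  zeros \<open>y + u\<close>. So each of its coefficients, a polynomial in x, vanishes on all of
  \<open>U\<close>, which contains arbitrarily large finite sets.\<close>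

lemma mon_independent:
  assumes a: "\<And>w. w \<in> W \<Longrightarrow> w < t \<Longrightarrow> a w \<in> U"
    and zero: "\<And>v. v \<in> V \<Longrightarrow> comb t a v = 0"
    and w: "w \<in> W" "w < t"
  shows "a w = 0"
proof -
  define a' where "a' i j = (if i * q + j * s < t then a (i * q + j * s) else 0)" for i j
  have a'U: "a' i j \<in> U" if "j < q" for i j using that a W_I zero_mem by (auto simp: a'_def)
  have expand: "comb t a (x, y) = (\<Sum>j<q. (\<Sum>i<t. a' i j * x ^ i) * y ^ j)" for x y
  proof -
    have "comb t a (x, y) =
       (\<Sum>(j, i)\<in>{(j, i). j < q \<and> i < t \<and> i * q + j * s < t}. a' i j * x ^ i * y ^ j)"
    proof (rule sum.reindex_bij_witness[of _ "\<lambda>(j, i). i * q + j * s" "\<lambda>w. (snd (expo w), fst (expo w))"])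
      fix w assume w: "w \<in> W_lt t"
      then obtain i j where ij: "j < q" "w = i * q + j * s" by (auto elim: W_E)
      have "i \<le> i * q" using q_gt_1 by simp
      then have iq: "i \<le> i * q + j * s" by linarith
      show "(case (snd (expo w), fst (expo w)) of (j, i) \<Rightarrow> i * q + j * s) = w"
        using ij by (simp add: expo)
      have "i < t" using w ij iq by simp
      then show "(snd (expo w), fst (expo w)) \<in> {(j, i). j < q \<and> i < t \<and> i * q + j * s < t}"
        using w ij by (simp add: expo)
      show "(case (snd (expo w), fst (expo w)) of (j, i) \<Rightarrow> a' i j * x ^ i * y ^ j) = a w * mon w (x, y)"
        using w ij by (simp add: expo mon_eq a'_def mult.assoc)
    qed (auto simp: expo W_I)
    also have "\<dots> = (\<Sum>(j, i)\<in>{..<q} \<times> {..<t}. a' i j * x ^ i * y ^ j)"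
      by (rule sum.mono_neutral_left) (auto simp: a'_def split: if_splits)
    also have "\<dots> = (\<Sum>j<q. (\<Sum>i<t. a' i j * x ^ i) * y ^ j)"
      by (simp add: sum.cartesian_product sum_distrib_right)
    finally show ?thesis .
  qed
  have B0: "(\<Sum>i<t. a' i j * x ^ i) = 0" if x: "x \<in> U" and j: "j < q" for x j
  proof -
    obtain y where y: "(x, y) \<in> V" using ex_fibre_point[OF x] by blast
    have U: "(\<Sum>i<t. a' i j * x ^ i) \<in> U" if "j < q" for j
      using a'U that x by (intro sum_mem mult_power_mem) auto
    show ?thesis
    proof (rule card_roots_le[where S = "(\<lambda>u. y + u) ` fld 1" and n = q and c = "\<lambda>j. \<Sum>i<t. a' i j * x ^ i"])
      show "finite ((\<lambda>u. y + u) ` fld 1)" using finite_fld[of 1] by simp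
      show "(\<lambda>u. y + u) ` fld 1 \<subseteq> U" using VD(2)[OF y] fld_subset by (auto intro!: add_mem)
      show "card ((\<lambda>u. y + u) ` fld 1) \<ge> q" by (simp add: card_image card_fld_1[simplified])
      fix z assume "z \<in> (\<lambda>u. y + u) ` fld 1"
      then have "(x, z) \<in> V" using fibre_translate[OF y] by auto
      then show "(\<Sum>j<q. (\<Sum>i<t. a' i j * x ^ i) * z ^ j) = 0" unfolding expand[symmetric] by (rule zero)
    qed (use U j in auto)
  qed
  obtain i j where ij: "j < q" "w = i * q + j * s" using w by (auto elim: W_E)
  have "i \<le> i * q" using q_gt_1 by simp
  then have "i \<le> i * q + j * s" by linarith
  then have it: "i < t" using ij w by simp
  have "a' i j = 0"
  \<comment> \<open>\<open>fld t\<close> serves as a finite set with at least t elements.\<close>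
  proof (rule card_roots_le[where S = "fld t" and n = t and c = "\<lambda>i. a' i j"])
    have "t > 0" using w by simp
    then show "finite (fld t)" by (rule finite_fld)
    show "t \<le> card (fld t)" using \<open>t > 0\<close> q_gt_1 by (simp add: card_fld less_imp_le)
    show "(\<Sum>i<t. a' i j * x ^ i) = 0" if "x \<in> fld t" for x using that fld_subset B0 ij by blast
  qed (use fld_subset a'U ij it in auto)
  then show ?thesis using ij w by (simp add: a'_def)
qed

section \<open>Filtration by pole order and leading terms\<close>

lemma Lt_mono: "\<phi> \<in> Lt t \<Longrightarrow> t \<le> t' \<Longrightarrow> \<phi> \<in> Lt t'"
proof -
  assume "\<phi> \<in> Lt t" and le: "t \<le> t'"
  then obtain a where a: "\<forall>w. a w \<in> K" "\<forall>v\<in>V. \<phi> v = comb t a v"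
    unfolding Lt_def by blast
  have "(\<Sum>w | w \<in> W \<and> w < t'. (if w < t then a w else 0) * mon w v) = comb t a v" for v
    using le by (intro sum.mono_neutral_cong_right) auto
  then show ?thesis unfolding Lt_def using a fld_zero
    by (intro CollectI exI[of _ "\<lambda>w. if w < t then a w else 0"]) auto
qed

lemma Lt_zero: "(\<lambda>v. 0) \<in> Lt t"
  unfolding Lt_def using fld_zero by (intro CollectI exI[of _ "\<lambda>w. 0"]) auto

lemma Lt_add: "\<phi> \<in> Lt t \<Longrightarrow> \<phi>' \<in> Lt t \<Longrightarrow> (\<lambda>v. \<phi> v + \<phi>' v) \<in> Lt t"
proof -
  assume "\<phi> \<in> Lt t" "\<phi>' \<in> Lt t"
  then obtain a a' where a: "\<forall>w. a w \<in> K" "\<forall>v\<in>V. \<phi> v = comb t a v"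
    "\<forall>w. a' w \<in> K" "\<forall>v\<in>V. \<phi>' v = comb t a' v"
    unfolding Lt_def by blast
  then show ?thesis unfolding Lt_def
    by (intro CollectI exI[of _ "\<lambda>w. a w + a' w"]) (auto simp: fld_add distrib_right sum.distrib)
qed

lemma Lt_sum: "(\<And>i. i \<in> I \<Longrightarrow> \<phi> i \<in> Lt t) \<Longrightarrow> (\<lambda>v. \<Sum>i\<in>I. \<phi> i v) \<in> Lt t"
  by (induction I rule: infinite_finite_induct) (auto simp: Lt_zero Lt_add)

lemma Lt_cong: "\<phi> \<in> Lt t \<Longrightarrow> (\<And>v. v \<in> V \<Longrightarrow> \<phi> v = \<phi>' v) \<Longrightarrow> \<phi>' \<in> Lt t"
  unfolding Lt_def by auto

lemma Lt_mon:
  assumes "a \<in> K" "w \<in> W" "w < t"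
  shows "(\<lambda>v. a * mon w v) \<in> Lt t"
proof -
  have "(\<Sum>w' | w' \<in> W \<and> w' < t. (if w' = w then a else 0) * mon w' v) = a * mon w v" for v
    using assms by (subst sum.mono_neutral_cong_right[of _ "{w}" _ "\<lambda>_. a * mon w v"]) auto
  then show ?thesis unfolding Lt_def using assms fld_zero
    by (intro CollectI exI[of _ "\<lambda>w'. if w' = w then a else 0"]) auto
qed

lemma Lt_monomial:
  assumes "a \<in> K" "j < q" "i * q + j * s < t"
  shows "(\<lambda>(x, y). a * x ^ i * y ^ j) \<in> Lt t"
  by (rule Lt_cong[OF Lt_mon[OF assms(1) W_I[OF assms(2)] assms(3)]])
    (use assms(2) in \<open>auto simp: mon_eq mult.assoc\<close>)

text \<open>The relation \<open>y\<^sup>q = y + f(x) - b\<close> trades the monomial \<open>y\<^sup>q\<close> of weight \<open>q s\<close> for \<open>c x\<^sup>s\<close>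
  of the same weight, up to terms of smaller weight.\<close>

lemma mon_mult:
  assumes "w1 \<in> W" "w2 \<in> W" "a1 \<in> K" "a2 \<in> K"
  shows "w1 + w2 \<in> W \<and> (\<exists>\<gamma>\<in>K. (a1 \<noteq> 0 \<and> a2 \<noteq> 0 \<longrightarrow> \<gamma> \<noteq> 0) \<and> (\<exists>l\<in>Lt (w1 + w2).
    \<forall>v\<in>V. (a1 * mon w1 v) * (a2 * mon w2 v) = \<gamma> * mon (w1 + w2) v + l v))"
proof -
  obtain i1 j1 where 1: "j1 < q" "w1 = i1 * q + j1 * s" "\<And>x y. mon w1 (x, y) = x ^ i1 * y ^ j1"
    by (rule W_E[OF assms(1)]) (rule that; assumption)
  obtain i2 j2 where 2: "j2 < q" "w2 = i2 * q + j2 * s" "\<And>x y. mon w2 (x, y) = x ^ i2 * y ^ j2"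
    by (rule W_E[OF assms(2)]) (rule that; assumption)
  let ?a = "a1 * a2"
  have aK: "?a \<in> K" using assms fld_mult by blast
  have a0: "a1 \<noteq> 0 \<and> a2 \<noteq> 0 \<longrightarrow> ?a \<noteq> 0" using assms mult_eq_0 fld_subset by blast
  show ?thesis
  proof (cases "j1 + j2 < q")
    case True
    have w: "w1 + w2 = (i1 + i2) * q + (j1 + j2) * s" by (simp add: 1 2 algebra_simps)
    have monw: "mon (w1 + w2) (x, y) = x ^ (i1 + i2) * y ^ (j1 + j2)" for x y
      unfolding w by (rule mon_eq[OF True])
    have "(a1 * mon w1 v) * (a2 * mon w2 v) = ?a * mon (w1 + w2) v + 0" for v
      by (cases v) (simp add: 1(3) 2(3) monw power_add ac_simps)
    moreover have "w1 + w2 \<in> W" unfolding w by (rule W_I[OF True])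
    ultimately show ?thesis using aK a0 Lt_zero
      by (intro conjI bexI[of _ ?a] bexI[of _ "\<lambda>v. 0"] ballI) assumption+
  next
    case False
    define I J where "I = i1 + i2" and "J = j1 + j2 - q"
    have J: "J + 1 < q" "j1 + j2 = J + q" using False 1 2 by (auto simp: J_def)
    have "w1 + w2 = I * q + (j1 + j2) * s" by (simp add: 1(2) 2(2) I_def algebra_simps)
    then have w: "w1 + w2 = (I + s) * q + J * s" unfolding J(2) by (simp add: algebra_simps)
    have wlt: "I * q + (J + 1) * s < w1 + w2" "(I + 1) * q + J * s < w1 + w2" "I * q + J * s < w1 + w2"
    proof -
      have "s < s * q" "q < s * q" using s q_gt_1 by auto
      then show "I * q + (J + 1) * s < w1 + w2" "(I + 1) * q + J * s < w1 + w2" "I * q + J * s < w1 + w2"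
        unfolding w by (auto simp: algebra_simps)
    qed
    let ?l = "\<lambda>v. (\<lambda>(x, y). ?a * x ^ I * y ^ (J + 1)) v + (\<lambda>(x, y). ?a * m * x ^ (I + 1) * y ^ J) v
       + (\<lambda>(x, y). - ?a * b * x ^ I * y ^ J) v"
    have mK: "m \<in> K" "c \<in> K" using fld_base m c by blast+
    have "?l \<in> Lt (w1 + w2)"
      by (rule Lt_add, rule Lt_add; rule Lt_monomial) (use J wlt aK mK b fld_mult fld_uminus in simp_all)
    moreover have "(a1 * mon w1 v) * (a2 * mon w2 v) = ?a * c * mon (w1 + w2) v + ?l v" if "v \<in> V" for v
    proof -
      obtain x y where v: "v = (x, y)" by (cases v)
      have "(a1 * mon w1 v) * (a2 * mon w2 v) = ?a * x ^ I * y ^ J * y ^ q"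
        unfolding v 1(3) 2(3) mult.assoc power_add[symmetric] J(2)[symmetric] I_def
        by (simp add: power_add ac_simps)
      also have "y ^ q = y + (c * x ^ s + m * x) - b" using VD(3)[of x y] that v by (simp add: f_def)
      finally have "(a1 * mon w1 v) * (a2 * mon w2 v) = ?a * x ^ I * y ^ J * (y + (c * x ^ s + m * x) - b)" .
      also have "\<dots> = ?a * c * (x ^ (I + s) * y ^ J) + ?l v" by (simp add: v power_add algebra_simps)
      also have "x ^ (I + s) * y ^ J = mon (w1 + w2) v" using J by (simp add: v w mon_eq)
      finally show ?thesis .
    qed
    moreover have "w1 + w2 \<in> W" using W_I[of J "I + s"] J w by simp
    moreover have "?a * c \<in> K" by (rule fld_mult[OF aK mK(2)])
    moreover have "?a \<noteq> 0 \<longrightarrow> ?a * c \<noteq> 0" using aK c mult_eq_0[of ?a c] fld_subset by blast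
    ultimately show ?thesis using a0
      by (intro conjI bexI[of _ "?a * c"] bexI[of _ ?l] ballI) blast+
  qed
qed

text \<open>The bounds are strict, hence the shift by one: an order at most t and an order below
  \<open>t'\<close> add up to an order below \<open>t + t'\<close>.\<close>

lemma Lt_mult:
  assumes "\<phi> \<in> Lt (Suc t)" "\<phi>' \<in> Lt t'"
  shows "(\<lambda>v. \<phi> v * \<phi>' v) \<in> Lt (t + t')"
proof -
  obtain a a' where a: "\<forall>w. a w \<in> K" "\<forall>v\<in>V. \<phi> v = comb (Suc t) a v"
    "\<forall>w. a' w \<in> K" "\<forall>v\<in>V. \<phi>' v = comb t' a' v"
    using assms unfolding Lt_def by blast
  have "(\<lambda>v. \<Sum>w | w \<in> W \<and> w < Suc t. \<Sum>w' | w' \<in> W \<and> w' < t'. (a w * mon w v) * (a' w' * mon w' v)) \<in> Lt (t + t')"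
  proof (intro Lt_sum)
    fix w w' assume w: "w \<in> (W_lt (Suc t))" "w' \<in> W_lt t'"
    then obtain \<gamma> l where l: "w + w' \<in> W" "\<gamma> \<in> K" "l \<in> Lt (w + w')"
      "\<And>v. v \<in> V \<Longrightarrow> (a w * mon w v) * (a' w' * mon w' v) = \<gamma> * mon (w + w') v + l v"
      using mon_mult[of w w' "a w" "a' w'"] a by blast
    have "(\<lambda>v. \<gamma> * mon (w + w') v + l v) \<in> Lt (t + t')"
      using l w by (intro Lt_add Lt_mon) (auto intro: Lt_mono)
    then show "(\<lambda>v. (a w * mon w v) * (a' w' * mon w' v)) \<in> Lt (t + t')" by (rule Lt_cong) (simp add: l)
  qed
  then show ?thesis by (rule Lt_cong) (simp add: a sum_product)
qed

lemma lead_Lt: "lead \<phi> w \<Longrightarrow> \<phi> \<in> Lt (Suc w)"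
proof -
  assume "lead \<phi> w"
  then obtain \<gamma> l where l: "w \<in> W" "\<gamma> \<in> K" "l \<in> Lt w" "\<forall>v\<in>V. \<phi> v = \<gamma> * mon w v + l v"
    unfolding lead_def by blast
  have "(\<lambda>v. \<gamma> * mon w v + l v) \<in> Lt (Suc w)"
    using l by (intro Lt_add Lt_mon) (auto intro: Lt_mono)
  then show ?thesis by (rule Lt_cong) (simp add: l)
qed

lemma lead_nonzero:
  assumes "lead \<phi> w"
  shows "\<exists>v\<in>V. \<phi> v \<noteq> 0"
proof (rule ccontr)
  assume zero: "\<not> (\<exists>v\<in>V. \<phi> v \<noteq> 0)"
  obtain \<gamma> l where l: "w \<in> W" "\<gamma> \<in> K" "\<gamma> \<noteq> 0" "l \<in> Lt w" "\<forall>v\<in>V. \<phi> v = \<gamma> * mon w v + l v"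
    using assms unfolding lead_def by blast
  obtain a where a: "\<forall>w. a w \<in> K" "\<forall>v\<in>V. l v = (\<Sum>w' | w' \<in> W \<and> w' < w. a w' * mon w' v)"
    using l(4) unfolding Lt_def by blast
  let ?a = "a(w := \<gamma>)"
  have "?a w = 0"
  proof (rule mon_independent[where a = ?a and t = "Suc w"])
    fix v assume v: "v \<in> V"
    have "{w'. w' \<in> W \<and> w' < Suc w} = insert w {w'. w' \<in> W \<and> w' < w}" using l(1) by auto
    then have "(\<Sum>w' | w' \<in> W \<and> w' < Suc w. ?a w' * mon w' v) =
      \<gamma> * mon w v + (\<Sum>w' | w' \<in> W \<and> w' < w. ?a w' * mon w' v)" by simp
    also have "(\<Sum>w' | w' \<in> W \<and> w' < w. ?a w' * mon w' v) = l v"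
      using a(2) v by (auto intro!: sum.cong)
    finally show "(\<Sum>w' | w' \<in> W \<and> w' < Suc w. ?a w' * mon w' v) = 0" using zero l v by simp
  next
    fix w' assume "w' \<in> W" "w' < Suc w"
    show "?a w' \<in> U" using a(1) l(2) fld_subset by auto
  qed (use l in auto)
  then show False using l(3) by simp
qed

lemma ex_lead:
  assumes "\<phi> \<in> Lt t" "v0 \<in> V" "\<phi> v0 \<noteq> 0"
  shows "\<exists>w. lead \<phi> w"
proof -
  obtain a where a: "\<forall>w. a w \<in> K" "\<forall>v\<in>V. \<phi> v = comb t a v"
    using assms(1) unfolding Lt_def by blast
  let ?S = "{w. w \<in> W \<and> w < t \<and> a w \<noteq> 0}"
  have "?S \<noteq> {}"
  proof
    assume "?S = {}"
    then have "a w * mon w v0 = 0" if "w \<in> W" "w < t" for w using that by auto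
    then have "\<phi> v0 = 0" using a(2) assms(2) by simp
    then show False using assms(3) by simp
  qed
  moreover have fin: "finite ?S" by simp
  ultimately have M: "Max ?S \<in> ?S" by (rule Max_in[rotated])
  have max: "\<And>w. w \<in> ?S \<Longrightarrow> w \<le> Max ?S" using fin by (rule Max_ge)
  define w where "w = Max ?S"
  have w: "w \<in> W" "w < t" "a w \<noteq> 0" using M unfolding w_def by auto
  have "\<phi> v = a w * mon w v + (\<Sum>w' | w' \<in> W \<and> w' < w. a w' * mon w' v)" if "v \<in> V" for v
  proof -
    have "\<phi> v = (\<Sum>w' | w' \<in> W \<and> w' < t. a w' * mon w' v)" using a that by simp
    also have "\<dots> = (\<Sum>w'\<in>insert w {w'. w' \<in> W \<and> w' < w}. a w' * mon w' v)"
    proof (rule sum.mono_neutral_right)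
      show "\<forall>i\<in>{w'. w' \<in> W \<and> w' < t} - insert w {w'. w' \<in> W \<and> w' < w}. a i * mon i v = 0"
      proof
        fix i assume "i \<in> {w'. w' \<in> W \<and> w' < t} - insert w {w'. w' \<in> W \<and> w' < w}"
        then have "i \<in> W" "i < t" "i > w" by auto
        then have "a i = 0" using max[of i] unfolding w_def by fastforce
        then show "a i * mon i v = 0" by simp
      qed
    qed (use w in auto)
    finally show ?thesis by simp
  qed
  moreover have "(\<lambda>v. \<Sum>w' | w' \<in> W \<and> w' < w. a w' * mon w' v) \<in> Lt w"
    unfolding Lt_def using a(1) by blast
  ultimately have "lead \<phi> w" unfolding lead_def using w a(1)
    by (intro conjI bexI[of _ "a w"] bexI[of _ "\<lambda>v. \<Sum>w' | w' \<in> W \<and> w' < w. a w' * mon w' v"]) auto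
  then show ?thesis ..
qed

text \<open>By \<open>mon_mult\<close> the two leading terms multiply to a leading term with nonzero
  coefficient; the three other products have smaller weight.\<close>

lemma lead_mult:
  assumes "lead \<phi> w" "lead \<phi>' w'"
  shows "lead (\<lambda>v. \<phi> v * \<phi>' v) (w + w')"
proof -
  obtain g l where 1: "w \<in> W" "g \<in> K" "g \<noteq> 0" "l \<in> Lt w" "\<And>v. v \<in> V \<Longrightarrow> \<phi> v = g * mon w v + l v"
    using assms(1) unfolding lead_def by blast
  obtain g' l' where 2: "w' \<in> W" "g' \<in> K" "g' \<noteq> 0" "l' \<in> Lt w'" "\<And>v. v \<in> V \<Longrightarrow> \<phi>' v = g' * mon w' v + l' v"
    using assms(2) unfolding lead_def by blast
  obtain \<gamma> h where 3: "w + w' \<in> W" "\<gamma> \<in> K" "\<gamma> \<noteq> 0" "h \<in> Lt (w + w')"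
    "\<And>v. v \<in> V \<Longrightarrow> (g * mon w v) * (g' * mon w' v) = \<gamma> * mon (w + w') v + h v"
    using mon_mult[OF 1(1) 2(1) 1(2) 2(2)] 1(3) 2(3) by blast
  have A: "(\<lambda>v. (g * mon w v) * l' v) \<in> Lt (w + w')"
    using Lt_mult[OF Lt_mon[OF 1(2,1), of "Suc w"] 2(4)] by simp
  have B: "(\<lambda>v. (g' * mon w' v) * l v) \<in> Lt (w + w')"
    using Lt_mult[OF Lt_mon[OF 2(2,1), of "Suc w'"] 1(4)] by (simp add: add.commute)
  have C: "(\<lambda>v. l v * l' v) \<in> Lt (w + w')"
    using Lt_mult[OF Lt_mono[OF 1(4), of "Suc w"] 2(4)] by simp
  let ?l = "\<lambda>v. h v + (g * mon w v) * l' v + (g' * mon w' v) * l v + l v * l' v"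
  have "?l \<in> Lt (w + w')" using 3(4) A B C by (intro Lt_add)
  moreover have "\<phi> v * \<phi>' v = \<gamma> * mon (w + w') v + ?l v" if "v \<in> V" for v
  proof -
    have "\<phi> v * \<phi>' v = (g * mon w v) * (g' * mon w' v) + (g * mon w v) * l' v + (g' * mon w' v) * l v + l v * l' v"
      unfolding 1(5)[OF that] 2(5)[OF that] by (simp only: distrib_left distrib_right) (simp only: ac_simps)
    then show ?thesis unfolding 3(5)[OF that] by (simp only: add.assoc)
  qed
  ultimately show ?thesis unfolding lead_def using 3(1-3)
    by (intro conjI bexI[of _ \<gamma>] bexI[of _ ?l]) auto
qed

lemma lead_power: "lead \<phi> w \<Longrightarrow> k > 0 \<Longrightarrow> lead (\<lambda>v. \<phi> v ^ k) (k * w)"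
proof (induction k)
  case (Suc k)
  then show ?case using lead_mult[of \<phi> w "\<lambda>v. \<phi> v ^ k" "k * w"] by (cases "k = 0") auto
qed auto

lemma lead_mon: "a \<in> K \<Longrightarrow> a \<noteq> 0 \<Longrightarrow> w \<in> W \<Longrightarrow> lead (\<lambda>v. a * mon w v) w"
  unfolding lead_def using Lt_zero by force

text \<open>Injectivity of \<omega> singles out one summand of largest weight, and nothing can
  cancel its leading term.\<close>

lemma lead_sum:
  assumes "finite I" "I \<noteq> {}" "inj_on \<omega> I" "\<And>i. i \<in> I \<Longrightarrow> lead (g i) (\<omega> i)"
  shows "\<exists>i\<in>I. lead (\<lambda>v. \<Sum>i\<in>I. g i v) (\<omega> i)"
proof -
  have "Max (\<omega> ` I) \<in> \<omega> ` I" using assms by (intro Max_in) auto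
  then obtain i where i: "i \<in> I" "\<omega> i = Max (\<omega> ` I)" by auto
  have lt: "\<omega> j < \<omega> i" if "j \<in> I - {i}" for j
  proof -
    have "\<omega> j \<le> \<omega> i" using that assms(1) i by simp
    moreover have "\<omega> j \<noteq> \<omega> i" using that inj_onD[OF assms(3), of j i] i by auto
    ultimately show ?thesis by simp
  qed
  obtain g' l where 1: "\<omega> i \<in> W" "g' \<in> K - {0}" "l \<in> Lt (\<omega> i)" "\<And>v. v \<in> V \<Longrightarrow> g i v = g' * mon (\<omega> i) v + l v"
    using assms(4)[OF i(1)] unfolding lead_def by blast
  have "(\<lambda>v. \<Sum>j\<in>I - {i}. g j v) \<in> Lt (\<omega> i)"
    by (rule Lt_sum) (use lead_Lt[OF assms(4)] lt Lt_mono Suc_leI in blast)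
  then have "(\<lambda>v. l v + (\<Sum>j\<in>I - {i}. g j v)) \<in> Lt (\<omega> i)" using 1 by (intro Lt_add)
  moreover have "(\<Sum>j\<in>I. g j v) = g' * mon (\<omega> i) v + (l v + (\<Sum>j\<in>I - {i}. g j v))" if "v \<in> V" for v
    using 1(4)[OF that] by (subst sum.remove[OF assms(1) i(1)]) simp
  ultimately have "lead (\<lambda>v. \<Sum>i\<in>I. g i v) (\<omega> i)" unfolding lead_def using 1(1,2)
    by (intro conjI bexI[of _ g'] bexI[of _ "\<lambda>v. l v + (\<Sum>j\<in>I - {i}. g j v)"]) auto
  then show ?thesis using i(1) by blast
qed


section \<open>Interpolation at rational points and counting of zeros\<close>

definition regular :: "('t \<times> 't \<Rightarrow> 't) \<Rightarrow> bool" where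
  "regular \<phi> \<longleftrightarrow> (\<exists>t. \<phi> \<in> Lt t)"

lemma regular_add: "regular \<phi> \<Longrightarrow> regular \<phi>' \<Longrightarrow> regular (\<lambda>v. \<phi> v + \<phi>' v)"
proof -
  assume "regular \<phi>" "regular \<phi>'"
  then obtain t t' where "\<phi> \<in> Lt t" "\<phi>' \<in> Lt t'" unfolding regular_def by blast
  then have "\<phi> \<in> Lt (t + t')" "\<phi>' \<in> Lt (t + t')" by (auto intro: Lt_mono)
  then show ?thesis unfolding regular_def using Lt_add by blast
qed

lemma regular_mult: "regular \<phi> \<Longrightarrow> regular \<phi>' \<Longrightarrow> regular (\<lambda>v. \<phi> v * \<phi>' v)"
proof -
  assume "regular \<phi>" "regular \<phi>'"
  then obtain t t' where "\<phi> \<in> Lt t" "\<phi>' \<in> Lt t'" unfolding regular_def by blast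
  then have "\<phi> \<in> Lt (Suc t)" by (auto intro: Lt_mono)
  then show ?thesis unfolding regular_def using Lt_mult \<open>\<phi>' \<in> Lt t'\<close> by blast
qed

lemma regular_power: "regular \<phi> \<Longrightarrow> k > 0 \<Longrightarrow> regular (\<lambda>v. \<phi> v ^ k)"
proof (induction k)
  case (Suc k)
  then show ?case using regular_mult[of \<phi> "\<lambda>v. \<phi> v ^ k"] by (cases "k = 0") auto
qed simp

lemma regular_cong: "regular \<phi> \<Longrightarrow> (\<And>v. v \<in> V \<Longrightarrow> \<phi> v = \<phi>' v) \<Longrightarrow> regular \<phi>'"
  unfolding regular_def using Lt_cong by blast

lemma regular_monomial: "a \<in> K \<Longrightarrow> j < q \<Longrightarrow> regular (\<lambda>(x, y). a * x ^ i * y ^ j)"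
  unfolding regular_def using Lt_monomial by blast

lemma regular_const: "a \<in> K \<Longrightarrow> regular (\<lambda>v. a)"
  by (rule regular_cong[OF regular_monomial[of a 0 0]]) (use q_gt_1 in auto)

lemma regular_fst: "regular fst"
  by (rule regular_cong[OF regular_monomial[OF fld_unit, of 0 1]])
    (use q_gt_1 unit_mult VD in \<open>auto simp: mult.assoc\<close>)

lemma regular_snd: "regular snd"
  by (rule regular_cong[OF regular_monomial[OF fld_unit, of 1 0]])
    (use q_gt_1 unit_mult VD in \<open>auto simp: mult.assoc\<close>)

lemma Lt_mem: "\<phi> \<in> Lt t \<Longrightarrow> v \<in> V \<Longrightarrow> \<phi> v \<in> U"
proof -
  assume "\<phi> \<in> Lt t" "v \<in> V"
  then obtain a where a: "\<forall>w. a w \<in> K" "\<phi> v = comb t a v"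
    unfolding Lt_def by blast
  show ?thesis unfolding a(2) using a(1) fld_subset \<open>v \<in> V\<close> by (intro sum_mem term_mem) auto
qed

lemma regular_diff: "regular \<phi> \<Longrightarrow> regular \<phi>' \<Longrightarrow> regular (\<lambda>v. \<phi> v - \<phi>' v)"
proof -
  assume a: "regular \<phi>" "regular \<phi>'"
  then obtain t where t: "\<phi>' \<in> Lt t" unfolding regular_def by blast
  have e: "- e \<in> K" by (rule fld_uminus[OF fld_unit])
  have "regular (\<lambda>v. \<phi> v + (- e) * \<phi>' v)"
    using a by (intro regular_add regular_mult regular_const e)
  moreover have "(- e) * \<phi>' v = - \<phi>' v" if "v \<in> V" for v
    using unit_mult[OF Lt_mem[OF t that]] by simp
  ultimately show ?thesis by (auto intro: regular_cong)
qed

lemma power_Q_minus_1: "z \<in> K \<Longrightarrow> z \<noteq> 0 \<Longrightarrow> z ^ (q ^ n - 1) = e"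
proof -
  assume z: "z \<in> K" "z \<noteq> 0"
  then have zU: "z \<in> U" "z ^ (q ^ n) = z" by (auto simp: fld_def)
  have Q: "q ^ n > 1" using n by (rule q_power_gt_1)
  have "z * z ^ (q ^ n - 1) = z ^ Suc (q ^ n - 1)" by simp
  also have "Suc (q ^ n - 1) = q ^ n" using Q by simp
  also have "z ^ (q ^ n) = z * e" using zU unit_mult[of z] by (simp add: mult.commute)
  finally show ?thesis by (rule mult_cancel[OF zU(1) z(2) power_mem[OF zU(1)] unit_mem, rotated]) (use Q in simp)
qed

definition points_K :: "('t \<times> 't) set" where
  "points_K = {(x, y). (x, y) \<in> V \<and> x \<in> K \<and> y \<in> K}"

lemma finite_points_K: "finite points_K"
  by (rule finite_subset[of _ "K \<times> K"]) (use finite_fld[OF n] in \<open>auto simp: points_K_def\<close>)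

text \<open>By \<open>power_Q_minus_1\<close> the function \<open>e - (z - z0)^(q^n - 1)\<close> is
  the indicator of z0 on \<open>K\<close>; one such factor is taken for each coordinate.\<close>

lemma ex_indicator:
  assumes "P \<in> points_K"
  shows "\<exists>\<phi>. regular \<phi> \<and> (\<forall>v\<in>points_K. \<phi> v = (if v = P then e else 0))"
proof -
  obtain x0 y0 where P: "P = (x0, y0)" "x0 \<in> K" "y0 \<in> K" using assms by (auto simp: points_K_def)
  let ?k = "q ^ n - 1"
  have k: "?k > 0" using q_power_gt_1[OF n] by simp
  let ?\<phi> = "\<lambda>v. (e - (fst v - x0) ^ ?k) * (e - (snd v - y0) ^ ?k)"
  have "regular ?\<phi>"
    using k by (intro regular_mult regular_diff regular_power regular_const fld_unit regular_fst regular_snd P)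
  moreover have pw: "e - (z - z0) ^ ?k = (if z = z0 then e else 0)" if "z \<in> K" "z0 \<in> K" for z z0
    using power_Q_minus_1[of "z - z0"] fld_diff[OF that] k by (auto simp: zero_power)
  have "?\<phi> v = (if v = P then e else 0)" if vP: "v \<in> points_K" for v
  proof -
    obtain x y where v: "v = (x, y)" "x \<in> K" "y \<in> K" using vP by (auto simp: points_K_def)
    have "?\<phi> v = (if x = x0 then e else 0) * (if y = y0 then e else 0)"
      unfolding v(1) fst_conv snd_conv pw[OF v(2) P(2)] pw[OF v(3) P(3)] ..
    then show ?thesis using unit_mult[OF unit_mem] by (simp add: v(1) P(1))
  qed
  ultimately show ?thesis by blast
qed

text \<open>Dimensions over \<open>K\<close> are compared through the cardinalities of coefficient
  spaces, so that rank arguments become injectivity and pigeonhole arguments.\<close>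

lemma card_coeffs: "card ((W_lt t) \<rightarrow>\<^sub>E K) = (q ^ n) ^ card (W_lt t)"
  by (simp add: card_PiE card_fld[OF n])

lemma coeffs_inj:
  assumes "a \<in> W_lt t \<rightarrow>\<^sub>E K" "a' \<in> W_lt t \<rightarrow>\<^sub>E K"
    and "\<And>v. v \<in> V \<Longrightarrow> comb t a v = comb t a' v"
  shows "a = a'"
proof (rule PiE_ext[OF assms(1,2)])
  fix w assume w: "w \<in> W_lt t"
  have "a w - a' w = 0"
  proof (rule mon_independent[where a = "\<lambda>w. a w - a' w" and t = t])
    fix w assume "w \<in> W" "w < t"
    then show "a w - a' w \<in> U" using assms(1,2) fld_subset by (intro minus_mem) (auto simp: PiE_iff)
  qed (use assms(3) w in \<open>auto simp: left_diff_distrib sum_subtractf\<close>)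
  then show "a w = a' w" by simp
qed

lemma ex_coeffs:
  assumes "\<phi> \<in> Lt t"
  shows "\<exists>a\<in>W_lt t \<rightarrow>\<^sub>E K. \<forall>v\<in>V. \<phi> v = comb t a v"
proof -
  obtain a where a: "\<forall>w. a w \<in> K" "\<forall>v\<in>V. \<phi> v = comb t a v"
    using assms unfolding Lt_def by blast
  show ?thesis
    by (rule bexI[of _ "restrict a (W_lt t)"]) (use a in auto)
qed

text \<open>A function with leading weight \<open>D\<close> has at most \<open>D\<close> zeros: multiplication by it together with
  interpolation at the zeros embeds \<open>Lt t \<oplus> K\<^sup>Z\<close> into \<open>Lt (t + D)\<close>, and \<open>Lt (t + D)\<close> has
  at most \<open>D\<close> more dimensions than \<open>Lt t\<close>.\<close>

lemma card_zeros_le: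
  assumes G: "lead G D" and Z: "Z \<subseteq> points_K" "\<And>v. v \<in> Z \<Longrightarrow> G v = 0"
  shows "card Z \<le> D"
proof -
  have finZ: "finite Z" using Z(1) finite_points_K by (rule finite_subset)
  have "\<exists>i. \<forall>P\<in>Z. regular (i P) \<and> (\<forall>v\<in>points_K. i P v = (if v = P then e else 0))"
    using ex_indicator Z(1) by (intro bchoice) blast
  then obtain i where i: "\<And>P. P \<in> Z \<Longrightarrow> regular (i P)"
    "\<And>P v. P \<in> Z \<Longrightarrow> v \<in> points_K \<Longrightarrow> i P v = (if v = P then e else 0)" by blast
  have "\<exists>T. \<forall>P\<in>Z. i P \<in> Lt (T P)" using i(1) unfolding regular_def by (intro bchoice) blast
  then obtain T where T: "\<And>P. P \<in> Z \<Longrightarrow> i P \<in> Lt (T P)" by blast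
  define t where "t = Max (insert 0 (T ` Z))"
  have it: "i P \<in> Lt t" if "P \<in> Z" for P
    using T[OF that] by (rule Lt_mono) (use that finZ in \<open>auto simp: t_def\<close>)
  let ?ev = "\<lambda>t a v. \<Sum>w | w \<in> W \<and> w < t. a w * mon w v"
  let ?X = "(W_lt t \<rightarrow>\<^sub>E K) \<times> (Z \<rightarrow>\<^sub>E K)"
  let ?\<Phi> = "\<lambda>(a, l) v. G v * ?ev t a v + (\<Sum>P\<in>Z. l P * i P v)"
  have ev: "?ev t a \<in> Lt t" if "a \<in> W_lt t \<rightarrow>\<^sub>E K" for a
    unfolding Lt_def using that fld_zero[of n]
    by (intro CollectI exI[of _ "\<lambda>w. if w \<in> W_lt t then a w else 0"]) (auto simp: PiE_iff intro!: sum.cong)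
  have Phi: "?\<Phi> z \<in> Lt (t + D)" if zX: "z \<in> ?X" for z
  proof -
    obtain a l where z: "z = (a, l)" "a \<in> W_lt t \<rightarrow>\<^sub>E K" "l \<in> Z \<rightarrow>\<^sub>E K" using zX by (cases z) auto
    have "(\<lambda>v. G v * ?ev t a v) \<in> Lt (D + t)" by (rule Lt_mult[OF lead_Lt[OF G] ev[OF z(2)]])
    moreover have "(\<lambda>v. l P * i P v) \<in> Lt (t + D)" if "P \<in> Z" for P
    proof -
      have lP: "l P \<in> K" using z(3) that by auto
      have "(\<lambda>v. l P) \<in> Lt (Suc 0)"
        by (rule Lt_cong[OF Lt_monomial[OF lP, of 0 0]]) (use q_gt_1 in auto)
      from Lt_mult[OF this it[OF that]] show ?thesis by (auto intro: Lt_mono)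
    qed
    ultimately show ?thesis unfolding z(1) prod.case by (intro Lt_add Lt_sum) (simp_all add: add.commute)
  qed
  have "\<exists>h. \<forall>z\<in>?X. h z \<in> W_lt (t + D) \<rightarrow>\<^sub>E K \<and> (\<forall>v\<in>V. ?\<Phi> z v = ?ev (t + D) (h z) v)"
    using ex_coeffs[OF Phi] by (intro bchoice) blast
  then obtain h where
    hX: "\<forall>z\<in>?X. h z \<in> W_lt (t + D) \<rightarrow>\<^sub>E K \<and> (\<forall>v\<in>V. ?\<Phi> z v = ?ev (t + D) (h z) v)" by (elim exE)
  have h: "h z \<in> W_lt (t + D) \<rightarrow>\<^sub>E K" "\<And>v. v \<in> V \<Longrightarrow> ?\<Phi> z v = ?ev (t + D) (h z) v" if "z \<in> ?X" for z
    using bspec[OF hX that] by (rule conjunct1, rule bspec[OF conjunct2])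
  have PhiZ: "?\<Phi> (a, l) P = l P" if "l \<in> Z \<rightarrow>\<^sub>E K" "P \<in> Z" for a l P
  proof -
    have "(\<Sum>P'\<in>Z. l P' * i P' P) = (\<Sum>P'\<in>Z. if P' = P then l P' * e else 0)"
    proof (intro sum.cong refl)
      fix P' assume "P' \<in> Z"
      then show "l P' * i P' P = (if P' = P then l P' * e else 0)"
        using i(2)[of P' P] that(2) Z(1) by auto
    qed
    also have "\<dots> = l P * e" using that(2) finZ by simp
    also have "\<dots> = l P"
    proof -
      have "l P \<in> U" using that fld_subset by blast
      then show ?thesis using unit_mult[of "l P"] by (simp add: mult.commute)
    qed
    finally show ?thesis using Z(2)[OF that(2)] by simp
  qed
  have "inj_on h ?X"
  proof (rule inj_onI)
    fix z z' assume z: "z \<in> ?X" "z' \<in> ?X" "h z = h z'"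
    obtain a l a' l' where zz: "z = (a, l)" "z' = (a', l')" by (cases z, cases z')
    have al: "a \<in> W_lt t \<rightarrow>\<^sub>E K" "a' \<in> W_lt t \<rightarrow>\<^sub>E K" "l \<in> Z \<rightarrow>\<^sub>E K" "l' \<in> Z \<rightarrow>\<^sub>E K" using z(1,2) zz by auto
    have eq: "?\<Phi> (a, l) v = ?\<Phi> (a', l') v" if "v \<in> V" for v
      using h(2)[OF z(1) that] h(2)[OF z(2) that] z(3) zz by simp
    \<comment> \<open>At the points of Z the factor G vanishes and the interpolation part returns
      l.\<close>
    have l: "l = l'"
    proof (rule PiE_ext[OF al(3,4)])
      fix P assume P: "P \<in> Z"
      then have "P \<in> V" using Z(1) by (auto simp: points_K_def)
      from eq[OF this] show "l P = l' P" unfolding PhiZ[OF al(3) P] PhiZ[OF al(4) P] .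
    qed
    \<comment> \<open>The interpolation parts agree by now, so G annihilates the difference of the
      other parts; since leading weights add, that product would be nonzero.\<close>
    have "a = a'"
    proof (rule ccontr)
      assume "a \<noteq> a'"
      let ?d = "\<lambda>v. ?ev t a v - ?ev t a' v"
      have "\<exists>v\<in>V. ?d v \<noteq> 0" using coeffs_inj[OF al(1,2)] \<open>a \<noteq> a'\<close> by auto
      then obtain v0 where v0: "v0 \<in> V" "?d v0 \<noteq> 0" by blast
      have "regular ?d" using ev[OF al(1)] ev[OF al(2)] regular_diff unfolding regular_def by blast
      then obtain t' where "?d \<in> Lt t'" unfolding regular_def by blast
      then obtain w where "lead ?d w" using ex_lead v0 by blast
      from lead_nonzero[OF lead_mult[OF G this]] obtain v where v: "v \<in> V" "G v * ?d v \<noteq> 0" by blast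
      moreover have "G v * ?ev t a v = G v * ?ev t a' v" using eq[OF v(1)] l by simp
      ultimately show False by (simp add: right_diff_distrib)
    qed
    then show "z = z'" using zz l by simp
  qed
  moreover have "h ` ?X \<subseteq> W_lt (t + D) \<rightarrow>\<^sub>E K" using h(1) by blast
  moreover have "finite (W_lt (t + D) \<rightarrow>\<^sub>E K)" using finite_fld[OF n] by (intro finite_PiE) auto
  ultimately have "card ?X \<le> card (W_lt (t + D) \<rightarrow>\<^sub>E K)" by (rule card_inj_on_le)
  then have "(q ^ n) ^ (card (W_lt t) + card Z) \<le> (q ^ n) ^ card (W_lt (t + D))"
    unfolding card_cartesian_product card_coeffs using finZ by (simp add: card_PiE card_fld[OF n] power_add)
  then have "card (W_lt t) + card Z \<le> card (W_lt (t + D))"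
    using q_power_gt_1[OF n] by (simp only: power_increasing_iff)
  moreover have "card (W_lt (t + D)) \<le> card (W_lt t) + card {t..<t + D}"
  proof -
    have "card (W_lt (t + D)) \<le> card (W_lt t \<union> {t..<t + D})" by (rule card_mono) auto
    also have "\<dots> \<le> card (W_lt t) + card {t..<t + D}" by (rule card_Un_le)
    finally show ?thesis .
  qed
  ultimately show ?thesis by simp
qed

section \<open>Stepanov's auxiliary function and the number of points\<close>

lemma card_W_le: "card (W_lt t) \<le> t"
proof -
  have "card (W_lt t) \<le> card {..<t}" by (rule card_mono) auto
  then show ?thesis by simp
qed

text \<open>Every \<open>w \<ge> q s\<close> belongs to the semigroup, so at most \<open>q s\<close>
  orders are gaps. This plays the role of the Riemann-Roch inequality.\<close>

lemma card_W_ge: "t \<le> card (W_lt t) + q * s"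
proof -
  have "coprime s q" "q \<noteq> 1" using coprime_s_q q_gt_1 by auto
  then obtain a b where ab: "s * a = q * b + 1" using coprime_bezout_strong by blast
  have "w \<in> W" if "w \<ge> q * s" for w
  proof -
    \<comment> \<open>Solves \<open>j s \<equiv> w\<close> modulo q, a being an inverse of
      s.\<close>
    define j where "j = (w * a) mod q"
    have j: "j < q" using q_gt_1 by (simp add: j_def)
    then have js: "j * s \<le> w" using that by (meson le_trans less_imp_le mult_le_mono1)
    have "(j * s) mod q = (w * (s * a)) mod q" unfolding j_def mod_mult_left_eq by (simp add: ac_simps)
    also have "w * (s * a) = w + q * (b * w)" by (simp only: ab) (simp add: algebra_simps)
    finally have "(j * s) mod q = w mod q" by simp
    then have "q dvd w - j * s" by (metis mod_eq_dvd_iff_nat js)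
    then obtain i where "w - j * s = q * i" by auto
    then have "w = i * q + j * s" using js by (simp add: mult.commute)
    then show ?thesis using W_I[OF j] by simp
  qed
  then have "{q * s..<t} \<subseteq> (W_lt t)" by auto
  then have "card {q * s..<t} \<le> card (W_lt t)" by (intro card_mono) auto
  then show ?thesis by simp
qed

text \<open>Pigeonhole: every sum of terms \<open>a(u,v) u^B v\<close> lies in \<open>Lt T\<close>,
  and there are more coefficient arrays than functions on \<open>V\<close> in that space. The
  relation is the difference of two arrays that give the same function.\<close>

lemma ex_auxiliary_relation:
  assumes "T \<ge> B * (L - 1) + M" "M > 0" "L > 0" "B > 0"
    and "card (W_lt T) < card (W_lt L) * card (W_lt M)"
  shows "\<exists>d. (\<forall>u v. d u v \<in> K) \<and> (\<exists>u v. u \<in> W \<and> u < L \<and> v \<in> W \<and> v < M \<and> d u v \<noteq> 0) \<and>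
    (\<forall>z\<in>V. (\<Sum>u | u \<in> W \<and> u < L. \<Sum>v | v \<in> W \<and> v < M. d u v * mon u z ^ B * mon v z) = 0)"
proof -
  let ?X = "(W_lt L \<times> W_lt M) \<rightarrow>\<^sub>E K"
  let ?ev = "\<lambda>a z. \<Sum>u | u \<in> W \<and> u < L. \<Sum>v | v \<in> W \<and> v < M. a (u, v) * mon u z ^ B * mon v z"
  let ?ev' = "\<lambda>a v. \<Sum>w | w \<in> W \<and> w < T. a w * mon w v"
  have ev: "?ev a \<in> Lt T" if aX: "a \<in> ?X" for a
  proof (intro Lt_sum)
    fix u v assume uv: "u \<in> W_lt L" "v \<in> W_lt M"
    then have a: "a (u, v) \<in> K" using aX by auto
    have eK: "e \<in> K" by (rule fld_unit)
    have "lead (\<lambda>z. (e * mon u z) ^ B) (B * u)"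
      using uv unit_neq_0 assms eK by (intro lead_power lead_mon) auto
    from Lt_mult[OF lead_Lt[OF this] Lt_mon[OF a, of v "Suc v"]] uv
    have "(\<lambda>z. (e * mon u z) ^ B * (a (u, v) * mon v z)) \<in> Lt (B * u + Suc v)" by simp
    moreover have "B * u + Suc v \<le> T"
    proof -
      have "B * u \<le> B * (L - 1)" using uv by (intro mult_le_mono2) auto
      moreover have "v < M" using uv by simp
      ultimately show ?thesis using assms(1) by linarith
    qed
    ultimately have "(\<lambda>z. (e * mon u z) ^ B * (a (u, v) * mon v z)) \<in> Lt T" by (rule Lt_mono)
    then show "(\<lambda>z. a (u, v) * mon u z ^ B * mon v z) \<in> Lt T"
    proof (rule Lt_cong)
      fix z
      have "(e * mon u z) ^ B * (a (u, v) * mon v z) = (e * a (u, v)) * mon u z ^ B * mon v z"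
        using assms by (simp add: power_mult_distrib unit_power ac_simps)
      also have "e * a (u, v) = a (u, v)" using a fld_subset unit_mult by blast
      finally show "(e * mon u z) ^ B * (a (u, v) * mon v z) = a (u, v) * mon u z ^ B * mon v z" .
    qed
  qed
  have "\<exists>h. \<forall>a\<in>?X. h a \<in> W_lt T \<rightarrow>\<^sub>E K \<and> (\<forall>v\<in>V. ?ev a v = ?ev' (h a) v)"
    using ex_coeffs[OF ev] by (intro bchoice) blast
  then obtain h where hX: "\<forall>a\<in>?X. h a \<in> W_lt T \<rightarrow>\<^sub>E K \<and> (\<forall>v\<in>V. ?ev a v = ?ev' (h a) v)" by (elim exE)
  have h: "h a \<in> W_lt T \<rightarrow>\<^sub>E K" "\<And>v. v \<in> V \<Longrightarrow> ?ev a v = ?ev' (h a) v" if "a \<in> ?X" for a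
    using bspec[OF hX that] by (rule conjunct1, rule bspec[OF conjunct2])
  have "finite (W_lt T \<rightarrow>\<^sub>E K)" using finite_fld[OF n] by (intro finite_PiE) auto
  moreover have "h ` ?X \<subseteq> W_lt T \<rightarrow>\<^sub>E K" using h(1) by blast
  moreover have "card (W_lt T \<rightarrow>\<^sub>E K) < card ?X"
  proof -
    have "card ?X = (q ^ n) ^ (card (W_lt L) * card (W_lt M))"
      by (simp add: card_PiE card_fld[OF n] card_cartesian_product)
    then show ?thesis unfolding card_coeffs using assms q_power_gt_1[OF n] by (simp only: power_strict_increasing_iff)
  qed
  ultimately have "\<not> inj_on h ?X" using card_inj_on_le[of h ?X "W_lt T \<rightarrow>\<^sub>E K"] by linarith
  then obtain a a' where aa: "a \<in> ?X" "a' \<in> ?X" "h a = h a'" "a \<noteq> a'" unfolding inj_on_def by blast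
  define d where "d u v = (if (u, v) \<in> W_lt L \<times> W_lt M then a (u, v) - a' (u, v) else 0)" for u v
  have "d u v \<in> K" for u v
    using aa(1,2) fld_zero[of n] by (auto simp: d_def PiE_iff intro!: fld_diff)
  moreover have "\<exists>u v. u \<in> W \<and> u < L \<and> v \<in> W \<and> v < M \<and> d u v \<noteq> 0"
  proof (rule ccontr)
    assume no: "\<not> ?thesis"
    have "a = a'"
    proof (rule PiE_ext[OF aa(1,2)])
      fix z assume z: "z \<in> W_lt L \<times> W_lt M"
      obtain u v where uv: "z = (u, v)" by (cases z)
      with z no have "d u v = 0" by auto
      then show "a z = a' z" using z uv by (simp add: d_def)
    qed
    then show False using aa by simp
  qed
  moreover have "(\<Sum>u | u \<in> W \<and> u < L. \<Sum>v | v \<in> W \<and> v < M. d u v * mon u z ^ B * mon v z) = 0" if "z \<in> V" for z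
  proof -
    have "(\<Sum>u | u \<in> W \<and> u < L. \<Sum>v | v \<in> W \<and> v < M. d u v * mon u z ^ B * mon v z) = ?ev a z - ?ev a' z"
      unfolding sum_subtractf[symmetric] by (intro sum.cong refl) (auto simp: d_def left_diff_distrib)
    then show ?thesis using h(2)[OF aa(1) that] h(2)[OF aa(2) that] aa(3) by simp
  qed
  ultimately show ?thesis by blast
qed

text \<open>Extracting \<open>B\<close>-th roots of the coefficients of a relation \<open>\<Sum> d u\<^sup>B v = 0\<close>, where \<open>B B' = q\<^sup>n\<close>, gives
  \<open>G = \<Sum> d\<^sup>1\<^sup>/\<^sup>B u v\<^sup>B\<^sup>'\<close>. It vanishes at all points over \<open>K\<close>, because \<open>G\<^sup>B = \<Sum> d u\<^sup>B v\<close> there, but it is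
  nonzero, because its terms have distinct weights.\<close>

lemma card_points_K_le:
  assumes BB: "\<beta> + \<beta>' = n" "\<beta> > 0" "\<beta>' > 0"
    and "card {w. w \<in> W \<and> w < q ^ \<beta> * (q ^ \<beta>' - 1) + M} <
       card {w. w \<in> W \<and> w < q ^ \<beta>'} * card (W_lt M)"
    and M: "M > 0"
  shows "card points_K \<le> (q ^ \<beta>' - 1) + q ^ \<beta>' * (M - 1)"
proof -
  define B B' where "B = q ^ \<beta>" and "B' = q ^ \<beta>'"
  have B: "B > 0" "B' > 0" "B' * B = q ^ n" "B * B' = q ^ n"
  proof -
    show "B > 0" "B' > 0" unfolding B_def B'_def using q_gt_1 by simp_all
    show "B' * B = q ^ n" "B * B' = q ^ n"
      unfolding B_def B'_def power_add[symmetric] using BB by (simp_all add: add.commute)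
  qed
  obtain d where d: "\<And>u v. d u v \<in> K" "\<exists>u v. u \<in> W \<and> u < B' \<and> v \<in> W \<and> v < M \<and> d u v \<noteq> 0"
    "\<And>z. z \<in> V \<Longrightarrow> (\<Sum>u | u \<in> W \<and> u < B'. \<Sum>v | v \<in> W \<and> v < M. d u v * mon u z ^ B * mon v z) = 0"
    using ex_auxiliary_relation[of B B' M "B * (B' - 1) + M"] assms(4) M B by (auto simp: B_def B'_def)
  let ?I = "{(u, v). u \<in> W \<and> u < B' \<and> v \<in> W \<and> v < M \<and> d u v \<noteq> 0}"
  let ?J = "(W_lt B') \<times> (W_lt M)"
  \<comment> \<open>\<open>d u v ^ B'\<close> is the B-th root of \<open>d u v\<close>, because
    \<open>B' * B = q^n\<close> and \<open>d u v\<close> lies in \<open>K\<close>.\<close>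
  let ?g = "\<lambda>(u, v) z. (d u v ^ B' * mon u z) * (e * mon v z) ^ B'"
  \<comment> \<open>As u stays below \<open>B'\<close>, the weight determines u and v by division
    with remainder.\<close>
  let ?\<omega> = "\<lambda>(u, v). u + B' * v"
  have IJ: "?I \<subseteq> ?J" by auto
  then have fin: "finite ?I" by (rule finite_subset) simp
  have inj: "inj_on ?\<omega> ?I"
  proof (rule inj_onI, clarsimp)
    fix u v u' v' assume "u < B'" "u' < B'" and eq: "u + B' * v = u' + B' * v'"
    have "u = (u + B' * v) mod B'" "v = (u + B' * v) div B'" using \<open>u < B'\<close> by auto
    moreover have "u' = (u' + B' * v') mod B'" "v' = (u' + B' * v') div B'" using \<open>u' < B'\<close> by auto
    ultimately show "u = u' \<and> v = v'" using eq by metis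
  qed
  have "lead (?g i) (?\<omega> i)" if iI: "i \<in> ?I" for i
  proof -
    obtain u v where i: "i = (u, v)" "u \<in> W" "v \<in> W" "d u v \<noteq> 0" using iI by auto
    have "d u v ^ B' \<in> K" using d(1) B(2) by (rule fld_power)
    moreover have "d u v ^ B' \<noteq> 0" using power_eq_0[of "d u v" B'] i(4) B(2) d(1) fld_subset by blast
    ultimately show ?thesis
      unfolding i(1) prod.case using i B(2) unit_neq_0 fld_unit
      by (intro lead_mult lead_power lead_mon) auto
  qed
  then have "\<exists>i\<in>?I. lead (\<lambda>z. \<Sum>i\<in>?I. ?g i z) (?\<omega> i)"
    using d(2) by (intro lead_sum fin inj) auto
  then obtain i where i: "i \<in> ?I" "lead (\<lambda>z. \<Sum>i\<in>?I. ?g i z) (?\<omega> i)" by blast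
  have "(\<Sum>i\<in>?I. ?g i z) = 0" if zP: "z \<in> points_K" for z
  proof -
    have z: "z \<in> V" "fst z \<in> K" "snd z \<in> K" using zP by (auto simp: points_K_def)
    have monQ: "mon w z ^ (q ^ n) = mon w z" for w
      using z(2,3) by (simp add: mon_def power_mult_distrib fld_def flip: power_mult)
        (simp add: mult.commute power_mult fld_def)
    have gU: "?g i z \<in> U" if "i \<in> ?I" for i
    proof -
      have "(\<lambda>z. ?g i z) \<in> Lt (Suc (?\<omega> i))" using \<open>\<And>i. i \<in> ?I \<Longrightarrow> lead (?g i) (?\<omega> i)\<close>[OF that] by (rule lead_Lt)
      then show ?thesis using z(1) by (rule Lt_mem)
    qed
    have "(\<Sum>i\<in>?I. ?g i z) ^ B = (\<Sum>i\<in>?I. ?g i z ^ B)"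
      unfolding B_def q_power by (rule frob_sum[OF gU])
    also have "\<dots> = (\<Sum>(u, v)\<in>?I. d u v * mon u z ^ B * mon v z)"
    proof (intro sum.cong refl)
      fix i assume "i \<in> ?I"
      obtain u v where i: "i = (u, v)" by (cases i)
      have duv: "d u v ^ (q ^ n) = d u v" "e * d u v = d u v"
        using d(1)[of u v] unit_mult by (auto simp: fld_def)
      have "?g i z ^ B = d u v ^ (B' * B) * mon u z ^ B * (e ^ (B' * B) * mon v z ^ (B' * B))"
        unfolding i prod.case by (simp add: power_mult_distrib power_mult)
      also have "e ^ (B' * B) = e" using B(1,2) by (intro unit_power) simp
      finally have "?g i z ^ B = d u v * mon u z ^ B * (e * mon v z)" unfolding B monQ duv .
      also have "\<dots> = (e * d u v) * mon u z ^ B * mon v z" by (simp only: ac_simps)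
      finally show "?g i z ^ B = (case i of (u, v) \<Rightarrow> d u v * mon u z ^ B * mon v z)"
        unfolding duv i prod.case .
    qed
    also have "\<dots> = (\<Sum>(u, v)\<in>?J. d u v * mon u z ^ B * mon v z)"
      by (rule sum.mono_neutral_left) auto
    also have "\<dots> = 0" using d(3)[OF z(1)] by (simp add: sum.cartesian_product)
    finally have "(\<Sum>i\<in>?I. ?g i z) ^ B = 0" .
    moreover have "(\<Sum>i\<in>?I. ?g i z) \<in> U" by (rule sum_mem) (rule gU)
    ultimately show ?thesis using power_eq_0[of "\<Sum>i\<in>?I. ?g i z" B] B(1) by simp
  qed
  then have "card points_K \<le> ?\<omega> i" by (intro card_zeros_le[OF i(2)]) auto
  also have "?\<omega> i \<le> (B' - 1) + B' * (M - 1)"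
  proof -
    obtain u v where uv: "i = (u, v)" "u < B'" "v < M" using i(1) by auto
    have "B' * v \<le> B' * (M - 1)" using uv by (intro mult_le_mono2) auto
    moreover have "u \<le> B' - 1" using uv by simp
    ultimately show ?thesis unfolding uv(1) prod.case by (rule add_le_mono[rotated])
  qed
  finally show ?thesis by (simp add: B'_def)
qed

text \<open>The exponents halve n as evenly as possible, so \<open>B \<le> q * B'\<close>. The
  counting condition compares \<open>B B' + g + g q + 1\<close> with
  \<open>(B' - g) (B + g q + 1)\<close>: the summand \<open>g q B'\<close> compensates the loss
  \<open>g B\<close>, and the surplus \<open>B'\<close> must beat the remaining constants, which is
  the assumption \<open>large\<close>.\<close>

lemma card_points_K_bound:
  assumes "\<beta> + \<beta>' = n" "\<beta>' > 0" "\<beta>' \<le> \<beta>" "\<beta> \<le> Suc \<beta>'"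
    and large: "q ^ \<beta>' > q * s * (q * s * q + 1) + q * s + q * s * q + 1"
  shows "card points_K \<le> q ^ n + q ^ \<beta>' * (q * s + q * s * q + 1)"
proof -
  define g where "g = q * s"
  define B B' where "B = q ^ \<beta>" and "B' = q ^ \<beta>'"
  \<comment> \<open>The summand \<open>g\<close> makes up for the gaps below M, and
    \<open>g * q\<close> for the loss caused by the gaps below \<open>B'\<close>.\<close>
  define M where "M = B + g + g * q + 1"
  have BB': "B \<le> q * B'" unfolding B_def B'_def
    using power_increasing[OF assms(4), of q] q_gt_1 by simp
  have lg: "B' > g * (g * q + 1) + g + g * q + 1" using large by (simp add: B'_def g_def)
  have 1: "B' - g \<le> card (W_lt B')" using card_W_ge[of B'] by (simp add: g_def)
  have 2: "B + g * q + 1 \<le> card (W_lt M)" using card_W_ge[of M] by (simp add: g_def M_def)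
  have gB': "g \<le> B'" using lg by simp
  have "B * (B' - 1) + M < (B' - g) * (B + g * q + 1)"
  proof -
    have B'1: "B' \<ge> 1" using lg by simp
    have "int (B * (B' - 1) + M) = int B * (int B' - 1) + int M" using B'1 by (simp add: of_nat_diff)
    also have "\<dots> = int B * int B' + int g + int g * int q + 1" by (simp add: M_def algebra_simps)
    also have "\<dots> < int B * int B' + int B' - int g * (int g * int q + 1)"
    proof -
      have "int B' > int (g * (g * q + 1) + g + g * q + 1)" using lg by (simp only: of_nat_less_iff)
      then show ?thesis by (simp add: algebra_simps)
    qed
    also have "\<dots> \<le> (int B' - int g) * (int B + int g * int q + 1)"
    proof -
      have "int g * int B \<le> int g * (int q * int B')"
        using BB' by (intro mult_left_mono) (simp_all flip: of_nat_mult)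
      then show ?thesis by (simp add: algebra_simps)
    qed
    also have "\<dots> = int ((B' - g) * (B + g * q + 1))"
      by (simp only: of_nat_mult of_nat_diff[OF gB'] of_nat_add of_nat_1)
    finally show ?thesis by (simp only: of_nat_less_iff)
  qed
  also have "\<dots> \<le> card (W_lt B') * card (W_lt M)" using 1 2 by (rule mult_le_mono)
  finally have "card (W_lt (B * (B' - 1) + M)) < card (W_lt B') * card (W_lt M)"
    using card_W_le[of "B * (B' - 1) + M"] by simp
  then have "card points_K \<le> (B' - 1) + B' * (M - 1)"
    unfolding B_def B'_def using assms by (intro card_points_K_le) (auto simp: M_def)
  also have "\<dots> \<le> B' + B' * (B + g + g * q)" by (simp add: M_def)
  also have "\<dots> = B' * B + B' * (g + g * q + 1)" by (simp add: algebra_simps)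
  also have "B' * B = q ^ n" using assms(1) by (simp add: B_def B'_def add.commute flip: power_add)
  finally show ?thesis by (simp add: B'_def g_def)
qed

text \<open>Additive Hilbert 90: \<open>y^(q^n) - y\<close> is the trace of
  \<open>y^q - y = f x - b\<close>. If that trace vanishes, a solution y lies in \<open>K\<close>,
  and its translates by the base field give q points over x.\<close>

lemma card_trace_fibre:
  "q * card {x \<in> K. tr n (f x) = tr n b} \<le> card points_K"
proof -
  let ?X = "{x \<in> K. tr n (f x) = tr n b}"
  have ex: "\<exists>y. (x, y) \<in> points_K" if x: "x \<in> ?X" for x
  proof -
    have xU: "x \<in> U" using x fld_subset by blast
    obtain y where y: "(x, y) \<in> V" using ex_fibre_point[OF xU] by blast
    have yU: "y \<in> U" using VD[OF y] by simp
    have tr_diff: "tr n (u - v) = tr n u - tr n v" if "u \<in> U" "v \<in> U" for u v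
      unfolding tr_def q_power using frob_diff[OF that] by (simp add: sum_subtractf)
    have "y ^ (q ^ n) - y = (\<Sum>i<n. y ^ (q ^ Suc i) - y ^ (q ^ i))"
      using sum_lessThan_telescope[of "\<lambda>i. y ^ (q ^ i)" n] by simp
    also have "\<dots> = (\<Sum>i<n. (y ^ q) ^ (q ^ i)) - (\<Sum>i<n. y ^ (q ^ i))"
      by (simp add: sum_subtractf power_mult)
    also have "\<dots> = tr n (y ^ q - y)"
      using tr_diff[of "y ^ q" y] yU q_gt_1 by (simp add: tr_def power_mem)
    also have "y ^ q - y = f x - b" using VD(3)[OF y] by simp
    also have "tr n (f x - b) = tr n (f x) - tr n b" by (rule tr_diff[OF fU[OF xU] bU])
    also have "\<dots> = 0" using x by simp
    finally have "y \<in> K" using yU by (simp add: fld_def)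
    then show ?thesis using y x by (auto simp: points_K_def)
  qed
  then have "\<exists>Y. \<forall>x\<in>?X. (x, Y x) \<in> points_K" by (intro bchoice) blast
  then obtain Y where Y: "\<And>x. x \<in> ?X \<Longrightarrow> (x, Y x) \<in> points_K" by blast
  have "card (?X \<times> fld 1) \<le> card points_K"
  proof (rule card_inj_on_le[OF _ _ finite_points_K])
    show "inj_on (\<lambda>(x, u). (x, Y x + u)) (?X \<times> fld 1)" by (auto simp: inj_on_def)
    show "(\<lambda>(x, u). (x, Y x + u)) ` (?X \<times> fld 1) \<subseteq> points_K"
    proof clarify
      fix x u assume x: "x \<in> K" "tr n (f x) = tr n b" and u: "u \<in> fld 1"
      then have "(x, Y x) \<in> points_K" using Y by simp
      then have V: "(x, Y x) \<in> V" "Y x \<in> K" by (auto simp: points_K_def)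
      have "u \<in> K" using u by (rule fld_base)
      then show "(x, Y x + u) \<in> points_K"
        using x fibre_translate[OF V(1) u] fld_add[OF V(2)] by (simp add: points_K_def)
    qed
  qed
  then show ?thesis by (simp add: card_cartesian_product card_fld_1[simplified] mult.commute)
qed

end

subsection \<open>Weil's bound\<close>

text \<open>Induction splitting off a zero z: the linear factor is normalised to
  \<open>1 - T / z\<close>, so the cofactor keeps constant term 1 and the linear coefficient changes
  by \<open>- 1 / z\<close>.\<close>

lemma norm_coeff_1_le:
  fixes P :: "complex poly"
  assumes "coeff P 0 = 1" "\<rho> > 0" "\<And>z. poly P z = 0 \<Longrightarrow> norm z \<ge> \<rho>"
  shows "norm (coeff P 1) \<le> real (degree P) / \<rho>"
  using assms(1,3)
proof (induction "degree P" arbitrary: P)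
  case 0
  then have "coeff P 1 = 0" by (intro coeff_eq_0) simp
  then show ?case using assms(2) by simp
next
  case (Suc d)
  have "\<not> constant (poly P)" using Suc.hyps(2) by (simp add: constant_degree)
  then obtain z where z: "poly P z = 0" using fundamental_theorem_of_algebra by blast
  then obtain R where R: "P = [:- z, 1:] * R" by (auto simp: poly_eq_0_iff_dvd)
  have z\<rho>: "norm z \<ge> \<rho>" using Suc.prems(2)[OF z] .
  then have z0: "z \<noteq> 0" using assms(2) by auto
  have "R \<noteq> 0" using R Suc.hyps(2) by auto
  then have "degree P = Suc (degree R)" unfolding R by (subst degree_mult_eq) auto
  then have deg: "d = degree (smult (- z) R)" using z0 Suc.hyps(2) by simp
  have c0: "coeff (smult (- z) R) 0 = 1" using Suc.prems(1) unfolding R by simp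
  have "norm (coeff (smult (- z) R) 1) \<le> real (degree (smult (- z) R)) / \<rho>"
  proof (rule Suc.hyps(1)[OF deg c0])
    fix w assume "poly (smult (- z) R) w = 0"
    then have "poly P w = 0" using z0 unfolding R by simp
    then show "norm w \<ge> \<rho>" by (rule Suc.prems(2))
  qed
  moreover have "coeff P 1 = coeff (smult (- z) R) 1 - 1 / z"
  proof -
    have "z * coeff R 0 = - 1" using arg_cong[OF c0, of uminus] by simp
    then have "coeff R 0 = - 1 / z" using z0 by (metis nonzero_mult_div_cancel_left)
    then show ?thesis unfolding R by simp
  qed
  moreover have "norm (1 / z) \<le> 1 / \<rho>" using z\<rho> assms(2) by (simp add: norm_divide frac_le)
  moreover have "norm (coeff (smult (- z) R) 1 - 1 / z) \<le> norm (coeff (smult (- z) R) 1) + norm (1 / z)"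
    by (rule norm_triangle_ineq4)
  ultimately have "norm (coeff P 1) \<le> real d / \<rho> + 1 / \<rho>" using deg by simp
  also have "\<dots> = real (degree P) / \<rho>" using Suc.hyps(2)[symmetric] by (simp add: add_divide_distrib)
  finally show ?case .
qed

lemma poly_sums: "(\<lambda>n. coeff p n * z ^ n) sums poly p z" for z :: complex
  unfolding poly_altdef by (rule sums_finite) (auto simp: coeff_eq_0)

text \<open>Whatever the sign, the absolute value of \<open>D i\<close> is at most
  \<open>2 E - D i\<close>, and the terms \<open>D i\<close> cancel in the sum.\<close>

lemma sum_abs_le_of_sum_zero:
  fixes D :: "'a \<Rightarrow> real"
  assumes "sum D I = 0" "\<And>i. i \<in> I \<Longrightarrow> D i \<le> E" "E \<ge> 0"
  shows "(\<Sum>i\<in>I. \<bar>D i\<bar>) \<le> 2 * real (card I) * E"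
proof -
  have "(\<Sum>i\<in>I. \<bar>D i\<bar>) \<le> (\<Sum>i\<in>I. 2 * E - D i)"
    using assms(2,3) by (intro sum_mono) (auto simp: abs_if dest!: assms(2))
  then show ?thesis using assms(1) by (simp add: sum_subtractf)
qed

section \<open>From point counts to the zeros of the L-function\<close>

context exp_sum
begin

lemma sum_psi: "(\<Sum>x\<in>fld 1. \<psi> x) = 0"
proof -
  obtain y where y: "y \<in> fld 1" "\<psi> y \<noteq> 1" using psi_nontrivial by blast
  have "(\<Sum>x\<in>fld 1. \<psi> x) = (\<Sum>x\<in>fld 1. \<psi> (y + x))"
    by (rule sum.reindex_bij_witness[of _ "\<lambda>x. y + x" "\<lambda>x. x - y"])
      (use y fld_add fld_diff in auto)
  also have "\<dots> = \<psi> y * (\<Sum>x\<in>fld 1. \<psi> x)" using y by (simp add: psi_add sum_distrib_left del: One_nat_def)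
  finally have "(1 - \<psi> y) * (\<Sum>x\<in>fld 1. \<psi> x) = 0" by (simp add: algebra_simps)
  then show ?thesis using y by simp
qed

definition point_error :: nat where "point_error = q * s + q * s * q + 1"

text \<open>The size demanded of \<open>q^(n div 2)\<close> in \<open>card_points_K_bound\<close>;
  it is reached as soon as \<open>n div 2\<close> exceeds this number.\<close>

definition threshold :: nat where "threshold = q * s * (q * s * q + 1) + q * s + q * s * q + 1"

text \<open>A nonempty fibre contains some x0, and \<open>f x0\<close> then supplies the constant b
  of the curve; for an empty fibre the bound is trivial.\<close>

lemma card_trace_fibre_le:
  assumes large: "n \<ge> 2 * threshold + 2"
  shows "q * card {x \<in> fld n. tr n (f x) = b0} \<le> q ^ n + q ^ (n div 2) * point_error"
proof (cases "{x \<in> fld n. tr n (f x) = b0} = {}")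
  case True
  then show ?thesis by (simp only: card.empty)
next
  case False
  then obtain x0 where x0: "x0 \<in> fld n" "tr n (f x0) = b0" by blast
  have n0: "n > 0" using large by simp
  interpret artin_schreier U e p \<kappa> q \<psi> s c m n "f x0"
    by unfold_locales (use n0 f_fld x0 in auto)
  have "n div 2 > threshold" using large by simp
  also have "n div 2 < q ^ (n div 2)" using q_gt_1 by (intro power_gt_expt) simp
  finally have "card points_K \<le> q ^ n + q ^ (n div 2) * (q * s + q * s * q + 1)"
    using large by (intro card_points_K_bound[of "n - n div 2" "n div 2"]) (auto simp: threshold_def)
  then show ?thesis using card_trace_fibre x0 by (simp add: point_error_def)
qed

text \<open>As \<psi> sums to zero over the base field, q times a fibre size may be replaced by its
  deviation \<open>D\<close> from \<open>q^n\<close>, and \<open>sum_abs_le_of_sum_zero\<close>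
  applies.\<close>

lemma norm_S_le:
  assumes n: "n \<ge> 2 * threshold + 2"
  shows "norm (S n) \<le> 2 * real point_error * sqrt (real q) ^ n"
proof -
  have n0: "n > 0" using n by simp
  let ?N = "\<lambda>b. card {x \<in> fld n. tr n (f x) = b}"
  define D where "D b = real (q * ?N b) - real (q ^ n)" for b
  define E where "E = real (q ^ (n div 2) * point_error)"
  have q0: "real q > 0" using q_gt_1 by simp
  have fin: "finite (fld 1)" "finite (fld n)" using finite_fld n0 by auto
  have im: "(\<lambda>x. tr n (f x)) ` fld n \<subseteq> fld 1" using tr_fld f_fld by blast
  have "(\<Sum>b\<in>fld 1. ?N b) = (\<Sum>b\<in>fld 1. \<Sum>x | x \<in> fld n \<and> tr n (f x) = b. 1)" by simp
  also have "\<dots> = (\<Sum>x\<in>fld n. 1)" by (rule sum.group[OF fin(2,1) im])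
  finally have sumN: "(\<Sum>b\<in>fld 1. ?N b) = q ^ n" using card_fld[OF n0] by simp
  have "(\<Sum>b\<in>fld 1. D b) = real q * real (\<Sum>b\<in>fld 1. ?N b) - real (card (fld 1)) * real (q ^ n)"
    unfolding D_def sum_subtractf by (simp add: sum_distrib_left)
  then have "sum D (fld 1) = 0" unfolding sumN card_fld_1 by simp
  moreover have "D b \<le> E" for b
    using card_trace_fibre_le[OF n, of b] unfolding D_def E_def
    by (simp only: diff_le_eq of_nat_add[symmetric] of_nat_le_iff add.commute)
  moreover have "E \<ge> 0" by (simp add: E_def)
  ultimately have sumD: "(\<Sum>b\<in>fld 1. \<bar>D b\<bar>) \<le> 2 * real q * E"
    using sum_abs_le_of_sum_zero[of D "fld 1" E] unfolding card_fld_1 by blast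
  have "S n = (\<Sum>b\<in>fld 1. \<Sum>x | x \<in> fld n \<and> tr n (f x) = b. \<psi> (tr n (f x)))"
    unfolding S_def by (rule sum.group[OF fin(2,1) im, symmetric])
  also have "\<dots> = (\<Sum>b\<in>fld 1. of_nat (?N b) * \<psi> b)" by (intro sum.cong refl) simp
  finally have "of_nat q * S n = (\<Sum>b\<in>fld 1. of_real (real (q * ?N b)) * \<psi> b)"
    by (simp add: sum_distrib_left mult.assoc)
  also have "\<dots> = (\<Sum>b\<in>fld 1. of_real (D b) * \<psi> b + of_nat (q ^ n) * \<psi> b)"
    by (intro sum.cong refl) (simp add: D_def left_diff_distrib)
  also have "\<dots> = (\<Sum>b\<in>fld 1. of_real (D b) * \<psi> b)"
    unfolding sum.distrib sum_distrib_left[symmetric] sum_psi by simp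
  finally have "real q * norm (S n) = norm (\<Sum>b\<in>fld 1. of_real (D b) * \<psi> b)"
    by (metis norm_mult norm_of_nat)
  also have "\<dots> \<le> (\<Sum>b\<in>fld 1. norm (of_real (D b) * \<psi> b))" by (rule norm_sum)
  also have "\<dots> = (\<Sum>b\<in>fld 1. \<bar>D b\<bar>)" by (intro sum.cong refl) (simp only: norm_mult norm_psi norm_of_real mult_1_right)
  finally have "real q * norm (S n) \<le> real q * (2 * E)" using sumD by simp
  then have "norm (S n) \<le> 2 * E" using q0 by simp
  also have "E \<le> real point_error * sqrt (real q) ^ n"
  proof -
    have "real (q ^ (n div 2)) = sqrt (real q) ^ (2 * (n div 2))" using q0 by (simp add: power_mult)
    also have "\<dots> \<le> sqrt (real q) ^ n" using q_gt_1 by (intro power_increasing) auto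
    finally show ?thesis unfolding E_def of_nat_mult by (metis mult.commute mult_left_mono of_nat_0_le_iff)
  qed
  finally show ?thesis by simp
qed

definition L :: "complex poly" where "L = (\<Sum>r<s. monom (A r) r)"

lemma coeff_L: "coeff L r = A r"
  using A_beyond[of r] by (auto simp: L_def coeff_sum)

text \<open>The logarithmic derivative starts at index 1; \<open>S 0\<close> would refer to
  \<open>fld 0\<close>, which is all of \<open>U\<close>.\<close>

definition S' :: "nat \<Rightarrow> complex" where "S' n = (if n = 0 then 0 else S n)"

lemma summable_S':
  assumes "norm z < 1 / sqrt (real q)"
  shows "summable (\<lambda>n. norm (S' n * z ^ n))"
proof (rule summable_comparison_test_ev)
  have q0: "sqrt (real q) > 0" using q_gt_1 by simp
  show "summable (\<lambda>n. 2 * real point_error * (sqrt (real q) * norm z) ^ n)"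
    using assms q0 by (intro summable_mult summable_geometric) (simp add: abs_mult field_simps)
  show "\<forall>\<^sub>F n in sequentially. norm (norm (S' n * z ^ n)) \<le> 2 * real point_error * (sqrt (real q) * norm z) ^ n"
  proof (rule eventually_sequentiallyI[of "2 * threshold + 2"])
    fix n assume n: "n \<ge> 2 * threshold + 2"
    have "norm (S' n) \<le> 2 * real point_error * sqrt (real q) ^ n" using norm_S_le[OF n] n by (simp add: S'_def)
    then have "norm (S' n) * norm z ^ n \<le> 2 * real point_error * sqrt (real q) ^ n * norm z ^ n"
      by (rule mult_right_mono) simp
    then show "norm (norm (S' n * z ^ n)) \<le> 2 * real point_error * (sqrt (real q) * norm z) ^ n"
      by (simp add: norm_mult norm_power power_mult_distrib mult.assoc)
  qed
qed

text \<open>\<open>A_recurrence\<close> is the equality of coefficients; absolute convergence inside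
  the disc justifies the Cauchy product.\<close>

lemma L_log_deriv:
  assumes z: "norm z < 1 / sqrt (real q)"
  shows "z * poly (pderiv L) z = poly L z * (\<Sum>n. S' n * z ^ n)"
proof -
  have sumL: "summable (\<lambda>n. norm (coeff L n * z ^ n))"
    by (rule summable_finite[of "{..<s}"]) (use A_beyond coeff_L in auto)
  have "(\<lambda>k. \<Sum>i\<le>k. (S' i * z ^ i) * (coeff L (k - i) * z ^ (k - i))) sums
     ((\<Sum>n. S' n * z ^ n) * (\<Sum>n. coeff L n * z ^ n))"
    by (rule Cauchy_product_sums[OF summable_S'[OF z] sumL])
  moreover have "(\<Sum>i\<le>k. (S' i * z ^ i) * (coeff L (k - i) * z ^ (k - i))) = coeff (pCons 0 (pderiv L)) k * z ^ k" for k
  proof -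
    have "(\<Sum>i\<le>k. (S' i * z ^ i) * (coeff L (k - i) * z ^ (k - i))) = (\<Sum>i\<le>k. S' i * A (k - i)) * z ^ k"
      unfolding sum_distrib_right by (intro sum.cong refl) (simp add: coeff_L flip: power_add)
    also have "(\<Sum>i\<le>k. S' i * A (k - i)) = (\<Sum>i=1..k. S i * A (k - i))"
      by (rule sum.mono_neutral_cong_right) (auto simp: S'_def)
    also have "\<dots> = of_nat k * A k" by (rule A_recurrence[symmetric])
    also have "\<dots> = coeff (pCons 0 (pderiv L)) k" by (cases k) (simp_all add: coeff_pderiv coeff_L)
    finally show ?thesis .
  qed
  ultimately have "(\<lambda>k. coeff (pCons 0 (pderiv L)) k * z ^ k) sums ((\<Sum>n. S' n * z ^ n) * poly L z)"
    using sums_unique[OF poly_sums[of L z]] by simp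
  then have "(\<Sum>n. S' n * z ^ n) * poly L z = poly (pCons 0 (pderiv L)) z"
    using poly_sums[of "pCons 0 (pderiv L)" z] by (rule sums_unique2)
  then show ?thesis by (simp add: mult.commute)
qed

text \<open>A zero of \<open>L\<close> in the disc of convergence would be a pole of \<open>L'/L\<close>.\<close>

lemma L_nonzero:
  assumes z: "norm z < 1 / sqrt (real q)"
  shows "poly L z \<noteq> 0"
proof
  assume L0: "poly L z = 0"
  have "poly L 0 = 1" by (simp add: poly_0_coeff_0 coeff_L A_0)
  then have z0: "z \<noteq> 0" and Ln: "L \<noteq> 0" using L0 by auto
  obtain M where M: "L = [:- z, 1:] ^ Polynomial.order z L * M" "\<not> [:- z, 1:] dvd M"
    using order_decomp[OF Ln] by blast
  obtain k where k: "Polynomial.order z L = Suc k"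
    using L0 Ln by (metis order_root not0_implies_Suc)
  have Mz: "poly M z \<noteq> 0" using M(2) by (simp add: poly_eq_0_iff_dvd)
  define H where "H w = (\<Sum>n. S' n * w ^ n)" for w
  obtain r where r: "norm z < r" "r < 1 / sqrt (real q)" using dense[OF z] by blast
  then have r0: "r > 0" using norm_ge_zero[of z] by linarith
  have nr: "norm (of_real r :: complex) = r" using r0 by simp
  have "summable (\<lambda>n. S' n * (of_real r) ^ n)"
    by (rule summable_norm_cancel, rule summable_S') (use r nr in simp)
  then have "isCont H z" unfolding H_def by (rule isCont_powser) (use r nr in simp)
  then have H: "(H \<longlongrightarrow> H z) (at z)" by (simp add: isCont_def)
  \<comment> \<open>The two sides after cancelling \<open>(w - z)^k\<close>, where
    \<open>k + 1\<close> is the order of the zero. At z the left side tends to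
    \<open>z (k + 1) M(z)\<close>, which is nonzero, the right side to 0.\<close>
  let ?l = "\<lambda>w. w * ((w - z) * poly (pderiv M) w + of_nat (Suc k) * poly M w)"
  let ?r = "\<lambda>w. (w - z) * (poly M w * H w)"
  have "\<forall>\<^sub>F w in at z. ?l w = ?r w"
  proof -
    have "\<forall>\<^sub>F w in at z. norm w < r"
      using r(1) by (intro order_tendstoD(2)[OF tendsto_norm[OF tendsto_ident_at]])
    moreover have "\<forall>\<^sub>F w in at z. w \<noteq> z" by (simp add: eventually_at_filter)
    ultimately show ?thesis
    proof eventually_elim
      case (elim w)
      let ?u = "[:- z, 1:]"
      have L: "L = ?u * (?u ^ k * M)" using M(1) unfolding k by (simp only: power_Suc mult.assoc)
      have "pderiv L = ?u ^ Suc k * pderiv M + smult (of_nat (Suc k)) (?u ^ k) * M"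
        by (subst M(1)) (simp add: k pderiv_mult pderiv_power_Suc pderiv_pCons mult.commute del: power_Suc)
      then have "poly (pderiv L) w = (w - z) ^ k * ((w - z) * poly (pderiv M) w + of_nat (Suc k) * poly M w)"
        by (simp only: poly_add poly_mult poly_power poly_smult) (simp add: algebra_simps)
      moreover have "poly L w = (w - z) ^ k * ((w - z) * poly M w)"
        unfolding L by (simp add: algebra_simps)
      moreover have "w * poly (pderiv L) w = poly L w * H w"
        unfolding H_def using elim r by (intro L_log_deriv) simp
      ultimately have "(w - z) ^ k * ?l w = (w - z) ^ k * ?r w" by (simp add: ac_simps)
      then show ?case using elim(2) by simp
    qed
  qed
  moreover have "(?l \<longlongrightarrow> z * ((z - z) * poly (pderiv M) z + of_nat (Suc k) * poly M z)) (at z)"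
    by (intro tendsto_intros)
  ultimately have "(?r \<longlongrightarrow> z * ((z - z) * poly (pderiv M) z + of_nat (Suc k) * poly M z)) (at z)"
    by (simp add: filterlim_cong)
  moreover have "(?r \<longlongrightarrow> (z - z) * (poly M z * H z)) (at z)"
    by (intro tendsto_intros H)
  ultimately have "z * ((z - z) * poly (pderiv M) z + of_nat (Suc k) * poly M z) = (z - z) * (poly M z * H z)"
    by (rule LIM_unique)
  then show False using z0 Mz by (simp add: of_nat_Suc[symmetric] del: of_nat_Suc)
qed

theorem weil_bound: "norm (\<Sum>x\<in>fld 1. \<psi> (c * x ^ s + m * x)) \<le> real s * sqrt (real q)"
proof -
  have "A 1 = S 1" using A_recurrence[of 1] by (simp add: A_0)
  moreover have "S 1 = (\<Sum>x\<in>fld 1. \<psi> (c * x ^ s + m * x))"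
    by (simp add: S_def tr_def f_def)
  moreover have "norm (coeff L 1) \<le> real (degree L) / (1 / sqrt (real q))"
    using q_gt_1 L_nonzero by (intro norm_coeff_1_le) (auto simp: coeff_L A_0 not_less[symmetric])
  moreover have "degree L \<le> s" using coeff_L A_beyond by (intro degree_le) auto
  ultimately have "norm (\<Sum>x\<in>fld 1. \<psi> (c * x ^ s + m * x)) \<le> real (degree L) * sqrt (real q)"
    by (simp add: coeff_L)
  also have "\<dots> \<le> real s * sqrt (real q)" using \<open>degree L \<le> s\<close> by (intro mult_right_mono) auto
  finally show ?thesis .
qed

end

subsection \<open>Character sums over sets of points\<close>

text \<open>Cauchy-Schwarz for the fibre sizes of N: they add up to the cardinality of Z, and their
  squares to the number of collisions.\<close>

lemma card_square_le_collisions: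
  assumes "finite Z"
  shows "(real (card Z))\<^sup>2 \<le> real (card (N ` Z)) * real (card {(z, z') \<in> Z \<times> Z. N z = N z'})"
proof -
  let ?F = "\<lambda>t. {z \<in> Z. N z = t}"
  have fin: "finite (N ` Z)" using assms by simp
  have "(\<Sum>t\<in>N ` Z. \<Sum>z\<in>?F t. 1 :: nat) = (\<Sum>z\<in>Z. 1)"
    by (rule sum.group[OF assms fin subset_refl])
  then have Z: "card Z = (\<Sum>t\<in>N ` Z. card (?F t))" by simp
  have "{(z, z') \<in> Z \<times> Z. N z = N z'} = (\<Union>t\<in>N ` Z. ?F t \<times> ?F t)" by auto
  also have "card \<dots> = (\<Sum>t\<in>N ` Z. card (?F t \<times> ?F t))"
    using assms by (intro card_UN_disjoint) auto
  finally have P: "card {(z, z') \<in> Z \<times> Z. N z = N z'} = (\<Sum>t\<in>N ` Z. (card (?F t))\<^sup>2)"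
    by (simp add: card_cartesian_product power2_eq_square)
  let ?x = "\<lambda>t. real (card (?F t))" and ?n = "real (card (N ` Z))"
  have "0 \<le> (\<Sum>t\<in>N ` Z. (?n * ?x t - sum ?x (N ` Z))\<^sup>2)" by (intro sum_nonneg) simp
  also have "\<dots> = (\<Sum>t\<in>N ` Z. ?n\<^sup>2 * (?x t)\<^sup>2 - 2 * ?n * sum ?x (N ` Z) * ?x t + (sum ?x (N ` Z))\<^sup>2)"
    by (simp add: power2_diff power_mult_distrib algebra_simps)
  also have "\<dots> = ?n\<^sup>2 * (\<Sum>t\<in>N ` Z. (?x t)\<^sup>2) - 2 * ?n * sum ?x (N ` Z) * sum ?x (N ` Z) + ?n * (sum ?x (N ` Z))\<^sup>2"
    by (simp add: sum.distrib sum_subtractf sum_distrib_left)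
  also have "\<dots> = ?n * (?n * (\<Sum>t\<in>N ` Z. (?x t)\<^sup>2) - (sum ?x (N ` Z))\<^sup>2)"
    by (simp add: power2_eq_square algebra_simps)
  finally have "0 \<le> ?n * (?n * (\<Sum>t\<in>N ` Z. (?x t)\<^sup>2) - (sum ?x (N ` Z))\<^sup>2)" .
  then have "(sum ?x (N ` Z))\<^sup>2 \<le> ?n * (\<Sum>t\<in>N ` Z. (?x t)\<^sup>2)"
  proof (cases "Z = {}")
    case False
    then have "?n > 0" using fin by (simp add: card_gt_0_iff)
    then show ?thesis
      using \<open>0 \<le> ?n * (?n * (\<Sum>t\<in>N ` Z. (?x t)\<^sup>2) - (sum ?x (N ` Z))\<^sup>2)\<close> by (simp add: zero_le_mult_iff)
  qed simp
  then show ?thesis unfolding P Z by simp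
qed

section \<open>Fourier analysis on the base field\<close>

context char_field
begin

abbreviation k :: "'t set" where "k \<equiv> fld 1"

lemma finite_k: "finite k" by (rule finite_fld) simp

lemma psi_uminus: "x \<in> k \<Longrightarrow> \<psi> (- x) = cnj (\<psi> x)"
proof -
  assume x: "x \<in> k"
  have "\<psi> x * \<psi> (- x) = 1" using psi_add[OF x fld_uminus[OF x]] psi_0 by simp
  moreover have "\<psi> x * cnj (\<psi> x) = 1" using complex_norm_square[of "\<psi> x"] norm_psi[OF x] by simp
  moreover have "\<psi> x \<noteq> 0" using norm_psi[OF x] by auto
  ultimately show ?thesis by (metis mult_left_cancel)
qed

lemma psi_sum: "(\<And>i. i \<in> I \<Longrightarrow> g i \<in> k) \<Longrightarrow> \<psi> (\<Sum>i\<in>I. g i) = (\<Prod>i\<in>I. \<psi> (g i))"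
proof (induction I rule: infinite_finite_induct)
  case (insert i I)
  then show ?case using psi_add[of "g i" "sum g I"] by (simp add: fld_sum)
qed (simp_all add: psi_0)

lemma psi_orthogonal:
  assumes x: "x \<in> k"
  shows "(\<Sum>m\<in>k. \<psi> (m * x)) = (if x = 0 then of_nat q else 0)"
proof (cases "x = 0")
  case True
  then show ?thesis by (simp add: psi_0 card_fld_1[simplified])
next
  case False
  obtain z where z: "z \<in> k" "x * z = e" using fld_inverse[OF x False] by blast
  obtain y where y: "y \<in> k" "\<psi> y \<noteq> 1" using psi_nontrivial by blast
  have yU: "y \<in> U" using y fld_subset by blast
  have zy: "z * y \<in> k" using z y by (intro fld_mult)
  have "z * y * x = y" using unit_mult[OF yU] z(2) by (metis mult.assoc mult.commute)
  then have eq: "\<psi> ((z * y + m) * x) = \<psi> y * \<psi> (m * x)" if "m \<in> k" for m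
    using psi_add[OF y(1) fld_mult[OF that x]] by (simp add: distrib_right)
  have "(\<Sum>m\<in>k. \<psi> (m * x)) = (\<Sum>m\<in>k. \<psi> ((z * y + m) * x))"
    by (rule sum.reindex_bij_witness[of _ "\<lambda>m. z * y + m" "\<lambda>m. m - z * y"])
      (use zy fld_add fld_diff in auto)
  also have "\<dots> = \<psi> y * (\<Sum>m\<in>k. \<psi> (m * x))" unfolding sum_distrib_left by (intro sum.cong refl eq)
  finally have "(1 - \<psi> y) * (\<Sum>m\<in>k. \<psi> (m * x)) = 0" by (simp add: algebra_simps)
  then show ?thesis using y False by simp
qed

definition csum :: "'t \<Rightarrow> 't \<Rightarrow> complex" where
  "csum c m = (\<Sum>x\<in>k. \<psi> (c * x ^ s + m * x))"

text \<open>For \<open>c = 0\<close> there is no cancellation at \<open>m = 0\<close>, which leaves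
  the trivial bound q.\<close>

definition csum_bound :: "'t \<Rightarrow> real" where
  "csum_bound c = (if c = 0 then real q else real s * sqrt (real q))"

lemma arg_mem: "c \<in> k \<Longrightarrow> m \<in> k \<Longrightarrow> x \<in> k \<Longrightarrow> c * x ^ s \<in> k" "c \<in> k \<Longrightarrow> x \<in> k \<Longrightarrow> c * x \<in> k"
  using s by (auto intro!: fld_mult fld_power)

lemma norm_csum_le:
  assumes "c \<in> k" "m \<in> k"
  shows "norm (csum c m) \<le> csum_bound c"
proof (cases "c = 0")
  case True
  have "norm (csum c m) \<le> (\<Sum>x\<in>k. norm (\<psi> (c * x ^ s + m * x)))" unfolding csum_def by (rule norm_sum)
  also have "\<dots> = (\<Sum>x\<in>k. 1)"
    using assms arg_mem by (intro sum.cong refl norm_psi fld_add) auto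
  finally show ?thesis using True by (simp add: csum_bound_def card_fld_1[simplified])
next
  case False
  interpret weil: exp_sum U e p \<kappa> q \<psi> s c m
    by unfold_locales (use assms False psi_add norm_psi psi_nontrivial s in auto)
  show ?thesis using weil.weil_bound False by (simp add: csum_def csum_bound_def)
qed

text \<open>Fourier inversion for \<open>z \<mapsto> \<psi> (c z^s)\<close>: summing over m first,
  orthogonality picks out the term \<open>x = z\<close>.\<close>

lemma csum_inversion:
  assumes c: "c \<in> k" and z: "z \<in> k"
  shows "of_nat q * \<psi> (c * z ^ s) = (\<Sum>m\<in>k. csum c m * \<psi> (- (m * z)))"
proof -
  have "(\<Sum>m\<in>k. csum c m * \<psi> (- (m * z))) = (\<Sum>m\<in>k. \<Sum>x\<in>k. \<psi> (c * x ^ s) * \<psi> (m * (x - z)))"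
    unfolding csum_def sum_distrib_right
  proof (intro sum.cong refl)
    fix m x assume mx: "m \<in> k" "x \<in> k"
    have mem: "c * x ^ s \<in> k" "m * x \<in> k" "- (m * z) \<in> k"
      using arg_mem c z mx by (auto intro: fld_uminus)
    have "\<psi> (c * x ^ s + m * x) * \<psi> (- (m * z)) = \<psi> (c * x ^ s) * (\<psi> (m * x) * \<psi> (- (m * z)))"
      using psi_add[OF mem(1,2)] by simp
    also have "\<psi> (m * x) * \<psi> (- (m * z)) = \<psi> (m * (x - z))"
      using psi_add[OF mem(2,3)] by (simp add: right_diff_distrib)
    finally show "\<psi> (c * x ^ s + m * x) * \<psi> (- (m * z)) = \<psi> (c * x ^ s) * \<psi> (m * (x - z))" .
  qed
  also have "\<dots> = (\<Sum>x\<in>k. \<psi> (c * x ^ s) * (\<Sum>m\<in>k. \<psi> (m * (x - z))))"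
    unfolding sum_distrib_left by (rule sum.swap)
  also have "\<dots> = (\<Sum>x\<in>k. \<psi> (c * x ^ s) * (if x = z then of_nat q else 0))"
    using z by (intro sum.cong refl arg_cong2[of _ _ _ _ "(*)"]) (simp add: psi_orthogonal fld_diff del: One_nat_def)
  also have "\<dots> = of_nat q * \<psi> (c * z ^ s)" using z finite_k by (simp add: mult.commute if_distrib cong: if_cong)
  finally show ?thesis by simp
qed

text \<open>The points of \<open>E\<close> enter only through their coordinates \<open>\<xi> x i\<close>, \<open>i \<in> I\<close>, which separate them.\<close>

lemma bilinear_bound:
  fixes \<xi> :: "'b \<Rightarrow> 'i \<Rightarrow> 't"
  assumes I: "finite I" and E: "finite E" and \<xi>: "\<And>x i. x \<in> E \<Longrightarrow> i \<in> I \<Longrightarrow> \<xi> x i \<in> k"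
    and sep: "\<And>x y. x \<in> E \<Longrightarrow> y \<in> E \<Longrightarrow> (\<And>i. i \<in> I \<Longrightarrow> \<xi> x i = \<xi> y i) \<Longrightarrow> x = y"
    and c: "\<And>i. i \<in> I \<Longrightarrow> c i \<in> k"
  shows "norm (\<Sum>x\<in>E. \<Sum>y\<in>E. \<psi> (\<Sum>i\<in>I. c i * (\<xi> x i - \<xi> y i) ^ s)) \<le> real (card E) * (\<Prod>i\<in>I. csum_bound (c i))"
proof -
  let ?G = "I \<rightarrow>\<^sub>E k"
  define \<chi> where "\<chi> g x = (\<Prod>i\<in>I. \<psi> (- (g i * \<xi> x i)))" for g x
  define T where "T g = (\<Sum>x\<in>E. \<chi> g x)" for g
  let ?Q = "of_nat q ^ card I :: complex"
  have chi2: "(\<Prod>i\<in>I. \<psi> (- (g i * (\<xi> x i - \<xi> y i)))) = \<chi> g x * cnj (\<chi> g y)"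
    if "g \<in> ?G" "x \<in> E" "y \<in> E" for g x y
  proof -
    have "\<psi> (- (g i * (\<xi> x i - \<xi> y i))) = \<psi> (- (g i * \<xi> x i)) * cnj (\<psi> (- (g i * \<xi> y i)))" if i: "i \<in> I" for i
    proof -
      have mem: "g i * \<xi> x i \<in> k" "g i * \<xi> y i \<in> k"
        using \<open>g \<in> ?G\<close> \<open>x \<in> E\<close> \<open>y \<in> E\<close> i \<xi> by (auto intro!: fld_mult)
      have "- (g i * (\<xi> x i - \<xi> y i)) = - (g i * \<xi> x i) + g i * \<xi> y i" by (simp add: algebra_simps)
      then show ?thesis using psi_add[OF fld_uminus[OF mem(1)] mem(2)] by (simp add: psi_uminus[OF mem(2)])
    qed
    then show ?thesis unfolding \<chi>_def by (simp add: prod.distrib)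
  qed
  \<comment> \<open>The kernel becomes a superposition of rank-one kernels, with coefficients that
    factor over the coordinates and obey \<open>csum_bound\<close> uniformly in g.\<close>
  have ker: "?Q * \<psi> (\<Sum>i\<in>I. c i * (\<xi> x i - \<xi> y i) ^ s) =
      (\<Sum>g\<in>?G. (\<Prod>i\<in>I. csum (c i) (g i)) * (\<chi> g x * cnj (\<chi> g y)))" if xy: "x \<in> E" "y \<in> E" for x y
  proof -
    have z: "\<xi> x i - \<xi> y i \<in> k" if "i \<in> I" for i using \<xi> xy that by (intro fld_diff)
    have "?Q * \<psi> (\<Sum>i\<in>I. c i * (\<xi> x i - \<xi> y i) ^ s) = (\<Prod>i\<in>I. of_nat q * \<psi> (c i * (\<xi> x i - \<xi> y i) ^ s))"
      using z c s by (subst psi_sum) (auto simp: prod.distrib intro!: fld_mult fld_power)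
    also have "\<dots> = (\<Prod>i\<in>I. \<Sum>m\<in>k. csum (c i) m * \<psi> (- (m * (\<xi> x i - \<xi> y i))))"
      by (intro prod.cong refl csum_inversion c z)
    also have "\<dots> = (\<Sum>g\<in>?G. \<Prod>i\<in>I. csum (c i) (g i) * \<psi> (- (g i * (\<xi> x i - \<xi> y i))))"
      using I finite_k by (intro prod_sum_PiE) auto
    also have "\<dots> = (\<Sum>g\<in>?G. (\<Prod>i\<in>I. csum (c i) (g i)) * (\<chi> g x * cnj (\<chi> g y)))"
      using chi2 xy by (intro sum.cong refl) (simp add: prod.distrib)
    finally show ?thesis .
  qed
  have TT: "(\<Sum>x\<in>E. \<Sum>y\<in>E. \<chi> g x * cnj (\<chi> g y)) = of_real ((norm (T g))\<^sup>2)" for g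
    unfolding complex_norm_square T_def cnj_sum sum_product ..
  \<comment> \<open>Only the diagonal survives: distinct points of \<open>E\<close> differ in some
    coordinate, and the factor belonging to it vanishes.\<close>
  have plancherel: "(\<Sum>g\<in>?G. of_real ((norm (T g))\<^sup>2)) = ?Q * of_nat (card E)"
  proof -
    have "(\<Sum>g\<in>?G. of_real ((norm (T g))\<^sup>2)) = (\<Sum>x\<in>E. \<Sum>y\<in>E. \<Sum>g\<in>?G. \<chi> g x * cnj (\<chi> g y))"
      unfolding TT[symmetric] by (subst sum.swap, intro sum.cong refl, rule sum.swap)
    also have "\<dots> = (\<Sum>x\<in>E. \<Sum>y\<in>E. if x = y then ?Q else 0)"
    proof (intro sum.cong refl)
      fix x y assume xy: "x \<in> E" "y \<in> E"
      have z: "\<xi> y i - \<xi> x i \<in> k" if "i \<in> I" for i using \<xi> xy that by (intro fld_diff)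
      have "(\<Sum>g\<in>?G. \<chi> g x * cnj (\<chi> g y)) = (\<Sum>g\<in>?G. \<Prod>i\<in>I. \<psi> (g i * (\<xi> y i - \<xi> x i)))"
        using chi2[OF _ xy] by (intro sum.cong refl) (simp add: algebra_simps)
      also have "\<dots> = (\<Prod>i\<in>I. \<Sum>m\<in>k. \<psi> (m * (\<xi> y i - \<xi> x i)))"
        using I finite_k by (intro prod_sum_PiE[symmetric]) auto
      also have "\<dots> = (\<Prod>i\<in>I. if \<xi> y i = \<xi> x i then of_nat q else 0)"
        using z by (intro prod.cong refl) (simp add: psi_orthogonal del: One_nat_def)
      also have "\<dots> = (if x = y then ?Q else 0)"
      proof (cases "x = y")
        case False
        then obtain i where "i \<in> I" "\<xi> y i \<noteq> \<xi> x i" using sep[OF xy] by metis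
        then show ?thesis using False I by (simp add: prod_zero_iff) (auto intro!: bexI[of _ i])
      qed simp
      finally show "(\<Sum>g\<in>?G. \<chi> g x * cnj (\<chi> g y)) = (if x = y then ?Q else 0)" .
    qed
    also have "\<dots> = ?Q * of_nat (card E)" using E by simp
    finally show ?thesis .
  qed
  have "?Q * (\<Sum>x\<in>E. \<Sum>y\<in>E. \<psi> (\<Sum>i\<in>I. c i * (\<xi> x i - \<xi> y i) ^ s)) =
     (\<Sum>x\<in>E. \<Sum>y\<in>E. \<Sum>g\<in>?G. (\<Prod>i\<in>I. csum (c i) (g i)) * (\<chi> g x * cnj (\<chi> g y)))"
    unfolding sum_distrib_left by (intro sum.cong refl) (simp add: ker)
  also have "\<dots> = (\<Sum>g\<in>?G. \<Sum>x\<in>E. \<Sum>y\<in>E. (\<Prod>i\<in>I. csum (c i) (g i)) * (\<chi> g x * cnj (\<chi> g y)))"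
    by (subst (2) sum.swap, intro sum.cong refl, rule sum.swap)
  also have "\<dots> = (\<Sum>g\<in>?G. (\<Prod>i\<in>I. csum (c i) (g i)) * of_real ((norm (T g))\<^sup>2))"
    unfolding TT[symmetric] by (simp only: sum_distrib_left)
  finally have main: "?Q * (\<Sum>x\<in>E. \<Sum>y\<in>E. \<psi> (\<Sum>i\<in>I. c i * (\<xi> x i - \<xi> y i) ^ s)) =
     (\<Sum>g\<in>?G. (\<Prod>i\<in>I. csum (c i) (g i)) * of_real ((norm (T g))\<^sup>2))" .
  let ?B = "\<Prod>i\<in>I. csum_bound (c i)"
  have "real q ^ card I * norm (\<Sum>x\<in>E. \<Sum>y\<in>E. \<psi> (\<Sum>i\<in>I. c i * (\<xi> x i - \<xi> y i) ^ s)) =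
     norm (\<Sum>g\<in>?G. (\<Prod>i\<in>I. csum (c i) (g i)) * of_real ((norm (T g))\<^sup>2))"
    unfolding main[symmetric] by (simp add: norm_mult norm_power)
  also have "\<dots> \<le> (\<Sum>g\<in>?G. ?B * (norm (T g))\<^sup>2)"
  proof (rule sum_norm_le)
    fix g assume g: "g \<in> ?G"
    have "norm (\<Prod>i\<in>I. csum (c i) (g i)) \<le> ?B"
      unfolding prod_norm[symmetric] using g c by (intro prod_mono) (auto intro!: norm_csum_le)
    then show "norm ((\<Prod>i\<in>I. csum (c i) (g i)) * of_real ((norm (T g))\<^sup>2)) \<le> ?B * (norm (T g))\<^sup>2"
      unfolding norm_mult norm_of_real by (simp add: mult_right_mono)
  qed
  also have "\<dots> = ?B * (real q ^ card I * real (card E))"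
  proof -
    have "complex_of_real (\<Sum>g\<in>?G. (norm (T g))\<^sup>2) = complex_of_real (real q ^ card I * real (card E))"
      unfolding of_real_sum plancherel by simp
    then show ?thesis unfolding sum_distrib_left[symmetric] of_real_eq_iff by simp
  qed
  finally have "real q ^ card I * norm (\<Sum>x\<in>E. \<Sum>y\<in>E. \<psi> (\<Sum>i\<in>I. c i * (\<xi> x i - \<xi> y i) ^ s)) \<le>
    real q ^ card I * (real (card E) * ?B)" by (simp add: ac_simps)
  moreover have "real q ^ card I > 0" using q_gt_1 by simp
  ultimately show ?thesis by (simp only: mult_le_cancel_left_pos)
qed

text \<open>When the squares are expanded, the sum over u1 and u2 factors, and orthogonality detects
  equality of each component with a factor q.\<close>

lemma collisions_parseval:
  assumes Z: "finite Z" and N: "\<And>z. z \<in> Z \<Longrightarrow> N1 z \<in> k \<and> N2 z \<in> k"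
  shows "(\<Sum>(u1, u2)\<in>k \<times> k. (norm (\<Sum>z\<in>Z. \<psi> (u1 * N1 z + u2 * N2 z)))\<^sup>2) =
    (real q)\<^sup>2 * real (card {(z, z') \<in> Z \<times> Z. (N1 z, N2 z) = (N1 z', N2 z')})"
proof -
  let ?T = "\<lambda>u1 u2. \<Sum>z\<in>Z. \<psi> (u1 * N1 z + u2 * N2 z)"
  have sq: "complex_of_real ((norm (?T u1 u2))\<^sup>2) =
     (\<Sum>z\<in>Z. \<Sum>z'\<in>Z. \<psi> (u1 * (N1 z - N1 z')) * \<psi> (u2 * (N2 z - N2 z')))" if u: "u1 \<in> k" "u2 \<in> k" for u1 u2
  proof -
    have "complex_of_real ((norm (?T u1 u2))\<^sup>2) = (\<Sum>z\<in>Z. \<Sum>z'\<in>Z. \<psi> (u1 * N1 z + u2 * N2 z) * cnj (\<psi> (u1 * N1 z' + u2 * N2 z')))"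
      by (simp add: complex_norm_square sum_product del: of_real_power)
    also have "\<dots> = (\<Sum>z\<in>Z. \<Sum>z'\<in>Z. \<psi> (u1 * (N1 z - N1 z')) * \<psi> (u2 * (N2 z - N2 z')))"
    proof (intro sum.cong refl)
      fix z z' assume z: "z \<in> Z" "z' \<in> Z"
      have mem: "u1 * N1 z + u2 * N2 z \<in> k" "u1 * N1 z' + u2 * N2 z' \<in> k"
        "u1 * (N1 z - N1 z') \<in> k" "u2 * (N2 z - N2 z') \<in> k"
        using u N[OF z(1)] N[OF z(2)] by (auto intro!: fld_add fld_mult fld_diff)
      have "\<psi> (u1 * N1 z + u2 * N2 z) * cnj (\<psi> (u1 * N1 z' + u2 * N2 z')) =
        \<psi> ((u1 * N1 z + u2 * N2 z) + - (u1 * N1 z' + u2 * N2 z'))"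
        unfolding psi_add[OF mem(1) fld_uminus[OF mem(2)]] psi_uminus[OF mem(2)] ..
      also have "(u1 * N1 z + u2 * N2 z) + - (u1 * N1 z' + u2 * N2 z') = u1 * (N1 z - N1 z') + u2 * (N2 z - N2 z')"
        by (simp add: algebra_simps)
      also have "\<psi> \<dots> = \<psi> (u1 * (N1 z - N1 z')) * \<psi> (u2 * (N2 z - N2 z'))" by (rule psi_add[OF mem(3,4)])
      finally show "\<psi> (u1 * N1 z + u2 * N2 z) * cnj (\<psi> (u1 * N1 z' + u2 * N2 z')) =
         \<psi> (u1 * (N1 z - N1 z')) * \<psi> (u2 * (N2 z - N2 z'))" .
    qed
    finally show ?thesis .
  qed
  have "complex_of_real (\<Sum>(u1, u2)\<in>k \<times> k. (norm (?T u1 u2))\<^sup>2) =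
      (\<Sum>u\<in>k \<times> k. \<Sum>z\<in>Z. \<Sum>z'\<in>Z. \<psi> (fst u * (N1 z - N1 z')) * \<psi> (snd u * (N2 z - N2 z')))"
    unfolding of_real_sum by (intro sum.cong refl) (auto simp: sq simp del: of_real_power One_nat_def)
  also have "\<dots> = (\<Sum>z\<in>Z. \<Sum>z'\<in>Z. \<Sum>u\<in>k \<times> k. \<psi> (fst u * (N1 z - N1 z')) * \<psi> (snd u * (N2 z - N2 z')))"
    by (subst sum.swap, intro sum.cong refl, rule sum.swap)
  also have "\<dots> = (\<Sum>z\<in>Z. \<Sum>z'\<in>Z. if (N1 z, N2 z) = (N1 z', N2 z') then of_nat (q\<^sup>2) else 0)"
  proof (intro sum.cong refl)
    fix z z' assume z: "z \<in> Z" "z' \<in> Z"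
    have d: "N1 z - N1 z' \<in> k" "N2 z - N2 z' \<in> k" using N[OF z(1)] N[OF z(2)] by (auto intro!: fld_diff)
    have "(\<Sum>u\<in>k \<times> k. \<psi> (fst u * (N1 z - N1 z')) * \<psi> (snd u * (N2 z - N2 z'))) =
      (\<Sum>u1\<in>k. \<psi> (u1 * (N1 z - N1 z'))) * (\<Sum>u2\<in>k. \<psi> (u2 * (N2 z - N2 z')))"
      by (simp add: sum_product sum.cartesian_product case_prod_beta)
    also have "\<dots> = (if (N1 z, N2 z) = (N1 z', N2 z') then of_nat (q\<^sup>2) else 0)"
      unfolding psi_orthogonal[OF d(1)] psi_orthogonal[OF d(2)] by (simp add: power2_eq_square)
    finally show "(\<Sum>u\<in>k \<times> k. \<psi> (fst u * (N1 z - N1 z')) * \<psi> (snd u * (N2 z - N2 z'))) =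
      (if (N1 z, N2 z) = (N1 z', N2 z') then of_nat (q\<^sup>2) else 0)" .
  qed
  also have "\<dots> = (\<Sum>y\<in>Z \<times> Z. if (N1 (fst y), N2 (fst y)) = (N1 (snd y), N2 (snd y)) then of_nat (q\<^sup>2) else 0)"
    by (simp add: sum.cartesian_product case_prod_beta)
  also have "\<dots> = (\<Sum>y\<in>{y \<in> Z \<times> Z. (N1 (fst y), N2 (fst y)) = (N1 (snd y), N2 (snd y))}. of_nat (q\<^sup>2))"
    using Z by (intro sum.inter_filter[symmetric]) simp
  also have "\<dots> = of_nat (q\<^sup>2 * card {y \<in> Z \<times> Z. (N1 (fst y), N2 (fst y)) = (N1 (snd y), N2 (snd y))})"
    by simp
  also have "{y \<in> Z \<times> Z. (N1 (fst y), N2 (fst y)) = (N1 (snd y), N2 (snd y))} =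
      {(z, z') \<in> Z \<times> Z. (N1 z, N2 z) = (N1 z', N2 z')}" by auto
  finally have "complex_of_real (\<Sum>(u1, u2)\<in>k \<times> k. (norm (?T u1 u2))\<^sup>2) =
    complex_of_real (real (q\<^sup>2 * card {(z, z') \<in> Z \<times> Z. (N1 z, N2 z) = (N1 z', N2 z')}))"
    by (simp only: of_real_of_nat_eq)
  then show ?thesis unfolding of_real_eq_iff by simp
qed

text \<open>In the constant, 1 stems from the trivial character, \<open>2 s^(4 d)\<close> from the
  characters on the two axes and \<open>s^(4 d)\<close> from the others; by \<open>large\<close>
  each contribution is compared with the fourth power of \<open>card E\<close>.\<close>

theorem card_distances_ge:
  fixes \<xi> \<eta> :: "'b \<Rightarrow> nat \<Rightarrow> 't" and a :: "nat \<Rightarrow> 't"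
  assumes d: "d > 0" and E: "finite E"
    and XY: "\<And>x i. x \<in> E \<Longrightarrow> i \<in> {1..d} \<Longrightarrow> \<xi> x i \<in> k \<and> \<eta> x i \<in> k"
    and sep: "\<And>x y. x \<in> E \<Longrightarrow> y \<in> E \<Longrightarrow> (\<And>i. i \<in> {1..d} \<Longrightarrow> \<xi> x i = \<xi> y i \<and> \<eta> x i = \<eta> y i) \<Longrightarrow> x = y"
    and a: "\<And>i. i \<in> {1..d} \<Longrightarrow> a i \<in> k - {0}"
    and large: "real (card E) \<ge> real q powr ((3 * real d + 1) / 2)"
  shows "real (card ((\<lambda>(x, y). (\<Sum>i=1..d. a i * (\<xi> x i - \<xi> y i) ^ s, \<Sum>i=1..d. a i * (\<eta> x i - \<eta> y i) ^ s)) ` (E \<times> E)))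
    \<ge> 1 / (1 + 3 * real s ^ (4 * d)) * (real q)\<^sup>2"
proof -
  define N1 where "N1 z = (\<Sum>i=1..d. a i * (\<xi> (fst z) i - \<xi> (snd z) i) ^ s)" for z
  define N2 where "N2 z = (\<Sum>i=1..d. a i * (\<eta> (fst z) i - \<eta> (snd z) i) ^ s)" for z
  let ?Z = "E \<times> E"
  let ?coll = "card {(z, z') \<in> ?Z \<times> ?Z. (N1 z, N2 z) = (N1 z', N2 z')}"
  let ?e = "real (card E)" and ?q = "real q" and ?s = "real s"
  have q1: "?q \<ge> 1" using q_gt_1 by simp
  have s1: "?s \<ge> 1" using s by simp
  have N: "N1 z \<in> k \<and> N2 z \<in> k" if "z \<in> ?Z" for z
    unfolding N1_def N2_def using that XY a s by (auto intro!: fld_sum fld_mult fld_power fld_diff)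
  have term_bound: "norm (\<Sum>z\<in>?Z. \<psi> (u1 * N1 z + u2 * N2 z)) \<le> ?e * (csum_bound u1 ^ d * csum_bound u2 ^ d)"
    if u: "u1 \<in> k" "u2 \<in> k" for u1 u2
  proof -
    \<comment> \<open>Both components are joined to one point with 2d coordinates, so that a single
      application of \<open>bilinear_bound\<close> covers both distances.\<close>
    let ?I = "{1..d} <+> {1..d}"
    let ?c = "case_sum (\<lambda>i. u1 * a i) (\<lambda>i. u2 * a i)"
    let ?X = "\<lambda>x. case_sum (\<xi> x) (\<eta> x)"
    have sumI: "(\<Sum>i\<in>?I. ?c i * (?X x i - ?X y i) ^ s) = u1 * N1 (x, y) + u2 * N2 (x, y)" for x y
      by (subst sum.Plus) (simp_all add: N1_def N2_def sum_distrib_left mult.assoc)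
    have "norm (\<Sum>x\<in>E. \<Sum>y\<in>E. \<psi> (\<Sum>i\<in>?I. ?c i * (?X x i - ?X y i) ^ s)) \<le> ?e * (\<Prod>i\<in>?I. csum_bound (?c i))"
    proof (rule bilinear_bound)
      fix x y assume xy: "x \<in> E" "y \<in> E" "\<And>i. i \<in> ?I \<Longrightarrow> ?X x i = ?X y i"
      show "x = y"
      proof (rule sep[OF xy(1,2)])
        fix i assume "i \<in> {1..d}"
        then show "\<xi> x i = \<xi> y i \<and> \<eta> x i = \<eta> y i" using xy(3)[OF InlI[of i]] xy(3)[OF InrI[of i]] by auto
      qed
    qed (use E XY a u in \<open>auto intro!: fld_mult\<close>)
    moreover have "csum_bound (u * a i) = csum_bound u" if "i \<in> {1..d}" "u \<in> k" for i u
    proof -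
      have "u * a i = 0 \<longleftrightarrow> u = 0" using mult_eq_0[of u "a i"] a[OF that(1)] that(2) fld_subset by auto
      then show ?thesis by (simp add: csum_bound_def)
    qed
    then have "(\<Prod>i\<in>?I. csum_bound (?c i)) = csum_bound u1 ^ d * csum_bound u2 ^ d"
      using u by (subst prod.Plus) simp_all
    ultimately show ?thesis unfolding sumI by (simp add: sum.cartesian_product case_prod_beta)
  qed
  \<comment> \<open>\<open>G1\<close> bounds the squared sum if exactly one of u1, u2 vanishes,
    \<open>G2\<close> if neither does. In \<open>G1\<close> the power \<open>s^(2 d)\<close> is
    enlarged to \<open>s^(4 d)\<close> for the sake of a common constant.\<close>
  define G1 G2 where "G1 = ?e\<^sup>2 * (?s ^ (4 * d) * ?q ^ (3 * d))" and "G2 = ?e\<^sup>2 * (?s ^ (4 * d) * ?q ^ (2 * d))"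
  have G0: "G1 \<ge> 0" "G2 \<ge> 0" by (simp_all add: G1_def G2_def)
  have Sb: "(csum_bound u ^ d)\<^sup>2 = (if u = 0 then ?q ^ (2 * d) else ?s ^ (2 * d) * ?q ^ d)" for u
    by (simp add: csum_bound_def power_mult_distrib mult.commute[of 2] power_mult[symmetric])
      (simp add: mult.commute[of d 2] power_mult)
  have s24: "?s ^ (2 * d) \<le> ?s ^ (4 * d)" using s1 by (intro power_increasing) auto
  \<comment> \<open>A sum of indicators instead of a case distinction, so that it can be summed over
    u1 and u2 term by term.\<close>
  have pt: "(norm (\<Sum>z\<in>?Z. \<psi> (u1 * N1 z + u2 * N2 z)))\<^sup>2 \<le>
      (if u1 = 0 \<and> u2 = 0 then ?e ^ 4 else 0) + (if u1 = 0 then G1 else 0) + (if u2 = 0 then G1 else 0) + G2"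
    if u: "u1 \<in> k" "u2 \<in> k" for u1 u2
  proof (cases "u1 = 0 \<and> u2 = 0")
    case True
    then have "(norm (\<Sum>z\<in>?Z. \<psi> (u1 * N1 z + u2 * N2 z)))\<^sup>2 = ?e ^ 4"
      by (simp add: psi_0 norm_mult card_cartesian_product power2_eq_square power4_eq_xxxx)
    then show ?thesis using True G0 by simp
  next
    case False
    have "(norm (\<Sum>z\<in>?Z. \<psi> (u1 * N1 z + u2 * N2 z)))\<^sup>2 \<le> (?e * (csum_bound u1 ^ d * csum_bound u2 ^ d))\<^sup>2"
      using term_bound[OF u] by (intro power_mono) auto
    also have "\<dots> = ?e\<^sup>2 * ((csum_bound u1 ^ d)\<^sup>2 * (csum_bound u2 ^ d)\<^sup>2)" by (simp only: power_mult_distrib)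
    also have "\<dots> \<le> (if u1 = 0 then G1 else 0) + (if u2 = 0 then G1 else 0) + G2"
    proof -
      have one: "?e\<^sup>2 * (?q ^ (2 * d) * (?s ^ (2 * d) * ?q ^ d)) \<le> G1"
      proof -
        have "?q ^ (2 * d) * (?s ^ (2 * d) * ?q ^ d) = ?s ^ (2 * d) * ?q ^ (3 * d)"
          by (simp add: ac_simps flip: power_add)
        also have "\<dots> \<le> ?s ^ (4 * d) * ?q ^ (3 * d)" using s24 by (intro mult_right_mono) auto
        finally show ?thesis unfolding G1_def by (intro mult_left_mono) auto
      qed
      have two: "?e\<^sup>2 * ((?s ^ (2 * d) * ?q ^ d) * (?s ^ (2 * d) * ?q ^ d)) = G2"
      proof -
        have "(?s ^ (2 * d) * ?q ^ d) * (?s ^ (2 * d) * ?q ^ d) = ?s ^ (2 * d + 2 * d) * ?q ^ (d + d)"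
          by (simp only: power_add ac_simps)
        moreover have "2 * d + 2 * d = 4 * d" "d + d = 2 * d" by simp_all
        ultimately show ?thesis by (simp only: G2_def)
      qed
      have one': "?e\<^sup>2 * ((?s ^ (2 * d) * ?q ^ d) * ?q ^ (2 * d)) \<le> G1"
        using one by (simp only: mult.commute[of "?s ^ (2 * d) * ?q ^ d"])
      consider "u1 = 0" "u2 \<noteq> 0" | "u1 \<noteq> 0" "u2 = 0" | "u1 \<noteq> 0" "u2 \<noteq> 0" using False by blast
      then show ?thesis
      proof cases
        case 1
        then show ?thesis unfolding Sb using add_mono[OF one G0(2)] by simp
      next
        case 2
        then show ?thesis unfolding Sb using add_mono[OF one' G0(2)] by simp
      next
        case 3
        then show ?thesis unfolding Sb using two by simp
      qed
    qed
    finally show ?thesis unfolding if_not_P[OF False] add_0 .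
  qed
  have "?q\<^sup>2 * real ?coll = (\<Sum>(u1, u2)\<in>k \<times> k. (norm (\<Sum>z\<in>?Z. \<psi> (u1 * N1 z + u2 * N2 z)))\<^sup>2)"
    using E N by (intro collisions_parseval[symmetric]) auto
  also have "\<dots> \<le> (\<Sum>(u1, u2)\<in>k \<times> k.
     (if u1 = 0 \<and> u2 = 0 then ?e ^ 4 else 0) + (if u1 = 0 then G1 else 0) + (if u2 = 0 then G1 else 0) + G2)"
    by (rule sum_mono) (auto intro: pt simp del: One_nat_def)
  also have "\<dots> = (\<Sum>u1\<in>k. \<Sum>u2\<in>k.
     (if u1 = 0 then if u2 = 0 then ?e ^ 4 else 0 else 0) + (if u1 = 0 then G1 else 0) + (if u2 = 0 then G1 else 0) + G2)"
    unfolding sum.cartesian_product by (intro sum.cong) auto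
  also have "\<dots> = ?e ^ 4 + 2 * ?q * G1 + ?q\<^sup>2 * G2"
  proof -
    have if_sum: "(\<Sum>u2\<in>k. if u1 = 0 then g u2 else 0) = (if u1 = 0 then sum g k else 0)" for u1 :: 't and g :: "'t \<Rightarrow> real"
      by simp
    show ?thesis
      using fld_zero[of 1] finite_k
      by (simp add: sum.distrib if_sum card_fld_1 sum_distrib_left[symmetric] power2_eq_square
          del: One_nat_def)
  qed
  also have "\<dots> \<le> ?e ^ 4 + 3 * ?s ^ (4 * d) * (?e\<^sup>2 * ?q ^ (3 * d + 1))"
  proof -
    have "2 * ?q * G1 = 2 * (?s ^ (4 * d) * (?e\<^sup>2 * ?q ^ (3 * d + 1)))"
      by (simp add: G1_def ac_simps)
    moreover have "?q\<^sup>2 * G2 \<le> ?s ^ (4 * d) * (?e\<^sup>2 * ?q ^ (3 * d + 1))"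
    proof -
      have "?q\<^sup>2 * G2 = ?s ^ (4 * d) * (?e\<^sup>2 * ?q ^ (2 + 2 * d))" unfolding G2_def power_add by (simp only: ac_simps)
      also have "\<dots> \<le> ?s ^ (4 * d) * (?e\<^sup>2 * ?q ^ (3 * d + 1))"
        using q1 d by (intro mult_left_mono power_increasing) auto
      finally show ?thesis .
    qed
    ultimately show ?thesis by linarith
  qed
  also have "\<dots> \<le> (1 + 3 * ?s ^ (4 * d)) * ?e ^ 4"
  proof -
    have "?q ^ (3 * d + 1) = ?q powr (3 * real d + 1)"
      using q1 by (subst powr_realpow[symmetric]) (auto simp: add.commute)
    also have "\<dots> = (?q powr ((3 * real d + 1) / 2))\<^sup>2"
      unfolding power2_eq_square powr_add[symmetric] by (simp only: field_sum_of_halves)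
    also have "\<dots> \<le> ?e\<^sup>2" using large by (intro power_mono) auto
    finally have "?e\<^sup>2 * ?q ^ (3 * d + 1) \<le> ?e\<^sup>2 * ?e\<^sup>2" by (intro mult_left_mono) auto
    also have "\<dots> = ?e ^ 4" by (simp flip: power_add)
    finally have "3 * ?s ^ (4 * d) * (?e\<^sup>2 * ?q ^ (3 * d + 1)) \<le> 3 * ?s ^ (4 * d) * ?e ^ 4"
      by (intro mult_left_mono) auto
    then show ?thesis by (simp add: algebra_simps)
  qed
  finally have upper: "?q\<^sup>2 * real ?coll \<le> (1 + 3 * ?s ^ (4 * d)) * ?e ^ 4" .
  let ?D = "card ((\<lambda>z. (N1 z, N2 z)) ` ?Z)"
  have "(real (card ?Z))\<^sup>2 \<le> real ?D * real ?coll"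
    using E by (intro card_square_le_collisions) auto
  then have cs: "?e ^ 4 \<le> real ?D * real ?coll"
    by (simp add: card_cartesian_product power2_eq_square power4_eq_xxxx)
  have "?q powr ((3 * real d + 1) / 2) > 0" using q1 by simp
  then have e0: "?e ^ 4 > 0" using large by (intro zero_less_power) linarith
  let ?M = "1 + 3 * ?s ^ (4 * d)"
  have M0: "?M > 0" by (simp add: add_pos_nonneg)
  have "?q\<^sup>2 * ?e ^ 4 \<le> ?q\<^sup>2 * (real ?D * real ?coll)" using cs by (intro mult_left_mono) auto
  also have "\<dots> = real ?D * (?q\<^sup>2 * real ?coll)" by (simp only: ac_simps)
  also have "\<dots> \<le> real ?D * (?M * ?e ^ 4)" using upper by (intro mult_left_mono) auto
  finally have "?q\<^sup>2 * ?e ^ 4 \<le> (real ?D * ?M) * ?e ^ 4" by (simp only: mult.assoc)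
  then have "?q\<^sup>2 \<le> real ?D * ?M" using e0 by simp
  then have "1 / ?M * ?q\<^sup>2 \<le> real ?D" using M0 by (simp add: divide_le_eq)
  moreover have "(\<lambda>z. (N1 z, N2 z)) = (\<lambda>(x, y). (\<Sum>i=1..d. a i * (\<xi> x i - \<xi> y i) ^ s, \<Sum>i=1..d. a i * (\<eta> x i - \<eta> y i) ^ s))"
    by (auto simp: N1_def N2_def)
  ultimately show ?thesis by (simp only:)
qed

end

subsection \<open>Transfer from an abstract finite field\<close>

lemma (in field) pow_order_eq:
  assumes "finite (carrier R)" "x \<in> carrier R"
  shows "x [^] order R = x"
proof (cases "x = \<zero>")
  case True
  have "order R \<noteq> 0" using assms by (auto simp: Coset.order_def)
  then show ?thesis using True by (simp add: nat_pow_zero)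
next
  case False
  interpret M: group "Multiplicative_Group.mult_of R" by (rule field_mult_group)
  have "order R > 0" using assms by (auto simp: Coset.order_def card_gt_0_iff)
  have "x [^] order (Multiplicative_Group.mult_of R) = \<one>"
    using M.pow_order_eq_1[of x] False assms by (simp add: Multiplicative_Group.nat_pow_mult_of)
  then have "x [^] (order R - 1) = \<one>" using assms by (simp add: order_mult_of)
  then have "x [^] Suc (order R - 1) = x" using assms by simp
  then show ?thesis using \<open>order R > 0\<close> by simp
qed

text \<open>Translation by x permutes \<open>G\<close>, so adding \<open>card G\<close> copies of x
  leaves the sum of all elements unchanged.\<close>

lemma finite_subgroup_card_mult:
  fixes G :: "'t :: comm_ring_1 set"
  assumes "additive_subgroup G" "finite G" "x \<in> G"
  shows "of_nat (card G) * x = 0"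
proof -
  have "(\<Sum>y\<in>G. y) = (\<Sum>y\<in>G. x + y)"
    by (rule sum.reindex_bij_witness[of _ "\<lambda>y. x + y" "\<lambda>y. y - x"])
      (use assms additive_subgroup_diff[OF assms(1)] in \<open>auto simp: additive_subgroup_def\<close>)
  then show ?thesis by (simp add: sum.distrib)
qed

text \<open>\<open>U\<close> has no zero divisors, so when prime factors of n are split off one at a
  time, one of them must annihilate e.\<close>

lemma (in alg_closed_subset) ex_prime_mult_eq_0:
  "n > 0 \<Longrightarrow> of_nat n * e = 0 \<Longrightarrow> \<exists>p. Factorial_Ring.prime p \<and> p dvd n \<and> of_nat p * e = 0"
proof (induction n rule: less_induct)
  case (less n)
  have "n \<noteq> 1" using less.prems unit_neq_0 by auto
  then obtain p where p: "Factorial_Ring.prime p" "p dvd n" using prime_factor_nat by blast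
  then obtain m where m: "n = p * m" by auto
  have mem: "of_nat i * e \<in> U" for i
    by (induction i) (auto simp: zero_mem distrib_right add_mem unit_mem)
  have "(of_nat p * e) * (of_nat m * e) = of_nat n * (e * e)" by (simp add: m ac_simps)
  then have "(of_nat p * e) * (of_nat m * e) = 0" using less.prems unit_mult[OF unit_mem] by simp
  then consider "of_nat p * e = 0" | "of_nat m * e = 0" using mult_eq_0[OF mem mem] by blast
  then show ?case
  proof cases
    case 2
    have "m < n" "m > 0" using m p(1) less.prems(1) prime_gt_1_nat[OF p(1)] by auto
    then show ?thesis using less.IH[OF _ _ 2] m by (metis dvd_mult)
  qed (use p in auto)
qed

text \<open>The multiset type in the statement is the one on which the algebraic closure is built.
  The image of \<open>F\<close> consists of fixed points of the power \<open>order F\<close>; there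
  are at most \<open>order F\<close> of these, so it is the whole fixed set.\<close>

lemma finite_field_embedding:
  fixes F :: "'a ring"
  assumes F: "field F" and fin: "finite (carrier F)"
  obtains U :: "(('a list \<times> nat) multiset \<Rightarrow> 'a) cring_prod set" and e p \<kappa> h where
    "frobenius_field U e p \<kappa> (order F)" "p dvd order F" "inj_on h (carrier F)"
    "h ` carrier F = {x\<in>U. x ^ order F = x}"
    "\<And>x y. x \<in> carrier F \<Longrightarrow> y \<in> carrier F \<Longrightarrow> h (x \<oplus>\<^bsub>F\<^esub> y) = h x + h y"
    "\<And>x y. x \<in> carrier F \<Longrightarrow> y \<in> carrier F \<Longrightarrow> h (x \<otimes>\<^bsub>F\<^esub> y) = h x * h y"
proof -
  interpret F: field F by (rule F)
  let ?L = "F.alg_closure"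
  interpret L: algebraic_closure ?L "F.indexed_const ` carrier F" by (rule F.alg_closureE)
  have hom: "F.indexed_const \<in> ring_hom F ?L" by (rule F.alg_closureE)
  have cr: "cring ?L" by (rule L.is_cring)
  let ?h = "\<lambda>x. embed_factor ?L (F.indexed_const x)"
  define U where "U = embed_factor ?L ` carrier ?L"
  define e where "e = embed_factor ?L \<one>\<^bsub>?L\<^esub>"
  interpret A: alg_closed_subset U e
    unfolding U_def e_def by (rule alg_closed_subset_embed_factor) (rule L.algebraically_closed_axioms)
  have ic: "F.indexed_const x \<in> carrier ?L" if "x \<in> carrier F" for x using ring_hom_closed[OF hom that] .
  have add: "?h (x \<oplus>\<^bsub>F\<^esub> y) = ?h x + ?h y" if "x \<in> carrier F" "y \<in> carrier F" for x y
    using that ic by (simp add: ring_hom_add[OF hom] embed_factor_add[OF cr])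
  have mult: "?h (x \<otimes>\<^bsub>F\<^esub> y) = ?h x * ?h y" if "x \<in> carrier F" "y \<in> carrier F" for x y
    using that ic by (simp add: ring_hom_mult[OF hom] embed_factor_mult[OF cr])
  have inj: "inj_on ?h (carrier F)"
  proof (rule inj_onI)
    fix x y assume xy: "x \<in> carrier F" "y \<in> carrier F" "?h x = ?h y"
    have "F.indexed_const x = (F.indexed_const y :: ('a list \<times> nat) multiset \<Rightarrow> 'a)"
      using inj_onD[OF inj_embed_factor[OF cr], OF xy(3)] ic xy(1,2) by blast
    then show "x = y" using inj_onD[OF F.indexed_const_inj_on] xy(1,2) by blast
  qed
  have zero: "?h \<zero>\<^bsub>F\<^esub> = 0" using add[of "\<zero>\<^bsub>F\<^esub>" "\<zero>\<^bsub>F\<^esub>"] by simp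
  have one: "?h \<one>\<^bsub>F\<^esub> = e" using ring_hom_one[OF hom] by (simp add: e_def)
  let ?G = "?h ` carrier F"
  have sub: "additive_subgroup ?G"
    unfolding additive_subgroup_def
  proof (intro conjI ballI)
    show "0 \<in> ?G" using zero by (metis F.zero_closed image_eqI)
  next
    fix x y assume "x \<in> ?G" "y \<in> ?G"
    then obtain u v where uv: "u \<in> carrier F" "v \<in> carrier F" "x = ?h u" "y = ?h v" by blast
    then have "x + y = ?h (u \<oplus>\<^bsub>F\<^esub> v)" using add by simp
    then show "x + y \<in> ?G" using uv by blast
  next
    fix x assume "x \<in> ?G"
    then obtain u where u: "u \<in> carrier F" "x = ?h u" by blast
    have "?h (\<ominus>\<^bsub>F\<^esub> u) + x = 0" using add[of "\<ominus>\<^bsub>F\<^esub> u" u] u zero by (simp add: F.l_neg)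
    then have "- x = ?h (\<ominus>\<^bsub>F\<^esub> u)" by (metis add.commute minus_unique)
    then show "- x \<in> ?G" using u by blast
  qed
  have finG: "finite ?G" using fin by simp
  have cardG: "card ?G = order F" using inj by (simp add: card_image Coset.order_def)
  have eG: "e \<in> ?G" using one by (metis F.one_closed image_eqI)
  have "of_nat (order F) * e = 0" using finite_subgroup_card_mult[OF sub finG eG] cardG by simp
  moreover have q0: "order F > 0" using fin by (auto simp: Coset.order_def card_gt_0_iff)
  ultimately obtain p where p: "Factorial_Ring.prime p" "p dvd order F" "of_nat p * e = 0"
    using A.ex_prime_mult_eq_0 by blast
  have pU: "of_nat p * x = 0" if "x \<in> U" for x
  proof -
    have "of_nat p * x = (of_nat p * e) * x" using A.unit_mult[OF that] by (simp add: mult.assoc)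
    then show ?thesis using p(3) by simp
  qed
  have GU: "?G \<subseteq> U" using ic by (auto simp: U_def)
  obtain \<kappa> where \<kappa>: "order F = p ^ \<kappa>"
    using card_additive_p_group[OF sub finG p(1)] pU GU cardG by auto
  have "\<kappa> > 0"
  proof (rule ccontr)
    assume "\<not> \<kappa> > 0"
    then have "order F = 1" using \<kappa> by simp
    then show False using p by auto
  qed
  have q1: "order F > 1" using p q0 prime_gt_1_nat[OF p(1)] dvd_imp_le[of p "order F"] by linarith
  have pow: "?h (x [^]\<^bsub>F\<^esub> n) = ?h x ^ n" if "x \<in> carrier F" "n > 0" for x and n :: nat
    using that(2,1) by (induction n rule: nat_induct_non_zero) (auto simp: mult mult.commute)
  have "?G \<subseteq> {x\<in>U. x ^ order F = x}"
    using GU pow[OF _ q0] F.pow_order_eq[OF fin] by auto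
  moreover have "card {x\<in>U. x ^ order F = x} \<le> card ?G"
    using A.finite_power_fixed[OF q1] cardG by simp
  ultimately have fixed: "?G = {x\<in>U. x ^ order F = x}"
    using A.finite_power_fixed(1)[OF q1] by (intro card_seteq) auto
  have "frobenius_field U e p \<kappa> (order F)"
    by unfold_locales (use p pU \<kappa> \<open>\<kappa> > 0\<close> fixed cardG in auto)
  then show thesis using that p(2) inj fixed add mult by blast
qed

text \<open>The reduced exponent s' depends on the characteristic, but \<open>s' \<le> s\<close>, so
  the constant belonging to s serves all fields at once.\<close>

theorem theorem3:
  fixes d s :: nat
  assumes "d \<ge> 2" and "s \<ge> 2"
  shows "\<exists>C>0::real. \<exists>c>0::real.
    \<forall>(F :: 'a ring) (a :: nat \<Rightarrow> 'a) (E :: ((nat \<Rightarrow> 'a) \<times> (nat \<Rightarrow> 'a)) set).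
      field F \<longrightarrow> finite (carrier F) \<longrightarrow> \<not> char_power F s \<longrightarrow>
      (\<forall>i\<in>{1..d}. a i \<in> carrier F - {\<zero>\<^bsub>F\<^esub>}) \<longrightarrow>
      E \<subseteq> points F d \<times> points F d \<longrightarrow>
      real (card E) \<ge> C * real (order F) powr ((3 * real d + 1) / 2) \<longrightarrow>
      real (card (distance_pairs F d s a E)) \<ge> c * (real (order F))\<^sup>2"
proof (intro exI conjI allI impI)
  show "(1::real) > 0" by simp
  show "1 / (1 + 3 * real s ^ (4 * d)) > 0" by (simp add: add_pos_nonneg)
  fix F :: "'a ring" and a :: "nat \<Rightarrow> 'a" and E :: "((nat \<Rightarrow> 'a) \<times> (nat \<Rightarrow> 'a)) set"
  assume F: "field F" and fin: "finite (carrier F)" and ncp: "\<not> char_power F s"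
    and a: "\<forall>i\<in>{1..d}. a i \<in> carrier F - {\<zero>\<^bsub>F\<^esub>}"
    and E: "E \<subseteq> points F d \<times> points F d"
    and large: "real (card E) \<ge> 1 * real (order F) powr ((3 * real d + 1) / 2)"
  interpret F: field F by (rule F)
  obtain U :: "(('a list \<times> nat) multiset \<Rightarrow> 'a) cring_prod set" and e p \<kappa> h where
    ff: "frobenius_field U e p \<kappa> (order F)" and pq: "p dvd order F" and inj: "inj_on h (carrier F)"
    and fixed: "h ` carrier F = {x\<in>U. x ^ order F = x}"
    and add: "\<And>x y. x \<in> carrier F \<Longrightarrow> y \<in> carrier F \<Longrightarrow> h (x \<oplus>\<^bsub>F\<^esub> y) = h x + h y"
    and mult: "\<And>x y. x \<in> carrier F \<Longrightarrow> y \<in> carrier F \<Longrightarrow> h (x \<otimes>\<^bsub>F\<^esub> y) = h x * h y"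
    by (rule finite_field_embedding[OF F fin]) (rule that; assumption)
  interpret frobenius_field U e p \<kappa> "order F" by (rule ff)
  have k: "h ` carrier F = fld 1" using fixed by (simp add: fld_def)
  have hk: "h x \<in> fld 1" if "x \<in> carrier F" for x using k that by blast
  have zero: "h \<zero>\<^bsub>F\<^esub> = 0" using add[of "\<zero>\<^bsub>F\<^esub>" "\<zero>\<^bsub>F\<^esub>"] by simp
  have diff: "h (x \<ominus>\<^bsub>F\<^esub> y) = h x - h y" if "x \<in> carrier F" "y \<in> carrier F" for x y
  proof -
    have "h (x \<ominus>\<^bsub>F\<^esub> y) + h y = h (x \<ominus>\<^bsub>F\<^esub> y \<oplus>\<^bsub>F\<^esub> y)" using that by (simp add: add)
    also have "x \<ominus>\<^bsub>F\<^esub> y \<oplus>\<^bsub>F\<^esub> y = x" using that by (simp add: F.minus_eq F.a_assoc F.l_neg)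
    finally show ?thesis by (simp add: algebra_simps)
  qed
  have pow: "h (x [^]\<^bsub>F\<^esub> n) = h x ^ n" if "x \<in> carrier F" "n > 0" for x and n :: nat
    using that(2,1) by (induction n rule: nat_induct_non_zero) (auto simp: mult mult.commute)
  have hsum: "h (\<Oplus>\<^bsub>F\<^esub>i\<in>I. g i) = (\<Sum>i\<in>I. h (g i))" if "finite I" "g \<in> I \<rightarrow> carrier F" for I :: "nat set" and g
    using that by (induction I rule: finite_induct) (auto simp: zero add Pi_iff F.finsum_insert)

  have "s > 0" using assms by simp
  then obtain s' where s': "s = p ^ multiplicity p s * s'" "\<not> p dvd s'"
    using multiplicity_decompose'[of s p] p by (metis not_prime_unit neq0_conv)
  define P where "P = p ^ multiplicity p s"
  have sP: "s = P * s'" using s' by (simp add: P_def)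
  have "s' \<noteq> 0" using sP \<open>s > 0\<close> by (cases s') auto
  \<comment> \<open>\<open>s' = 1\<close> would make s a power of the characteristic, the case
    excluded by \<open>char_power\<close>.\<close>
  moreover have "s' \<noteq> 1" using sP ncp p pq unfolding char_power_def P_def by auto
  ultimately have s'2: "s' \<ge> 2" by simp
  have "s' \<le> P * s'" using p_pos by (simp add: P_def)
  then have "s' \<le> s" unfolding sP[symmetric] .
  have Pinj: "x = y" if "x \<in> fld 1" "y \<in> fld 1" "x ^ P = y ^ P" for x y
    using frob_inj that fld_subset unfolding P_def by blast
  have P0: "P > 0" using p_pos by (simp add: P_def)
  \<comment> \<open>An injective map of a finite set to itself is onto, so every coefficient has a
    P-th root \<open>b i\<close>; this turns \<open>diag_norm\<close> into the P-th power of a form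
    with exponent s'.\<close>
  have "(\<lambda>x. x ^ P) ` fld 1 = fld 1"
    using Pinj P0 by (intro endo_inj_surj finite_fld) (auto simp: inj_on_def intro: fld_power)
  then have "\<forall>i. \<exists>b. i \<in> {1..d} \<longrightarrow> b \<in> fld 1 \<and> h (a i) = b ^ P" using a hk by (metis DiffD1 imageE)
  then obtain b where b: "\<And>i. i \<in> {1..d} \<Longrightarrow> b i \<in> fld 1" "\<And>i. i \<in> {1..d} \<Longrightarrow> h (a i) = b i ^ P" by metis
  have b0: "b i \<noteq> 0" if "i \<in> {1..d}" for i
  proof
    assume "b i = 0"
    then have "h (a i) = h \<zero>\<^bsub>F\<^esub>" using b(2)[OF that] P0 zero by (simp add: zero_power)
    then have "a i = \<zero>\<^bsub>F\<^esub>" using a that by (intro inj_onD[OF inj]) auto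
    then show False using a that by auto
  qed

  have sub1: "additive_subgroup (fld 1)"
    using fld_zero fld_add fld_uminus by (auto simp: additive_subgroup_def)
  have ne1: "fld 1 \<noteq> {0}" using fld_unit[of 1] unit_neq_0 by auto
  have p1: "of_nat p * x = 0" if "x \<in> fld 1" for x using that fld_subset p_mult by blast
  obtain \<psi> :: "(('a list \<times> nat) multiset \<Rightarrow> 'a) cring_prod \<Rightarrow> complex" where
    \<psi>: "\<forall>x\<in>fld 1. \<forall>y\<in>fld 1. \<psi> (x + y) = \<psi> x * \<psi> y" "\<forall>x\<in>fld 1. norm (\<psi> x) = 1" "\<exists>x\<in>fld 1. \<psi> x \<noteq> 1"
    using ex_nontrivial_character[OF sub1 finite_fld[OF zero_less_one] ne1 p p1] by blast
  interpret char_field U e p \<kappa> "order F" \<psi> s'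
    by unfold_locales (use \<psi> s'2 s' in auto)

  have pt: "x i \<in> carrier F" if "x \<in> points F d" "i \<in> {1..d}" for x i
    using that by (auto simp: points_def PiE_iff)
  have norm_h: "h (diag_norm F d s a x y) = (\<Sum>i=1..d. b i * (h (x i) - h (y i)) ^ s') ^ P"
    if xy: "x \<in> points F d" "y \<in> points F d" for x y
  proof -
    have "h (diag_norm F d s a x y) = (\<Sum>i\<in>{1..d}. h (a i \<otimes>\<^bsub>F\<^esub> (x i \<ominus>\<^bsub>F\<^esub> y i) [^]\<^bsub>F\<^esub> s))"
      unfolding diag_norm_def using a pt xy by (intro hsum) (auto intro!: F.m_closed F.nat_pow_closed)
    also have "\<dots> = (\<Sum>i=1..d. (b i * (h (x i) - h (y i)) ^ s') ^ P)"
    proof (intro sum.cong refl)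
      fix i assume i: "i \<in> {1..d}"
      have "h (a i \<otimes>\<^bsub>F\<^esub> (x i \<ominus>\<^bsub>F\<^esub> y i) [^]\<^bsub>F\<^esub> s) = h (a i) * (h (x i) - h (y i)) ^ s"
        using a i pt[OF xy(1) i] pt[OF xy(2) i] \<open>s > 0\<close> by (simp add: mult pow diff)
      also have "\<dots> = (b i * (h (x i) - h (y i)) ^ s') ^ P"
        using b(2)[OF i] by (simp add: sP power_mult_distrib mult.commute[of P] power_mult)
      finally show "h (a i \<otimes>\<^bsub>F\<^esub> (x i \<ominus>\<^bsub>F\<^esub> y i) [^]\<^bsub>F\<^esub> s) = (b i * (h (x i) - h (y i)) ^ s') ^ P" .
    qed
    also have "\<dots> = (\<Sum>i=1..d. b i * (h (x i) - h (y i)) ^ s') ^ P"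
      unfolding P_def
    proof (rule frob_sum[symmetric])
      fix i assume i: "i \<in> {1..d}"
      have "b i * (h (x i) - h (y i)) ^ s' \<in> fld 1"
        using b(1)[OF i] hk pt[OF xy(1) i] pt[OF xy(2) i] s'2 by (intro fld_mult fld_power fld_diff) auto
      then show "b i * (h (x i) - h (y i)) ^ s' \<in> U" using fld_subset by blast
    qed
    finally show ?thesis .
  qed

  have finpts: "finite (points F d)" using fin by (auto simp: points_def intro!: finite_PiE)
  have finE: "finite E" by (rule finite_subset[OF E]) (use finpts in simp)
  let ?N = "\<lambda>x y. \<Sum>i=1..d. b i * (h (x i) - h (y i)) ^ s'"
  let ?D = "(\<lambda>(x, y). (?N (fst x) (fst y), ?N (snd x) (snd y))) ` (E \<times> E)"
  have "1 / (1 + 3 * real s ^ (4 * d)) * (real (order F))\<^sup>2 \<le> 1 / (1 + 3 * real s' ^ (4 * d)) * (real (order F))\<^sup>2"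
  proof (intro mult_right_mono divide_left_mono)
    have "real s' ^ (4 * d) \<le> real s ^ (4 * d)" using \<open>s' \<le> s\<close> by (intro power_mono) auto
    then show "1 + 3 * real s' ^ (4 * d) \<le> 1 + 3 * real s ^ (4 * d)" by simp
  qed (auto intro!: mult_pos_pos add_pos_nonneg)
  also have "\<dots> \<le> real (card ?D)"
  proof (rule card_distances_ge[of d E "\<lambda>x i. h (fst x i)" "\<lambda>x i. h (snd x i)" b])
    fix x i assume "x \<in> E" "i \<in> {1..d}"
    then show "h (fst x i) \<in> fld 1 \<and> h (snd x i) \<in> fld 1" using E pt hk by auto
  next
    fix x y assume xy: "x \<in> E" "y \<in> E"
      and eq: "\<And>i. i \<in> {1..d} \<Longrightarrow> h (fst x i) = h (fst y i) \<and> h (snd x i) = h (snd y i)"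
    have mem: "fst x \<in> points F d" "fst y \<in> points F d" "snd x \<in> points F d" "snd y \<in> points F d"
      using xy E by auto
    have "fst x i = fst y i" "snd x i = snd y i" if "i \<in> {1..d}" for i
      using eq[OF that] inj_onD[OF inj] pt[OF mem(1) that] pt[OF mem(2) that] pt[OF mem(3) that] pt[OF mem(4) that]
      by auto
    then have "fst x = fst y" "snd x = snd y"
      using mem unfolding points_def by (blast intro: PiE_ext)+
    then show "x = y" by (simp add: prod_eq_iff)
  qed (use assms finE b b0 large in auto)
  also have "card ?D \<le> card (distance_pairs F d s a E)"
  proof -
    \<comment> \<open>Both distance sets are compared inside the embedded field: raising to the
      power P is injective there and carries the distances with exponent s' to the images under
      \<open>h\<close> of the original ones.\<close>
    let ?g = "\<lambda>(u, v). (h u, h v)" and ?P = "\<lambda>(u, v). (u ^ P, v ^ P)"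
    have dp: "distance_pairs F d s a E =
        (\<lambda>(x, y). (diag_norm F d s a (fst x) (fst y), diag_norm F d s a (snd x) (snd y))) ` (E \<times> E)"
      unfolding distance_pairs_def by force
    then have findp: "finite (distance_pairs F d s a E)" using finE by simp
    have "?P ` ?D = ?g ` distance_pairs F d s a E"
      unfolding dp image_image
    proof (intro image_cong refl)
      fix z assume "z \<in> E \<times> E"
      then have "fst (fst z) \<in> points F d" "snd (fst z) \<in> points F d" "fst (snd z) \<in> points F d" "snd (snd z) \<in> points F d"
        using E by auto
      then show "?P (case z of (x, y) \<Rightarrow> (?N (fst x) (fst y), ?N (snd x) (snd y))) =
         ?g (case z of (x, y) \<Rightarrow> (diag_norm F d s a (fst x) (fst y), diag_norm F d s a (snd x) (snd y)))"
        by (simp add: case_prod_beta norm_h)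
    qed
    moreover have "inj_on ?P ?D"
    proof (rule inj_on_subset[of _ "fld 1 \<times> fld 1"])
      show "inj_on ?P (fld 1 \<times> fld 1)" using Pinj by (auto simp: inj_on_def)
      have N: "?N x y \<in> fld 1" if "x \<in> points F d" "y \<in> points F d" for x y
      proof (rule fld_sum)
        fix i assume i: "i \<in> {1..d}"
        show "b i * (h (x i) - h (y i)) ^ s' \<in> fld 1"
          using b(1)[OF i] hk pt[OF that(1) i] pt[OF that(2) i] s'2 by (intro fld_mult fld_power fld_diff) auto
      qed
      show "?D \<subseteq> fld 1 \<times> fld 1"
      proof (rule image_subsetI)
        fix z assume "z \<in> E \<times> E"
        then have "fst (fst z) \<in> points F d" "snd (fst z) \<in> points F d" "fst (snd z) \<in> points F d" "snd (snd z) \<in> points F d"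
          using E by auto
        then show "(case z of (x, y) \<Rightarrow> (?N (fst x) (fst y), ?N (snd x) (snd y))) \<in> fld 1 \<times> fld 1"
          unfolding case_prod_beta by (intro SigmaI N)
      qed
    qed
    ultimately have "card ?D = card (?g ` distance_pairs F d s a E)"
      using card_image[of ?P ?D] by (simp only:)
    also have "\<dots> \<le> card (distance_pairs F d s a E)" by (rule card_image_le[OF findp])
    finally show ?thesis by (simp only: of_nat_le_iff)
  qed
  finally show "real (card (distance_pairs F d s a E)) \<ge> 1 / (1 + 3 * real s ^ (4 * d)) * (real (order F))\<^sup>2"
    by simp
qed

end
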